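(* \textsc{Node Multiway Cut} can be solved in time $(w+3)^{2w}\cdot n^{O(1)}$ if a $w$-expression of the input graph $G$ is given, where $n=|V(G)|$.
   Context: \textsc{Node Multiway Cut}: given a finite simple graph $G$, a set of terminals $T\subseteq V(G)$ and an integer $k$, decide whether there is a set $S\subseteq V(G)\setminus T$ with $|S|\le k$ such that no two distinct terminals are connected by a path in $G-S$. A $w$-expression describes a vertex-labeled graph with labels in $[w]$, built recursively by the operations: $i(v)$ creates a single vertex $v$ with label $i$; $\Phi'\oplus\Phi''$ is the disjoint union; $\eta_{i\to j}(\Phi')$ relabels every vertex of label $i$ to label $j$; $\rho_{i,j}(\Phi')$ adds all edges between vertices of label $i$ and vertices of label $j$. The graph $G$ is given together with a $w$-expression whose described graph (ignoring labels) is $G$. *)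

theory Defs
  imports "Graph_Theory.Graph_Theory"
begin

section \<open>Node Multiway Cut\<close>

text \<open>
  A finite simple undirected graph is a \<^locale>\<open>pair_graph\<close>, in which every edge is
  represented by its two arcs.
\<close>

definition delete_verts :: "'a pair_pre_digraph \<Rightarrow> 'a set \<Rightarrow> ('a, 'a \<times> 'a) pre_digraph" where
  "delete_verts G S = with_proj G \<restriction> (pverts G - S)"

definition multiway_cut :: "'a pair_pre_digraph \<Rightarrow> 'a set \<Rightarrow> 'a set \<Rightarrow> bool" where
  "multiway_cut G T S \<longleftrightarrow> S \<subseteq> pverts G - T \<and>
     (\<forall>s\<in>T. \<forall>t\<in>T. s \<noteq> t \<longrightarrow> \<not> (\<exists>p. pre_digraph.apath (delete_verts G S) s p t))"

definition node_multiway_cut :: "'a pair_pre_digraph \<Rightarrow> 'a set \<Rightarrow> int \<Rightarrow> bool" where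
  "node_multiway_cut G T k \<longleftrightarrow> (\<exists>S. multiway_cut G T S \<and> int (card S) \<le> k)"


section \<open>Clique-width expressions\<close>

datatype 'a wexp =
    Vertex nat 'a
  | DUnion "'a wexp" "'a wexp"
  | Relabel nat nat "'a wexp"
  | Join nat nat "'a wexp"

primrec wverts :: "'a wexp \<Rightarrow> 'a set" where
  "wverts (Vertex i v) = {v}"
| "wverts (DUnion \<phi> \<psi>) = wverts \<phi> \<union> wverts \<psi>"
| "wverts (Relabel i j \<phi>) = wverts \<phi>"
| "wverts (Join i j \<phi>) = wverts \<phi>"

text \<open>The label function is only meaningful on \<^const>\<open>wverts\<close>.\<close>

primrec wlabel :: "'a wexp \<Rightarrow> 'a \<Rightarrow> nat" where
  "wlabel (Vertex i v) = (\<lambda>x. i)"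
| "wlabel (DUnion \<phi> \<psi>) = (\<lambda>x. if x \<in> wverts \<phi> then wlabel \<phi> x else wlabel \<psi> x)"
| "wlabel (Relabel i j \<phi>) = (\<lambda>x. if wlabel \<phi> x = i then j else wlabel \<phi> x)"
| "wlabel (Join i j \<phi>) = wlabel \<phi>"

primrec warcs :: "'a wexp \<Rightarrow> ('a \<times> 'a) set" where
  "warcs (Vertex i v) = {}"
| "warcs (DUnion \<phi> \<psi>) = warcs \<phi> \<union> warcs \<psi>"
| "warcs (Relabel i j \<phi>) = warcs \<phi>"
| "warcs (Join i j \<phi>) = warcs \<phi> \<union>
     {(u, v). u \<in> wverts \<phi> \<and> v \<in> wverts \<phi> \<and>
              (wlabel \<phi> u = i \<and> wlabel \<phi> v = j \<or> wlabel \<phi> u = j \<and> wlabel \<phi> v = i)}"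

definition wgraph :: "'a wexp \<Rightarrow> 'a pair_pre_digraph" where
  "wgraph \<phi> = \<lparr>pverts = wverts \<phi>, parcs = warcs \<phi>\<rparr>"

text \<open>
  Labels come from \<open>[w] = {1..w}\<close>; unions are disjoint, so every vertex is created once;
  and, as usual, a join takes two different labels (otherwise it would create loops).
\<close>

primrec w_expression :: "nat \<Rightarrow> 'a wexp \<Rightarrow> bool" where
  "w_expression w (Vertex i v) \<longleftrightarrow> i \<in> {1..w}"
| "w_expression w (DUnion \<phi> \<psi>) \<longleftrightarrow>
     w_expression w \<phi> \<and> w_expression w \<psi> \<and> wverts \<phi> \<inter> wverts \<psi> = {}"
| "w_expression w (Relabel i j \<phi>) \<longleftrightarrow> i \<in> {1..w} \<and> j \<in> {1..w} \<and> w_expression w \<phi>"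
| "w_expression w (Join i j \<phi>) \<longleftrightarrow>
     i \<in> {1..w} \<and> j \<in> {1..w} \<and> i \<noteq> j \<and> w_expression w \<phi>"


section \<open>Model of computation\<close>

text \<open>
  Programs are written in a first-order, call-by-value functional language over binary trees,
  in the style of Jones' languages F and WHILE (\<open>Computability and Complexity from a Programming
  Perspective\<close>). The only operations on data are constructing a node, taking a node apart, and
  testing for a leaf. Every evaluated subexpression costs one unit of time. With trees stored as
  pointers, a program running for \<open>t\<close> steps is simulated in \<open>O(t)\<close> steps by a unit-cost RAM with
  \<open>O(log t)\<close>-bit words (for a fixed program, after reading the input), and the model is polynomially
  equivalent to Turing machines. There is no unit-cost arithmetic: numbers are lists of bits.
\<close>

datatype data = Leaf | Node data data

text \<open>
  A program is a list of function bodies. \<open>Var i\<close> refers to the \<open>i\<close>-th argument of the enclosing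
  function, and \<open>Call f es\<close> calls the \<open>f\<close>-th function of the program. An unbound variable or a call
  of a missing function has no value. \<open>Fst\<close> and \<open>Snd\<close> of a leaf are a leaf.
\<close>

datatype expr =
    Var nat
  | MkLeaf
  | MkNode expr expr
  | Fst expr
  | Snd expr
  | Cond expr expr expr
  | Call nat "expr list"

type_synonym program = "expr list"

primrec left :: "data \<Rightarrow> data" where
  "left Leaf = Leaf"
| "left (Node x y) = x"

primrec right :: "data \<Rightarrow> data" where
  "right Leaf = Leaf"
| "right (Node x y) = y"

inductive
  eval :: "program \<Rightarrow> data list \<Rightarrow> expr \<Rightarrow> data \<Rightarrow> nat \<Rightarrow> bool" and
  evals :: "program \<Rightarrow> data list \<Rightarrow> expr list \<Rightarrow> data list \<Rightarrow> nat \<Rightarrow> bool"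
  for P :: program
where
  eval_Var: "i < length env \<Longrightarrow> eval P env (Var i) (env ! i) 1"
| eval_MkLeaf: "eval P env MkLeaf Leaf 1"
| eval_MkNode: "eval P env e1 x s \<Longrightarrow> eval P env e2 y t \<Longrightarrow>
    eval P env (MkNode e1 e2) (Node x y) (s + t + 1)"
| eval_Fst: "eval P env e x t \<Longrightarrow> eval P env (Fst e) (left x) (t + 1)"
| eval_Snd: "eval P env e x t \<Longrightarrow> eval P env (Snd e) (right x) (t + 1)"
| eval_CondT: "eval P env b x s \<Longrightarrow> x \<noteq> Leaf \<Longrightarrow> eval P env e1 y t \<Longrightarrow>
    eval P env (Cond b e1 e2) y (s + t + 1)"
| eval_CondF: "eval P env b Leaf s \<Longrightarrow> eval P env e2 y t \<Longrightarrow>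
    eval P env (Cond b e1 e2) y (s + t + 1)"
| eval_Call: "f < length P \<Longrightarrow> evals P env es xs s \<Longrightarrow> eval P xs (P ! f) y t \<Longrightarrow>
    eval P env (Call f es) y (s + t + 1)"
| evals_Nil: "evals P env [] [] 0"
| evals_Cons: "eval P env e x s \<Longrightarrow> evals P env es xs t \<Longrightarrow>
    evals P env (e # es) (x # xs) (s + t)"

text \<open>A program is started by calling its function \<open>0\<close> on the input.\<close>

definition runs :: "program \<Rightarrow> data \<Rightarrow> data \<Rightarrow> nat \<Rightarrow> bool" where
  "runs P x y t \<longleftrightarrow> eval P [x] (Call 0 [Var 0]) y t"

inductive_cases eval_elims:
  "eval P env (Var i) x t" "eval P env MkLeaf x t" "eval P env (MkNode e1 e2) x t"
  "eval P env (Fst e) x t" "eval P env (Snd e) x t" "eval P env (Cond b e1 e2) x t"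
  "eval P env (Call f es) x t" "evals P env [] xs t" "evals P env (e # es) xs t"

lemma eval_deterministic:
  "eval P env e x s \<Longrightarrow> (\<And>x' s'. eval P env e x' s' \<Longrightarrow> x' = x \<and> s' = s)"
  "evals P env es xs s \<Longrightarrow> (\<And>xs' s'. evals P env es xs' s' \<Longrightarrow> xs' = xs \<and> s' = s)"
proof (induction rule: eval_evals.inducts)
  case eval_Var
  then show ?case by (auto elim: eval_elims)
next
  case eval_MkLeaf
  then show ?case by (auto elim: eval_elims)
next
  case eval_MkNode
  from eval_MkNode.prems show ?case
    by (auto elim!: eval_elims dest!: eval_MkNode.IH(2) eval_MkNode.IH(4))
next
  case eval_Fst
  from eval_Fst.prems show ?case
    by (auto elim!: eval_elims dest!: eval_Fst.IH(2))
next
  case eval_Snd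
  from eval_Snd.prems show ?case
    by (auto elim!: eval_elims dest!: eval_Snd.IH(2))
next
  case eval_CondT
  from eval_CondT.prems show ?case
    using eval_CondT.hyps by (auto elim!: eval_elims dest!: eval_CondT.IH(2) eval_CondT.IH(4))
next
  case eval_CondF
  from eval_CondF.prems show ?case
    by (auto elim!: eval_elims dest!: eval_CondF.IH(2) eval_CondF.IH(4))
next
  case eval_Call
  from eval_Call.prems show ?case
    by (auto elim!: eval_elims dest!: eval_Call.IH(3) eval_Call.IH(5))
next
  case evals_Nil
  then show ?case by (auto elim: eval_elims)
next
  case evals_Cons
  from evals_Cons.prems show ?case
    by (auto elim!: eval_elims dest!: evals_Cons.IH(2) evals_Cons.IH(4))
qed

theorem runs_deterministic: "runs P x y s \<Longrightarrow> runs P x z t \<Longrightarrow> z = y \<and> t = s"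
  unfolding runs_def by (rule eval_deterministic(1))


section \<open>Encoding of instances\<close>

fun enc_bool :: "bool \<Rightarrow> data" where
  "enc_bool False = Leaf"
| "enc_bool True = Node Leaf Leaf"

fun enc_list :: "data list \<Rightarrow> data" where
  "enc_list [] = Leaf"
| "enc_list (x # xs) = Node x (enc_list xs)"

text \<open>Binary, least significant bit first.\<close>

fun enc_nat :: "nat \<Rightarrow> data" where
  "enc_nat n = (if n = 0 then Leaf else Node (enc_bool (odd n)) (enc_nat (n div 2)))"

declare enc_nat.simps [simp del]

definition enc_int :: "int \<Rightarrow> data" where
  "enc_int k = Node (enc_bool (k < 0)) (enc_nat (nat \<bar>k\<bar>))"

primrec enc_wexp :: "nat wexp \<Rightarrow> data" where
  "enc_wexp (Vertex i v) = enc_list [enc_nat 0, enc_nat i, enc_nat v]"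
| "enc_wexp (DUnion \<phi> \<psi>) = enc_list [enc_nat 1, enc_wexp \<phi>, enc_wexp \<psi>]"
| "enc_wexp (Relabel i j \<phi>) = enc_list [enc_nat 2, enc_nat i, enc_nat j, enc_wexp \<phi>]"
| "enc_wexp (Join i j \<phi>) = enc_list [enc_nat 3, enc_nat i, enc_nat j, enc_wexp \<phi>]"

text \<open>
  Vertices are arbitrary natural numbers, and finite sets are given by listing their elements,
  without repetitions, in an arbitrary order.
\<close>

definition enc_nats :: "nat list \<Rightarrow> data" where
  "enc_nats vs = enc_list (map enc_nat vs)"

definition enc_arcs :: "(nat \<times> nat) list \<Rightarrow> data" where
  "enc_arcs es = enc_list (map (\<lambda>(u, v). Node (enc_nat u) (enc_nat v)) es)"

definition encodes ::
  "data \<Rightarrow> nat pair_pre_digraph \<Rightarrow> nat set \<Rightarrow> int \<Rightarrow> nat wexp \<Rightarrow> bool" where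
  "encodes x G T k \<phi> \<longleftrightarrow> (\<exists>vs es ts.
     distinct vs \<and> set vs = pverts G \<and> distinct es \<and> set es = parcs G \<and>
     distinct ts \<and> set ts = T \<and>
     x = enc_list [enc_nats vs, enc_arcs es, enc_nats ts, enc_int k, enc_wexp \<phi>])"

text \<open>The length of an input, up to a constant factor.\<close>

primrec input_size :: "data \<Rightarrow> nat" where
  "input_size Leaf = 1"
| "input_size (Node x y) = input_size x + input_size y + 1"

text \<open>
  Concerning the time bounds: a \<open>w\<close>-expression, unlike a graph on \<open>n\<close> vertices, can be arbitrarily
  long (and so can vertex names and the binary representation of \<open>k\<close>), and the input has to be read.
  As usual, a bound \<open>f(w)\<close> times a polynomial in \<open>n\<close> thus refers to inputs of length polynomial in
  \<open>n\<close>: for every length bound \<open>d * n ^ d\<close> there is a polynomial factor \<open>C d * n ^ C d\<close>, for the same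
  program. Without a length restriction, the polynomial factor is in the length of the input.
\<close>

end

theory Submission
  imports Defs
begin

text \<open>
  Dynamic programming over the expression. A solution \<open>S\<close> is witnessed by an equivalence relation on
  the vertices outside \<open>S\<close> that contains all remaining edges and never relates two terminals. For a
  subexpression and a label there are three cases: the label has no live vertex; it gets no further
  edge to a live vertex; or it gets one later, and then all its live vertices end up in one class,
  so they may be put into one class right away. Hence a partial solution is described by a partition
  of the labels of the third kind, with one bit per class for the presence of a terminal. A label
  of the third kind either opens a class, with or without a terminal, or joins the class of another
  label, which leaves \<open>w + 3\<close> choices for every label, i.e. at most \<open>(w + 3) ^ w\<close>
  states. Two states determine at most one state of the disjoint union, so all pairs are tried; the
  results are deduplicated by a trie in time polynomial per pair. The number of deleted vertices is
  part of the table keys.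
\<close>

section \<open>Time-bounded evaluation\<close>

text \<open>The live vertices of one label may lie in many components, so recording exact
  connectivity would make a state a family of label sets, far too many. Allowing any separating
  equivalence relation instead of connectivity removes this: coarsening is harmless as long as no
  class receives two terminals, and because a class has at most one terminal, a single bit detects
  every forbidden merge. Completeness is a comparison with a fixed solution, given as a symmetric
  and transitive relation \<open>Q\<close>. Each operation produces the least relation that its
  merges force; this stays inside \<open>Q\<close>, and inside \<open>Q\<close> no merge can fail.
  Whether a label gets a later edge is guessed when a vertex is created. The guess is carried along
  unchanged and may be withdrawn only after a join, which may have supplied the last edge. Keeping
  the number of deletions in the keys costs a factor \<open>n + 1\<close> per table and spares the
  computation of minima. The exponent \<open>2 * w\<close> is caused by the pairs in a disjoint
  union alone; the other operations are linear in the length of the table, up to polynomial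
  factors.\<close>

definition takes :: "program \<Rightarrow> data list \<Rightarrow> expr \<Rightarrow> data \<Rightarrow> nat \<Rightarrow> bool" where
  "takes P env e x b \<longleftrightarrow> (\<exists>t\<le>b. eval P env e x t)"

definition takes_list :: "program \<Rightarrow> data list \<Rightarrow> expr list \<Rightarrow> data list \<Rightarrow> nat \<Rightarrow> bool" where
  "takes_list P env es xs b \<longleftrightarrow> (\<exists>t\<le>b. evals P env es xs t)"

text \<open>Costs are upper bounds rather than exact step counts, so that they can be rounded up and
  added along an expression. The overhead of the call itself is charged in
  \<open>takes_Call\<close>.\<close>

definition computes :: "program \<Rightarrow> nat \<Rightarrow> data list \<Rightarrow> data \<Rightarrow> nat \<Rightarrow> bool" where
  "computes P f xs y b \<longleftrightarrow> f < length P \<and> takes P xs (P ! f) y b"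

lemma takes_mono: "takes P env e x b \<Longrightarrow> x = y \<Longrightarrow> b \<le> c \<Longrightarrow> takes P env e y c"
  unfolding takes_def using le_trans by blast

lemma computesI:
  "f < length P \<Longrightarrow> P ! f = e \<Longrightarrow> takes P xs e x b \<Longrightarrow> x = y \<Longrightarrow> b \<le> c \<Longrightarrow> computes P f xs y c"
  unfolding computes_def using takes_mono by blast

lemma computes_mono: "computes P f xs y b \<Longrightarrow> y = z \<Longrightarrow> b \<le> c \<Longrightarrow> computes P f xs z c"
  unfolding computes_def using takes_mono by blast

lemma takes_Var:
  "takes P (x0 # env) (Var 0) x0 1"
  "takes P (x0 # x1 # env) (Var 1) x1 1"
  "takes P (x0 # x1 # x2 # env) (Var 2) x2 1"
  "takes P (x0 # x1 # x2 # x3 # env) (Var 3) x3 1"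
  unfolding takes_def
  using eval_Var[of 0 "x0 # env" P] eval_Var[of 1 "x0 # x1 # env" P]
    eval_Var[of 2 "x0 # x1 # x2 # env" P] eval_Var[of 3 "x0 # x1 # x2 # x3 # env" P]
  by auto

lemma takes_MkLeaf: "takes P env MkLeaf Leaf 1"
  unfolding takes_def using eval_MkLeaf by blast

lemma takes_MkNode:
  assumes "takes P env e1 x s" "takes P env e2 y t"
  shows "takes P env (MkNode e1 e2) (Node x y) (s + t + 1)"
proof -
  obtain s' t' where "s' \<le> s" "t' \<le> t" "eval P env e1 x s'" "eval P env e2 y t'"
    using assms unfolding takes_def by blast
  then show ?thesis
    unfolding takes_def by (intro exI[of _ "s' + t' + 1"]) (simp add: eval_MkNode[simplified])
qed

lemma takes_Fst: "takes P env e x t \<Longrightarrow> takes P env (Fst e) (left x) (t + 1)"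
  unfolding takes_def by (metis eval_Fst add_le_mono1)

lemma takes_Snd: "takes P env e x t \<Longrightarrow> takes P env (Snd e) (right x) (t + 1)"
  unfolding takes_def by (metis eval_Snd add_le_mono1)

text \<open>Each branch only has to terminate under the outcome that selects it. Recursive functions
  depend on this: the induction hypothesis for a recursive call becomes available only when the
  guard shows that the argument shrinks.\<close>

lemma takes_Cond:
  assumes "takes P env b x s" "x \<noteq> Leaf \<Longrightarrow> takes P env e1 y1 t1" "x = Leaf \<Longrightarrow> takes P env e2 y2 t2"
  shows "takes P env (Cond b e1 e2) (if x = Leaf then y2 else y1)
    (s + (if x = Leaf then t2 else t1) + 1)"
proof -
  obtain s' where s': "s' \<le> s" "eval P env b x s'"
    using assms(1) unfolding takes_def by blast
  show ?thesis
  proof (cases "x = Leaf")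
    case True
    with assms(3) obtain t' where "t' \<le> t2" "eval P env e2 y2 t'"
      unfolding takes_def by blast
    with s' True show ?thesis
      unfolding takes_def by (intro exI[of _ "s' + t' + 1"]) (simp add: eval_CondF[simplified])
  next
    case False
    with assms(2) obtain t' where "t' \<le> t1" "eval P env e1 y1 t'"
      unfolding takes_def by blast
    with s' False show ?thesis
      unfolding takes_def by (intro exI[of _ "s' + t' + 1"]) (simp add: eval_CondT[simplified])
  qed
qed

lemma takes_Call:
  assumes "takes_list P env es xs s" "computes P f xs y t"
  shows "takes P env (Call f es) y (s + t + 1)"
proof -
  obtain s' t' where "s' \<le> s" "t' \<le> t" "f < length P" "evals P env es xs s'" "eval P xs (P ! f) y t'"
    using assms unfolding takes_def takes_list_def computes_def by blast
  then show ?thesis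
    unfolding takes_def by (intro exI[of _ "s' + t' + 1"]) (simp add: eval_Call[simplified])
qed

lemma takes_list_Nil: "takes_list P env [] [] 0"
  unfolding takes_list_def using evals_Nil by blast

lemma takes_list_Cons:
  assumes "takes P env e x s" "takes_list P env es xs t"
  shows "takes_list P env (e # es) (x # xs) (s + t)"
proof -
  obtain s' t' where "s' \<le> s" "t' \<le> t" "eval P env e x s'" "evals P env es xs t'"
    using assms unfolding takes_def takes_list_def by blast
  then show ?thesis
    unfolding takes_list_def by (intro exI[of _ "s' + t'"]) (simp add: evals_Cons)
qed

lemmas takes_rules = takes_Var takes_MkLeaf takes_MkNode takes_Fst takes_Snd takes_Cond takes_Call
  takes_list_Nil takes_list_Cons

lemma input_size_left_less [simp]: "x \<noteq> Leaf \<Longrightarrow> input_size (left x) < input_size x"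
  by (cases x) auto

lemma input_size_right_less [simp]: "x \<noteq> Leaf \<Longrightarrow> input_size (right x) < input_size x"
  by (cases x) auto

lemma input_size_right_le: "input_size (right x) \<le> input_size x"
  by (cases x) auto

lemma input_size_pos [simp]: "1 \<le> input_size x"
  by (cases x) auto

text \<open>Trees and lists of trees are in bijection along the right spine, so every tree can be
  treated as a list without a validity condition.\<close>

primrec items :: "data \<Rightarrow> data list" where
  "items Leaf = []"
| "items (Node x y) = x # items y"

abbreviation len :: "data \<Rightarrow> nat" where
  "len x \<equiv> length (items x)"

lemma items_enc_list [simp]: "items (enc_list xs) = xs"
  by (induction xs) auto

lemma items_inject [simp]: "items x = items y \<longleftrightarrow> x = y"
proof (induction x arbitrary: y)
  case Leaf
  then show ?case by (cases y) auto
next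
  case (Node x1 x2)
  then show ?case by (cases y) auto
qed

abbreviation one :: data where "one \<equiv> Node Leaf Leaf"
abbreviation One :: expr where "One \<equiv> MkNode MkLeaf MkLeaf"

lemma enc_bool_if: "enc_bool b = (if b then one else Leaf)"
  by (cases b) auto

section \<open>The program\<close>

abbreviation (input) "f_eq \<equiv> 1 :: nat"
abbreviation (input) "f_assoc \<equiv> 2 :: nat"
abbreviation (input) "f_upd \<equiv> 3 :: nat"
abbreviation (input) "f_subst \<equiv> 4 :: nat"
abbreviation (input) "f_merge \<equiv> 5 :: nat"
abbreviation (input) "f_relab \<equiv> 6 :: nat"
abbreviation (input) "f_join \<equiv> 7 :: nat"
abbreviation (input) "f_forget \<equiv> 8 :: nat"
abbreviation (input) "f_app \<equiv> 9 :: nat"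
abbreviation (input) "f_tag_value \<equiv> 10 :: nat"
abbreviation (input) "f_tag \<equiv> 11 :: nat"
abbreviation (input) "f_fuse \<equiv> 12 :: nat"
abbreviation (input) "f_first \<equiv> 13 :: nat"
abbreviation (input) "f_canon_value \<equiv> 14 :: nat"
abbreviation (input) "f_canon_list \<equiv> 15 :: nat"
abbreviation (input) "f_canon \<equiv> 16 :: nat"
abbreviation (input) "f_mem \<equiv> 17 :: nat"
abbreviation (input) "f_ins \<equiv> 18 :: nat"
abbreviation (input) "f_clean \<equiv> 19 :: nat"
abbreviation (input) "f_clean_step \<equiv> 20 :: nat"
abbreviation (input) "f_relab_table \<equiv> 21 :: nat"
abbreviation (input) "f_join_table \<equiv> 22 :: nat"
abbreviation (input) "f_forget_table \<equiv> 23 :: nat"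
abbreviation (input) "f_union_row \<equiv> 24 :: nat"
abbreviation (input) "f_union_table \<equiv> 25 :: nat"
abbreviation (input) "f_blank \<equiv> 26 :: nat"
abbreviation (input) "f_elem \<equiv> 27 :: nat"
abbreviation (input) "f_leaf_table \<equiv> 28 :: nat"
abbreviation (input) "f_table \<equiv> 29 :: nat"
abbreviation (input) "f_labels \<equiv> 30 :: nat"
abbreviation (input) "f_add \<equiv> 31 :: nat"
abbreviation (input) "f_half \<equiv> 32 :: nat"
abbreviation (input) "f_leq \<equiv> 33 :: nat"
abbreviation (input) "f_accept \<equiv> 34 :: nat"

text \<open>Each body, except that of \<open>main\<close>, implements the function of the same name below.\<close>

definition main_body :: expr where
  "main_body =
  Cond (Fst (Fst (Snd (Snd (Snd (Var 0))))))
    MkLeaf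
    (Call f_accept
      [Call f_table
        [Fst (Snd (Snd (Snd (Snd (Var 0))))),
         Call f_labels [Fst (Snd (Snd (Snd (Snd (Var 0))))), MkLeaf],
         Fst (Snd (Snd (Var 0)))],
       Snd (Fst (Snd (Snd (Snd (Var 0)))))])"

definition eq_body :: expr where
  "eq_body =
  Cond (Var 0)
    (Cond (Var 1)
      (Cond (Call f_eq [Fst (Var 0), Fst (Var 1)])
        (Call f_eq [Snd (Var 0), Snd (Var 1)])
        MkLeaf)
      MkLeaf)
    (Cond (Var 1) MkLeaf One)"

definition assoc_body :: expr where
  "assoc_body =
  Cond (Var 0)
    (Cond (Call f_eq [Fst (Fst (Var 0)), Var 1])
      (Snd (Fst (Var 0)))
      (Call f_assoc [Snd (Var 0), Var 1]))
    MkLeaf"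

definition upd_body :: expr where
  "upd_body =
  Cond (Var 0)
    (MkNode
      (Cond (Call f_eq [Fst (Fst (Var 0)), Var 1])
        (MkNode (Var 1) (Var 2))
        (Fst (Var 0)))
      (Call f_upd [Snd (Var 0), Var 1, Var 2]))
    MkLeaf"

definition subst_body :: expr where
  "subst_body =
  Cond (Var 0)
    (MkNode
      (Cond (Call f_eq [Snd (Fst (Var 0)), Var 1])
        (MkNode (Fst (Fst (Var 0))) (Var 2))
        (Fst (Var 0)))
      (Call f_subst [Snd (Var 0), Var 1, Var 2]))
    MkLeaf"

definition merge_body :: expr where
  "merge_body =
  Cond (Call f_eq [Var 1, Var 2])
    (Var 0)
    (Cond (Fst (Var 1))
      (Cond (Fst (Var 2))
        (Cond (Snd (Var 1))
          (Cond (Snd (Var 2))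
            MkLeaf
            (Call f_subst [Var 0, Var 2, Var 1]))
          (Call f_subst [Var 0, Var 1, Var 2]))
        MkLeaf)
      MkLeaf)"

definition relab_body :: expr where
  "relab_body =
  Cond (Call f_eq [Var 1, Var 2])
    (Var 0)
    (Cond (Call f_assoc [Var 0, Var 1])
      (Call f_upd
        [Cond (Call f_assoc [Var 0, Var 2])
           (Call f_merge [Var 0, Call f_assoc [Var 0, Var 1], Call f_assoc [Var 0, Var 2]])
           (Call f_upd [Var 0, Var 2, Call f_assoc [Var 0, Var 1]]),
         Var 1, MkLeaf])
      (Var 0))"

definition join_body :: expr where
  "join_body =
  Cond (Call f_assoc [Var 0, Var 1])
    (Cond (Call f_assoc [Var 0, Var 2])
      (Cond (Fst (Call f_assoc [Var 0, Var 1]))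
        (Cond (Fst (Call f_assoc [Var 0, Var 2]))
          (Call f_merge [Var 0, Call f_assoc [Var 0, Var 1], Call f_assoc [Var 0, Var 2]])
          MkLeaf)
        MkLeaf)
      (Var 0))
    (Var 0)"

definition forget_body :: expr where
  "forget_body =
  Cond (Call f_assoc [Var 0, Var 1])
    (Call f_upd [Var 0, Var 1, One])
    (Var 0)"

definition app_body :: expr where
  "app_body =
  Cond (Var 0)
    (MkNode (Fst (Var 0)) (Call f_app [Snd (Var 0), Var 1]))
    (Var 1)"

definition tag_value_body :: expr where
  "tag_value_body =
  Cond (Fst (Var 0))
    (MkNode (MkNode (Fst (Var 0)) MkLeaf) (Snd (Var 0)))
    (Var 0)"

definition tag_body :: expr where
  "tag_body =
  Cond (Var 0)
    (MkNode
      (MkNode (MkNode (Fst (Fst (Var 0))) MkLeaf) (Call f_tag_value [Snd (Fst (Var 0))]))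
      (Call f_tag [Snd (Var 0)]))
    MkLeaf"

definition fuse_body :: expr where
  "fuse_body =
  Cond (Var 0)
    (Call f_fuse
      [Snd (Var 0),
       Call f_relab [Var 1, MkNode (Fst (Var 0)) MkLeaf, Fst (Var 0)]])
    (Var 1)"

definition first_body :: expr where
  "first_body =
  Cond (Var 0)
    (Cond (Call f_eq [Call f_assoc [Var 1, Fst (Var 0)], Var 2])
      (Fst (Var 0))
      (Call f_first [Snd (Var 0), Var 1, Var 2]))
    MkLeaf"

definition canon_value_body :: expr where
  "canon_value_body =
  Cond (Var 2)
    (Cond (Fst (Var 2))
      (MkNode (Call f_first [Var 0, Var 1, Var 2]) (Cond (Snd (Var 2)) One MkLeaf))
      One)
    MkLeaf"

definition canon_list_body :: expr where
  "canon_list_body =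
  Cond (Var 0)
    (MkNode
      (MkNode (Fst (Var 0))
        (Call f_canon_value [Var 1, Var 2, Call f_assoc [Var 2, Fst (Var 0)]]))
      (Call f_canon_list [Snd (Var 0), Var 1, Var 2]))
    MkLeaf"

definition canon_body :: expr where
  "canon_body =
  Cond (Var 1) (Call f_canon_list [Var 0, Var 0, Var 1]) MkLeaf"

definition mem_body :: expr where
  "mem_body =
  Cond (Var 1)
    (Cond (Fst (Var 1))
      (Call f_mem
        [Snd (Var 0),
         MkNode (Fst (Fst (Var 1))) (MkNode (Snd (Fst (Var 1))) (Snd (Var 1)))])
      (Call f_mem [Fst (Var 0), Snd (Var 1)]))
    (Cond (Var 0) One MkLeaf)"

definition ins_body :: expr where
  "ins_body =
  Cond (Var 1)
    (Cond (Fst (Var 1))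
      (MkNode (Fst (Var 0))
        (Call f_ins
          [Snd (Var 0),
           MkNode (Fst (Fst (Var 1))) (MkNode (Snd (Fst (Var 1))) (Snd (Var 1)))]))
      (MkNode (Call f_ins [Fst (Var 0), Snd (Var 1)]) (Snd (Var 0))))
    One"

definition clean_body :: expr where
  "clean_body =
  Cond (Var 0)
    (Call f_clean_step
      [MkNode (Call f_canon [Var 2, Fst (Fst (Var 0))]) (Snd (Fst (Var 0))),
       Snd (Var 0), Var 1, Var 2])
    MkLeaf"

definition clean_step_body :: expr where
  "clean_step_body =
  Cond (Fst (Var 0))
    (Cond (Call f_mem [Var 2, MkNode (Var 0) MkLeaf])
      (Call f_clean [Var 1, Var 2, Var 3])
      (MkNode (Var 0)
        (Call f_clean [Var 1, Call f_ins [Var 2, MkNode (Var 0) MkLeaf], Var 3])))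
    (Call f_clean [Var 1, Var 2, Var 3])"

definition relab_table_body :: expr where
  "relab_table_body =
  Cond (Var 0)
    (MkNode
      (MkNode (Call f_relab [Fst (Fst (Var 0)), Var 1, Var 2]) (Snd (Fst (Var 0))))
      (Call f_relab_table [Snd (Var 0), Var 1, Var 2]))
    MkLeaf"

definition join_table_body :: expr where
  "join_table_body =
  Cond (Var 0)
    (MkNode
      (MkNode (Call f_join [Fst (Fst (Var 0)), Var 1, Var 2]) (Snd (Fst (Var 0))))
      (Call f_join_table [Snd (Var 0), Var 1, Var 2]))
    MkLeaf"

definition forget_table_body :: expr where
  "forget_table_body =
  Cond (Var 0)
    (MkNode
      (Fst (Var 0))
      (MkNode
        (MkNode (Call f_forget [Fst (Fst (Var 0)), Var 1]) (Snd (Fst (Var 0))))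
        (Call f_forget_table [Snd (Var 0), Var 1])))
    MkLeaf"

definition union_row_body :: expr where
  "union_row_body =
  Cond (Var 1)
    (MkNode
      (MkNode
        (Call f_fuse
          [Var 2, Call f_app [Fst (Var 0), Call f_tag [Fst (Fst (Var 1))]]])
        (Call f_app [Snd (Var 0), Snd (Fst (Var 1))]))
      (Call f_union_row [Var 0, Snd (Var 1), Var 2, Var 3]))
    (Var 3)"

definition union_table_body :: expr where
  "union_table_body =
  Cond (Var 0)
    (Call f_union_row
      [Fst (Var 0), Var 1, Var 2, Call f_union_table [Snd (Var 0), Var 1, Var 2]])
    MkLeaf"

definition blank_body :: expr where
  "blank_body =
  Cond (Var 0)
    (MkNode (MkNode (Fst (Var 0)) MkLeaf) (Call f_blank [Snd (Var 0)]))
    MkLeaf"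

definition elem_body :: expr where
  "elem_body =
  Cond (Var 0)
    (Cond (Call f_eq [Fst (Var 0), Var 1])
      One
      (Call f_elem [Snd (Var 0), Var 1]))
    MkLeaf"

definition leaf_table_body :: expr where
  "leaf_table_body =
  MkNode
    (MkNode (Call f_upd [Call f_blank [Var 0], Var 2, One]) MkLeaf)
    (MkNode
      (MkNode
        (Call f_upd
          [Call f_blank [Var 0], Var 2, MkNode (Var 2) (Call f_elem [Var 1, Var 3])])
        MkLeaf)
      (Cond (Call f_elem [Var 1, Var 3])
        MkLeaf
        (MkNode (MkNode (Call f_blank [Var 0]) One) MkLeaf)))"

text \<open>The constructor is recognised from the binary digits of its tag, least significant
  first: 0 is \<open>Leaf\<close>, 1 has nothing after its first digit, and 2 and 3 differ in the
  first digit.\<close>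

definition table_body :: expr where
  "table_body =
  Cond (Fst (Var 0))
    (Cond (Snd (Fst (Var 0)))
      (Cond (Fst (Fst (Var 0)))
        (Call f_clean
          [Call f_forget_table
            [Call f_forget_table
              [Call f_join_table
                [Call f_table [Fst (Snd (Snd (Snd (Var 0)))), Var 1, Var 2],
                 Fst (Snd (Var 0)), Fst (Snd (Snd (Var 0)))],
               Fst (Snd (Var 0))],
             Fst (Snd (Snd (Var 0)))],
           MkLeaf, Var 1])
        (Call f_clean
          [Call f_relab_table
            [Call f_table [Fst (Snd (Snd (Snd (Var 0)))), Var 1, Var 2],
             Fst (Snd (Var 0)), Fst (Snd (Snd (Var 0)))],
           MkLeaf, Var 1]))
      (Call f_clean
        [Call f_union_table
          [Call f_table [Fst (Snd (Var 0)), Var 1, Var 2],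
           Call f_table [Fst (Snd (Snd (Var 0))), Var 1, Var 2],
           Var 1],
         MkLeaf, Var 1]))
    (Call f_leaf_table [Var 1, Var 2, Fst (Snd (Var 0)), Fst (Snd (Snd (Var 0)))])"

definition labels_body :: expr where
  "labels_body =
  Cond (Fst (Var 0))
    (Cond (Snd (Fst (Var 0)))
      (Call f_add [Fst (Snd (Var 0)), Call f_add [Fst (Snd (Snd (Var 0))),
        Call f_labels [Fst (Snd (Snd (Snd (Var 0)))), Var 1]]])
      (Call f_labels [Fst (Snd (Var 0)), Call f_labels [Fst (Snd (Snd (Var 0))), Var 1]]))
    (Call f_add [Fst (Snd (Var 0)), Var 1])"

definition add_body :: expr where
  "add_body =
  Cond (Call f_elem [Var 1, Var 0]) (Var 1) (MkNode (Var 0) (Var 1))"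

definition half_body :: expr where
  "half_body =
  Cond (Var 0) (MkNode MkLeaf (Call f_half [Snd (Snd (Var 0))])) MkLeaf"

definition leq_body :: expr where
  "leq_body =
  Cond (Var 1)
    (Call f_leq
      [Call f_half [Cond (Fst (Var 1)) (Snd (Var 0)) (Var 0)], Snd (Var 1)])
    (Cond (Var 0) MkLeaf One)"

definition accept_body :: expr where
  "accept_body =
  Cond (Var 0)
    (Cond (Call f_leq [Snd (Fst (Var 0)), Var 1])
      One
      (Call f_accept [Snd (Var 0), Var 1]))
    MkLeaf"

definition prog :: program where
  "prog =
   [main_body, eq_body, assoc_body, upd_body,
    subst_body, merge_body, relab_body, join_body,
    forget_body, app_body, tag_value_body, tag_body,
    fuse_body, first_body, canon_value_body, canon_list_body,
    canon_body, mem_body, ins_body, clean_body,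
    clean_step_body, relab_table_body, join_table_body, forget_table_body,
    union_row_body, union_table_body, blank_body, elem_body,
    leaf_table_body, table_body, labels_body, add_body,
    half_body, leq_body, accept_body]"

lemma prog_nth:
  "prog ! f_eq = eq_body"
  "prog ! f_assoc = assoc_body"
  "prog ! f_upd = upd_body"
  "prog ! f_subst = subst_body"
  "prog ! f_merge = merge_body"
  "prog ! f_relab = relab_body"
  "prog ! f_join = join_body"
  "prog ! f_forget = forget_body"
  "prog ! f_app = app_body"
  "prog ! f_tag_value = tag_value_body"
  "prog ! f_tag = tag_body"
  "prog ! f_fuse = fuse_body"
  "prog ! f_first = first_body"
  "prog ! f_canon_value = canon_value_body"
  "prog ! f_canon_list = canon_list_body"
  "prog ! f_canon = canon_body"
  "prog ! f_mem = mem_body"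
  "prog ! f_ins = ins_body"
  "prog ! f_clean = clean_body"
  "prog ! f_clean_step = clean_step_body"
  "prog ! f_relab_table = relab_table_body"
  "prog ! f_join_table = join_table_body"
  "prog ! f_forget_table = forget_table_body"
  "prog ! f_union_row = union_row_body"
  "prog ! f_union_table = union_table_body"
  "prog ! f_blank = blank_body"
  "prog ! f_elem = elem_body"
  "prog ! f_leaf_table = leaf_table_body"
  "prog ! f_table = table_body"
  "prog ! f_labels = labels_body"
  "prog ! f_add = add_body"
  "prog ! f_half = half_body"
  "prog ! f_leq = leq_body"
  "prog ! f_accept = accept_body"
  "prog ! 0 = main_body"
  by (simp_all add: prog_def)

lemma length_prog [simp]: "length prog = 35"
  by (simp add: prog_def)

section \<open>Operations on states and tables\<close>

text \<open>
  A state is an association list from labels to values, where \<^term>\<open>one\<close> is the value of labels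
  without further edges and \<open>Node r b\<close> with \<open>r \<noteq> Leaf\<close> stands for a class with name \<open>r\<close> and terminal
  bit \<open>b\<close>. In place of a state, \<^const>\<open>Leaf\<close> signals failure. The keys in a table are pairs of a state
  and the number of deleted vertices in unary.
\<close>

fun assoc :: "data \<Rightarrow> data \<Rightarrow> data" where
  "assoc Leaf a = Leaf"
| "assoc (Node e s) a = (if left e = a then right e else assoc s a)"

fun upd :: "data \<Rightarrow> data \<Rightarrow> data \<Rightarrow> data" where
  "upd Leaf a v = Leaf"
| "upd (Node e s) a v = Node (if left e = a then Node a v else e) (upd s a v)"

fun subst :: "data \<Rightarrow> data \<Rightarrow> data \<Rightarrow> data" where
  "subst Leaf u v = Leaf"
| "subst (Node e s) u v = Node (if right e = u then Node (left e) v else e) (subst s u v)"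

text \<open>The class without a terminal is renamed to the other one, so the surviving value already
  carries the correct bit. Failure has two causes: both classes contain a terminal, or only one of
  the two values is a class, i.e. the guesses about later edges disagree.\<close>

definition merge :: "data \<Rightarrow> data \<Rightarrow> data \<Rightarrow> data" where
  "merge s u v =
    (if u = v then s
     else if left u = Leaf \<or> left v = Leaf then Leaf
     else if right u = Leaf then subst s u v
     else if right v = Leaf then subst s v u
     else Leaf)"

definition relab :: "data \<Rightarrow> data \<Rightarrow> data \<Rightarrow> data" where
  "relab s a b =
    (if a = b \<or> assoc s a = Leaf then s
     else upd (if assoc s b = Leaf then upd s b (assoc s a) else merge s (assoc s a) (assoc s b))
       a Leaf)"

text \<open>An edge between two live labels refutes the guess that one of them gets no further edge,
  hence the failure unless both are classes.\<close>

definition join :: "data \<Rightarrow> data \<Rightarrow> data \<Rightarrow> data" where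
  "join s a b =
    (if assoc s a = Leaf \<or> assoc s b = Leaf then s
     else if left (assoc s a) = Leaf \<or> left (assoc s b) = Leaf then Leaf
     else merge s (assoc s a) (assoc s b))"

text \<open>Other labels of the class keep its name and bit, so a terminal of a forgotten label
  remains on record. The name may then be a label outside the class until the state is made
  canonical again.\<close>

definition forget :: "data \<Rightarrow> data \<Rightarrow> data" where
  "forget s a = (if assoc s a = Leaf then s else upd s a one)"

fun app :: "data \<Rightarrow> data \<Rightarrow> data" where
  "app Leaf t = t"
| "app (Node x s) t = Node x (app s t)"

text \<open>
  Tagging keeps the labels and class names of the two sides of a disjoint union apart, until
  \<open>fuse\<close> relabels every tagged label to the original one.
\<close>

definition tag_value :: "data \<Rightarrow> data" where
  "tag_value v = (if left v = Leaf then v else Node (Node (left v) Leaf) (right v))"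

fun tag :: "data \<Rightarrow> data" where
  "tag Leaf = Leaf"
| "tag (Node e s) = Node (Node (Node (left e) Leaf) (tag_value (right e))) (tag s)"

fun fuse :: "data \<Rightarrow> data \<Rightarrow> data" where
  "fuse Leaf s = s"
| "fuse (Node a K) s = fuse K (relab s (Node a Leaf) a)"

fun first :: "data \<Rightarrow> data \<Rightarrow> data \<Rightarrow> data" where
  "first Leaf s v = Leaf"
| "first (Node a K) s v = (if assoc s a = v then a else first K s v)"

definition canon_value :: "data \<Rightarrow> data \<Rightarrow> data \<Rightarrow> data" where
  "canon_value L s v =
    (if v = Leaf then Leaf
     else if left v = Leaf then one
     else Node (first L s v) (if right v = Leaf then Leaf else one))"

fun canon_list :: "data \<Rightarrow> data \<Rightarrow> data \<Rightarrow> data" where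
  "canon_list Leaf L s = Leaf"
| "canon_list (Node a K) L s = Node (Node a (canon_value L s (assoc s a))) (canon_list K L s)"

text \<open>States that differ only in the names of classes mean the same and have to become equal
  before duplicates can be removed. The result also has no entries for tagged labels, since it is
  built along \<open>L\<close>.\<close>

definition canon :: "data \<Rightarrow> data \<Rightarrow> data" where
  "canon L s = (if s = Leaf then Leaf else canon_list L L s)"

text \<open>
  A trie with trees as keys, read in preorder; the second argument of \<open>mem\<close> and \<open>ins\<close> is the stack of
  trees that are still to be read.
\<close>

definition weight :: "data \<Rightarrow> nat" where
  "weight st = sum_list (map input_size (items st))"

lemma weight_simps [simp]:
  "weight Leaf = 0"
  "weight (Node x st) = input_size x + weight st"
  by (simp_all add: weight_def)

function mem :: "data \<Rightarrow> data \<Rightarrow> bool" where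
  "mem t Leaf \<longleftrightarrow> t \<noteq> Leaf"
| "mem t (Node Leaf st) \<longleftrightarrow> mem (left t) st"
| "mem t (Node (Node x y) st) \<longleftrightarrow> mem (right t) (Node x (Node y st))"
  by pat_completeness auto
termination by (relation "measure (\<lambda>(t, st). weight st)") auto

function ins :: "data \<Rightarrow> data \<Rightarrow> data" where
  "ins t Leaf = one"
| "ins t (Node Leaf st) = Node (ins (left t) st) (right t)"
| "ins t (Node (Node x y) st) = Node (left t) (ins (right t) (Node x (Node y st)))"
  by pat_completeness auto
termination by (relation "measure (\<lambda>(t, st). weight st)") auto

fun clean :: "data \<Rightarrow> data \<Rightarrow> data \<Rightarrow> data" where
  "clean Leaf t L = Leaf"
| "clean (Node e X) t L =
    (let k = Node (canon L (left e)) (right e) in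
     if left k = Leaf \<or> mem t (Node k Leaf) then clean X t L
     else Node k (clean X (ins t (Node k Leaf)) L))"

fun relab_table :: "data \<Rightarrow> data \<Rightarrow> data \<Rightarrow> data" where
  "relab_table Leaf a b = Leaf"
| "relab_table (Node e X) a b = Node (Node (relab (left e) a b) (right e)) (relab_table X a b)"

fun join_table :: "data \<Rightarrow> data \<Rightarrow> data \<Rightarrow> data" where
  "join_table Leaf a b = Leaf"
| "join_table (Node e X) a b = Node (Node (join (left e) a b) (right e)) (join_table X a b)"

text \<open>Both versions stay in the table, since it is still open whether the label gets edges
  beyond the join.\<close>

fun forget_table :: "data \<Rightarrow> data \<Rightarrow> data" where
  "forget_table Leaf a = Leaf"
| "forget_table (Node e X) a =
    Node e (Node (Node (forget (left e) a) (right e)) (forget_table X a))"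

fun union_row :: "data \<Rightarrow> data \<Rightarrow> data \<Rightarrow> data \<Rightarrow> data" where
  "union_row k Leaf L Z = Z"
| "union_row k (Node e Y) L Z =
    Node (Node (fuse L (app (left k) (tag (left e)))) (app (right k) (right e)))
      (union_row k Y L Z)"

fun union_table :: "data \<Rightarrow> data \<Rightarrow> data \<Rightarrow> data" where
  "union_table Leaf Y L = Leaf"
| "union_table (Node k X) Y L = union_row k Y L (union_table X Y L)"

fun blank :: "data \<Rightarrow> data" where
  "blank Leaf = Leaf"
| "blank (Node a L) = Node (Node a Leaf) (blank L)"

text \<open>All guesses originate here: the vertex survives without later edges, survives as a class
  named by its own label, or is deleted, which is not offered to terminals.\<close>

definition leaf_table :: "data \<Rightarrow> data \<Rightarrow> data \<Rightarrow> data \<Rightarrow> data" where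
  "leaf_table L T a v =
    Node (Node (upd (blank L) a one) Leaf)
      (Node (Node (upd (blank L) a (Node a (enc_bool (v \<in> set (items T))))) Leaf)
        (if v \<in> set (items T) then Leaf else Node (Node (blank L) one) Leaf))"

primrec table :: "data \<Rightarrow> data \<Rightarrow> nat wexp \<Rightarrow> data" where
  "table L T (Vertex i v) = leaf_table L T (enc_nat i) (enc_nat v)"
| "table L T (DUnion \<phi> \<psi>) = clean (union_table (table L T \<phi>) (table L T \<psi>) L) Leaf L"
| "table L T (Relabel i j \<phi>) = clean (relab_table (table L T \<phi>) (enc_nat i) (enc_nat j)) Leaf L"
| "table L T (Join i j \<phi>) =
    clean (forget_table (forget_table (join_table (table L T \<phi>) (enc_nat i) (enc_nat j))
      (enc_nat i)) (enc_nat j)) Leaf L"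

definition add :: "data \<Rightarrow> data \<Rightarrow> data" where
  "add x K = (if x \<in> set (items K) then K else Node x K)"

text \<open>The width \<open>w\<close> is not part of the input. The labels that occur take its
  place: there are at most \<open>w\<close> of them, and all bounds are monotone in their
  number.\<close>

primrec labels :: "nat wexp \<Rightarrow> data \<Rightarrow> data" where
  "labels (Vertex i v) K = add (enc_nat i) K"
| "labels (DUnion \<phi> \<psi>) K = labels \<phi> (labels \<psi> K)"
| "labels (Relabel i j \<phi>) K = add (enc_nat i) (add (enc_nat j) (labels \<phi> K))"
| "labels (Join i j \<phi>) K = add (enc_nat i) (add (enc_nat j) (labels \<phi> K))"

fun half :: "data \<Rightarrow> data" where
  "half Leaf = Leaf"
| "half (Node x Leaf) = one"
| "half (Node x (Node y u)) = Node Leaf (half u)"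

text \<open>A unary number is compared with a binary one, least significant bit first:
  \<open>u \<le> b + 2 * k\<close> holds iff half of \<open>u - b\<close>, rounded up and with
  truncated subtraction, is at most \<open>k\<close>. This is why \<open>half\<close> rounds
  up.\<close>

fun leq :: "data \<Rightarrow> data \<Rightarrow> bool" where
  "leq u Leaf \<longleftrightarrow> u = Leaf"
| "leq u (Node b k) \<longleftrightarrow> leq (half (if b = Leaf then u else right u)) k"

fun accept :: "data \<Rightarrow> data \<Rightarrow> bool" where
  "accept Leaf k \<longleftrightarrow> False"
| "accept (Node e X) k \<longleftrightarrow> leq (right e) k \<or> accept X k"

section \<open>Values and running times of the individual functions\<close>

text \<open>The comparison descends both trees in parallel, so the second one alone bounds its cost;
  stored keys can be compared with a label whatever their size. As in the lemmas that follow, the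
  rules are applied along the syntax of the body and leave two goals, the value and the arithmetic
  of the bound.\<close>

lemma computes_eq: "computes prog f_eq [x, y] (enc_bool (x = y)) (20 * input_size y)"
proof (induction x arbitrary: y rule: measure_induct_rule[where f = input_size])
  case (less x)
  show ?case
    by (rule computesI, simp, rule prog_nth, unfold eq_body_def,
        (rule takes_rules less.IH | (simp; fail))+)
      (cases x; cases y; auto simp: enc_bool_if)+
qed

lemma computes_assoc:
  "computes prog f_assoc [s, a] (assoc s a) (len s * (20 * input_size a + 20) + 5)"
proof (induction s rule: measure_induct_rule[where f = input_size])
  case (less s)
  show ?case
    by (rule computesI, simp, rule prog_nth, unfold assoc_body_def,
        (rule takes_rules less.IH computes_eq | (simp; fail))+)
      (cases s; auto simp: enc_bool_if)+
qed

lemma computes_upd: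
  "computes prog f_upd [s, a, v] (upd s a v) (len s * (20 * input_size a + 40) + 5)"
proof (induction s rule: measure_induct_rule[where f = input_size])
  case (less s)
  show ?case
    by (rule computesI, simp, rule prog_nth, unfold upd_body_def,
        (rule takes_rules less.IH computes_eq | (simp; fail))+)
      (cases s; auto simp: enc_bool_if)+
qed

lemma computes_subst:
  "computes prog f_subst [s, u, v] (subst s u v) (len s * (20 * input_size u + 40) + 5)"
proof (induction s rule: measure_induct_rule[where f = input_size])
  case (less s)
  show ?case
    by (rule computesI, simp, rule prog_nth, unfold subst_body_def,
        (rule takes_rules less.IH computes_eq | (simp; fail))+)
      (cases s; auto simp: enc_bool_if)+
qed

lemma computes_merge:
  "computes prog f_merge [s, u, v] (merge s u v)
    (len s * (20 * (input_size u + input_size v) + 40) + 20 * input_size v + 60)"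
  by (rule computesI, simp, rule prog_nth, unfold merge_body_def,
      (rule takes_rules computes_eq computes_subst | (simp; fail))+)
    (simp_all add: enc_bool_if merge_def algebra_simps)

text \<open>Number and size of the entries are bounded separately because they grow at different
  places: the first under concatenation, the second under tagging. The other operations preserve
  both.\<close>

definition small :: "nat \<Rightarrow> nat \<Rightarrow> data \<Rightarrow> bool" where
  "small m A s \<longleftrightarrow> len s \<le> m \<and> (\<forall>e\<in>set (items s). input_size (left e) \<le> A \<and> input_size (right e) \<le> A)"

lemma small_Leaf [simp]: "small m A Leaf"
  by (simp add: small_def)

lemma small_Node [simp]:
  "small m A (Node e s) \<longleftrightarrow>
    0 < m \<and> input_size (left e) \<le> A \<and> input_size (right e) \<le> A \<and> small (m - 1) A s"
  by (auto simp: small_def)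

lemma input_size_assoc: "small m A s \<Longrightarrow> 1 \<le> A \<Longrightarrow> input_size (assoc s a) \<le> A"
  by (induction s a arbitrary: m rule: assoc.induct) auto

lemma len_upd [simp]: "len (upd s a v) = len s"
  by (induction s a v rule: upd.induct) auto

lemma len_subst [simp]: "len (subst s u v) = len s"
  by (induction s u v rule: subst.induct) auto

lemma small_upd:
  "small m A s \<Longrightarrow> input_size a \<le> A \<Longrightarrow> input_size v \<le> A \<Longrightarrow> small m A (upd s a v)"
  by (induction s a v arbitrary: m rule: upd.induct) auto

lemma small_subst:
  "small m A s \<Longrightarrow> input_size v \<le> A \<Longrightarrow> small m A (subst s u v)"
  by (induction s u v arbitrary: m rule: subst.induct) auto

lemma small_merge:
  "small m A s \<Longrightarrow> input_size u \<le> A \<Longrightarrow> input_size v \<le> A \<Longrightarrow> small m A (merge s u v)"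
  by (simp add: merge_def small_subst)

lemma small_relab:
  assumes "small m A s" "input_size a \<le> A" "input_size b \<le> A"
  shows "small m A (relab s a b)"
proof -
  have A: "1 \<le> A"
    using assms(2) input_size_pos le_trans by blast
  have assoc: "input_size (assoc s c) \<le> A" for c
    using assms(1) A by (rule input_size_assoc)
  show ?thesis
    using assms A assoc by (simp add: relab_def small_upd small_merge)
qed

lemma len_app [simp]: "len (app s t) = len s + len t"
  by (induction s t rule: app.induct) auto

lemma len_tag [simp]: "len (tag s) = len s"
  by (induction s rule: tag.induct) auto

lemma small_app: "small m A s \<Longrightarrow> small m' A t \<Longrightarrow> small (m + m') A (app s t)"
proof (induction s t arbitrary: m rule: app.induct)
  case (1 t)
  then show ?case by (auto simp: small_def)
next
  case (2 x s t)
  then have "small (m - Suc 0 + m') A (app s t)" "0 < m"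
    using "2.IH"[of "m - Suc 0"] by auto
  moreover have "m - Suc 0 + m' = m + m' - Suc 0"
    using \<open>0 < m\<close> by simp
  ultimately have "small (m + m' - Suc 0) A (app s t)"
    by simp
  with 2 show ?case
    by simp
qed

text \<open>Wrapping a label or a class name into \<open>Node _ Leaf\<close> adds 2 to its
  size.\<close>

lemma small_tag: "small m A s \<Longrightarrow> small m (A + 2) (tag s)"
proof (induction s arbitrary: m rule: tag.induct)
  case (2 e s)
  then show ?case by (cases "right e") (auto simp: tag_value_def)
qed simp

lemma small_mult_le:
  assumes "small m A s" "1 \<le> m" "1 \<le> A" "k \<le> c * A + d"
  shows "len s * k + e \<le> (c + d + e) * (m * A)"
proof -
  have "len s \<le> m"
    using assms(1) by (simp add: small_def)
  then have "len s * k \<le> m * (c * A + d)"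
    using assms(4) by (rule mult_mono) auto
  moreover have "d * m \<le> d * (m * A)" "e \<le> e * (m * A)"
    using assms(2,3) by auto
  moreover have "m * (c * A + d) = c * (m * A) + d * m"
    "(c + d + e) * (m * A) = c * (m * A) + d * (m * A) + e * (m * A)"
    by (simp_all add: algebra_simps)
  ultimately show ?thesis
    by linarith
qed

text \<open>The factors add up the constants of the finer bounds: 45 = 20 + 20 + 5 and 65 = 20 + 40
  + 5, while 160 consists of 80 for the substitution and 80 for comparing the two values and the
  overhead.\<close>

lemma computes_small:
  assumes "small m A s" "1 \<le> m" "input_size a \<le> A"
  shows "computes prog f_assoc [s, a] (assoc s a) (45 * (m * A))"
    "computes prog f_upd [s, a, v] (upd s a v) (65 * (m * A))"
    "input_size v \<le> A \<Longrightarrow> computes prog f_merge [s, a, v] (merge s a v) (160 * (m * A))"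
proof -
  have A: "1 \<le> A"
    using assms(3) input_size_pos le_trans by blast
  then have p: "A \<le> m * A" "1 \<le> m * A"
    using assms(2) by auto
  define p where "p = m * A"
  show "computes prog f_assoc [s, a] (assoc s a) (45 * (m * A))"
    using small_mult_le[OF assms(1,2) A, of "20 * input_size a + 20" 20 20 5] assms(3)
    by (intro computes_mono[OF computes_assoc]) auto
  show "computes prog f_upd [s, a, v] (upd s a v) (65 * (m * A))"
    using small_mult_le[OF assms(1,2) A, of "20 * input_size a + 40" 20 40 5] assms(3)
    by (intro computes_mono[OF computes_upd]) auto
  assume "input_size v \<le> A"
  then show "computes prog f_merge [s, a, v] (merge s a v) (160 * (m * A))"
    using small_mult_le[OF assms(1,2) A, of "20 * (input_size a + input_size v) + 40" 40 40 0]
      assms(3) p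
    by (intro computes_mono[OF computes_merge] refl) (simp flip: p_def)
qed

lemma computes_relab:
  assumes "small m A s" "1 \<le> m" "input_size a \<le> A" "input_size b \<le> A"
  shows "computes prog f_relab [s, a, b] (relab s a b) (1000 * (m * A))"
proof -
  define p where "p = m * A"
  have A: "1 \<le> A"
    using assms(3) input_size_pos le_trans by blast
  have assoc: "input_size (assoc s c) \<le> A" for c
    using assms(1) A by (rule input_size_assoc)
  have p: "A \<le> p" "1 \<le> p"
    using A assms(2) by (auto simp: p_def)
  \<comment> \<open>The final update acts on the merged state, so its cost requires the size bounds
    for that state.\<close>
  have small: "small m A (if assoc s b = Leaf then upd s b (assoc s a)
      else merge s (assoc s a) (assoc s b))"
    using assms assoc by (simp add: small_upd small_merge)
  note * = computes_small[OF assms(1,2), folded p_def]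
    computes_small[OF small assms(2), folded p_def]
  show ?thesis
    unfolding p_def[symmetric]
    by (rule computesI, simp, rule prog_nth, unfold relab_body_def,
        (rule takes_rules computes_eq * | (simp add: assms assoc; fail))+)
      (use assms(3,4) p in \<open>simp_all add: enc_bool_if relab_def\<close>)
qed

lemma computes_join:
  assumes "small m A s" "1 \<le> m" "input_size a \<le> A" "input_size b \<le> A"
  shows "computes prog f_join [s, a, b] (join s a b) (1000 * (m * A))"
proof -
  define p where "p = m * A"
  have A: "1 \<le> A"
    using assms(3) input_size_pos le_trans by blast
  have assoc: "input_size (assoc s c) \<le> A" for c
    using assms(1) A by (rule input_size_assoc)
  have p: "1 \<le> p"
    using A assms(2) by (auto simp: p_def)
  note * = computes_small[OF assms(1,2), folded p_def]
  show ?thesis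
    unfolding p_def[symmetric]
    by (rule computesI, simp, rule prog_nth, unfold join_body_def,
        (rule takes_rules * | (simp add: assms assoc; fail))+)
      (use p in \<open>simp_all add: join_def\<close>)
qed

lemma computes_forget:
  assumes "small m A s" "1 \<le> m" "input_size a \<le> A"
  shows "computes prog f_forget [s, a] (forget s a) (1000 * (m * A))"
proof -
  define p where "p = m * A"
  have A: "1 \<le> A"
    using assms(3) input_size_pos le_trans by blast
  have p: "1 \<le> p"
    using A assms(2) by (auto simp: p_def)
  note * = computes_small[OF assms(1,2), folded p_def]
  show ?thesis
    unfolding p_def[symmetric]
    by (rule computesI, simp, rule prog_nth, unfold forget_body_def,
        (rule takes_rules * | (simp add: assms; fail))+)
      (use p in \<open>simp_all add: forget_def\<close>)
qed

lemma computes_app: "computes prog f_app [s, t] (app s t) (len s * 20 + 5)"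
proof (induction s rule: measure_induct_rule[where f = input_size])
  case (less s)
  show ?case
    by (rule computesI, simp, rule prog_nth, unfold app_body_def,
        (rule takes_rules less.IH | (simp; fail))+)
      (cases s; auto)+
qed

lemma computes_tag_value: "computes prog f_tag_value [v] (tag_value v) 20"
  by (rule computesI, simp, rule prog_nth, unfold tag_value_body_def,
      (rule takes_rules | (simp; fail))+)
    (simp_all add: tag_value_def)

lemma computes_tag: "computes prog f_tag [s] (tag s) (len s * 50 + 5)"
proof (induction s rule: measure_induct_rule[where f = input_size])
  case (less s)
  show ?case
    by (rule computesI, simp, rule prog_nth, unfold tag_body_def,
        (rule takes_rules less.IH computes_tag_value | (simp; fail))+)
      (cases s; auto)+
qed

text \<open>The slack of 2 is for the tagged label \<open>Node a Leaf\<close>, which every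
  relabelling receives as an argument.\<close>

lemma computes_fuse:
  assumes "small m A s" "1 \<le> m" "\<forall>a\<in>set (items K). input_size a + 2 \<le> A"
  shows "computes prog f_fuse [K, s] (fuse K s) (len K * (1000 * (m * A) + 40) + 5)"
  using assms(1,3)
proof (induction K arbitrary: s rule: measure_induct_rule[where f = input_size])
  case (less K)
  define p where "p = 1000 * (m * A)"
  show ?case
  proof (cases K)
    case Leaf
    show ?thesis
      by (rule computesI, simp, rule prog_nth, unfold fuse_body_def Leaf,
          rule takes_Cond, rule takes_rules, simp, rule takes_rules)
        simp_all
  next
    case (Node a K')
    have a: "input_size (Node a Leaf) \<le> A" "input_size a \<le> A"
      using less.prems(2) Node by auto
    have IH: "computes prog f_fuse [right K, relab s (Node a Leaf) a]
      (fuse (right K) (relab s (Node a Leaf) a)) (len K' * (p + 40) + 5)"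
      using less.IH[of K' "relab s (Node a Leaf) a"] small_relab[OF less.prems(1) a] less.prems(2)
        Node by (simp add: p_def)
    have left: "left K = a"
      using Node by simp
    show ?thesis
      unfolding p_def[symmetric]
      by (rule computesI, simp, rule prog_nth, unfold fuse_body_def,
          (rule takes_rules IH computes_relab[OF less.prems(1) assms(2) a, folded p_def left]
            IH[folded left] | (simp; fail))+)
        (simp_all add: Node)
  qed
qed

lemma computes_first:
  assumes "small m A s" "1 \<le> m" "\<forall>a\<in>set (items K). input_size a \<le> A" "input_size v \<le> A"
  shows "computes prog f_first [K, s, v] (first K s v) (len K * (100 * (m * A)) + 5)"
  using assms(3)
proof (induction K rule: measure_induct_rule[where f = input_size])
  case (less K)
  define p where "p = m * A"
  have A: "1 \<le> A"
    using assms(4) input_size_pos le_trans by blast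
  then have p: "A \<le> p" "1 \<le> p"
    using assms(2) by (auto simp: p_def)
  have K: "input_size (left K) \<le> A"
    using less.prems A by (cases K) auto
  have K': "\<forall>a\<in>set (items (right K)). input_size a \<le> A"
    using less.prems by (cases K) auto
  show ?case
    unfolding p_def[symmetric]
    by (rule computesI, simp, rule prog_nth, unfold first_body_def,
        (rule takes_rules less.IH[folded p_def] K' computes_eq
          computes_small(1)[OF assms(1,2), folded p_def] | (simp add: K; fail))+)
      (cases K; use assms(4) p in \<open>auto simp: enc_bool_if\<close>)+
qed

lemma computes_canon_value:
  assumes "small m A s" "1 \<le> m" "\<forall>a\<in>set (items L). input_size a \<le> A" "input_size v \<le> A"
  shows "computes prog f_canon_value [L, s, v] (canon_value L s v) (len L * (100 * (m * A)) + 50)"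
  by (rule computesI, simp, rule prog_nth, unfold canon_value_body_def,
      (rule takes_rules computes_first[OF assms] | (simp; fail))+)
    (simp_all add: canon_value_def)

lemma computes_canon_list:
  assumes "small m A s" "1 \<le> m" "\<forall>a\<in>set (items L). input_size a \<le> A"
    "\<forall>a\<in>set (items K). input_size a \<le> A"
  shows "computes prog f_canon_list [K, L, s] (canon_list K L s)
    (len K * (len L * (100 * (m * A)) + 200 * (m * A)) + 5)"
  using assms(4)
proof (induction K rule: measure_induct_rule[where f = input_size])
  case (less K)
  define p where "p = m * A"
  show ?case
  proof (cases K)
    case Leaf
    show ?thesis
      by (rule computesI, simp, rule prog_nth, unfold canon_list_body_def Leaf,
          rule takes_Cond, rule takes_rules, simp, rule takes_rules)
        simp_all
  next
    case (Node a K')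
    have a: "input_size a \<le> A" "left K = a"
      using less.prems Node by auto
    have A: "1 \<le> A"
      using a(1) input_size_pos le_trans by blast
    then have p: "1 \<le> p"
      using assms(2) by (auto simp: p_def)
    have assoc: "input_size (assoc s c) \<le> A" for c
      using assms(1) A by (rule input_size_assoc)
    have K': "\<forall>a\<in>set (items (right K)). input_size a \<le> A"
      using less.prems Node by auto
    show ?thesis
      unfolding p_def[symmetric]
      by (rule computesI, simp, rule prog_nth, unfold canon_list_body_def,
          (rule takes_rules less.IH[folded p_def] K'
            computes_canon_value[OF assms(1-3) assoc, folded p_def]
            computes_small(1)[OF assms(1,2), folded p_def] | (simp add: a; fail))+)
        (simp_all add: Node, use p in linarith)
  qed
qed

text \<open>The cube arises because, for each label, the search for the name of its class may run
  through all labels and look each of them up in the state.\<close>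

lemma computes_canon:
  assumes "small m A s" "1 \<le> m" "\<forall>a\<in>set (items L). input_size a \<le> A" "len L \<le> m" "1 \<le> A"
  shows "computes prog f_canon [L, s] (canon L s) (400 * (m ^ 3 * A))"
proof -
  have "200 * (m * A) \<le> m * (200 * (m * A))"
    using assms(2) by simp
  moreover have "len L * (100 * (m * A)) \<le> m * (100 * (m * A))"
    using assms(4) by (rule mult_right_mono) simp
  ultimately have "len L * (100 * (m * A)) + 200 * (m * A) \<le>
      m * (100 * (m * A)) + m * (200 * (m * A))"
    by (rule add_mono[rotated])
  then have "len L * (len L * (100 * (m * A)) + 200 * (m * A)) \<le>
      m * (m * (100 * (m * A)) + m * (200 * (m * A)))"
    using assms(4) by (intro mult_mono) auto
  also have "\<dots> = 300 * m ^ 3 * A"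
    by (simp add: power3_eq_cube algebra_simps)
  finally have *: "len L * (len L * (100 * (m * A)) + 200 * (m * A)) \<le> 300 * (m ^ 3 * A)"
    by simp
  define q where "q = m ^ 3 * A"
  have q: "1 \<le> q"
    using assms(2,5) by (simp add: q_def)
  show ?thesis
    unfolding q_def[symmetric]
    by (rule computesI, simp, rule prog_nth, unfold canon_body_def,
        (rule takes_rules computes_canon_list[OF assms(1-3)] assms | (simp; fail))+)
      (use *[folded q_def] q in \<open>simp_all add: canon_def\<close>)
qed

text \<open>The stack may get longer, but replacing a node by its two subtrees lowers the total size
  by one. So a key is looked up in time linear in its own size, however many keys are stored; this
  keeps the cost per pair in a disjoint union polynomial.\<close>

lemma computes_mem: "computes prog f_mem [t, st] (enc_bool (mem t st)) (weight st * 40 + 10)"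
proof (induction st arbitrary: t rule: measure_induct_rule[where f = weight])
  case (less st)
  have *: "st \<noteq> Leaf \<Longrightarrow> left st = Leaf \<Longrightarrow> weight (right st) < weight st"
    "left st \<noteq> Leaf \<Longrightarrow>
      weight (Node (left (left st)) (Node (right (left st)) (right st))) < weight st"
    by (cases st; cases "left st"; simp)+
  show ?case
    by (rule computesI, simp, rule prog_nth, unfold mem_body_def,
        (rule takes_rules less.IH * | (assumption) | (simp; fail))+)
      (cases st; cases "left st"; auto simp: enc_bool_if)+
qed

lemma computes_ins: "computes prog f_ins [t, st] (ins t st) (weight st * 40 + 10)"
proof (induction st arbitrary: t rule: measure_induct_rule[where f = weight])
  case (less st)
  have *: "st \<noteq> Leaf \<Longrightarrow> left st = Leaf \<Longrightarrow> weight (right st) < weight st"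
    "left st \<noteq> Leaf \<Longrightarrow>
      weight (Node (left (left st)) (Node (right (left st)) (right st))) < weight st"
    by (cases st; cases "left st"; simp)+
  show ?case
    by (rule computesI, simp, rule prog_nth, unfold ins_body_def,
        (rule takes_rules less.IH * | (assumption) | (simp; fail))+)
      (cases st; cases "left st"; auto)+
qed


text \<open>\<open>U\<close> bounds the canonicalisation and \<open>V\<close> the size of a key. At
  most one lookup and one insertion per entry, at 40 per unit of key size each, give
  \<open>80 * V\<close>.\<close>

lemma computes_clean:
  assumes "\<forall>e\<in>set (items X). computes prog f_canon [L, left e] (canon L (left e)) U \<and>
    input_size (canon L (left e)) + input_size (right e) + 1 \<le> V"
  shows "computes prog f_clean [X, t, L] (clean X t L) (len X * (U + 80 * V + 100) + 5)"
  using assms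
proof (induction X arbitrary: t rule: measure_induct_rule[where f = input_size])
  case (less X)
  show ?case
  proof (cases X)
    case Leaf
    show ?thesis
      by (rule computesI, simp, rule prog_nth, unfold clean_body_def Leaf,
          rule takes_Cond, rule takes_rules, simp, rule takes_rules)
        simp_all
  next
    case (Node e Y)
    define k where "k = Node (canon L (left e)) (right e)"
    have e: "left X = e" "right X = Y"
      using Node by auto
    have k: "input_size k \<le> V"
      using less.prems Node by (auto simp: k_def)
    have canon: "computes prog f_canon [L, left e] (canon L (left e)) U"
      using less.prems Node by auto
    have IH: "computes prog f_clean [Y, t, L] (clean Y t L) (len Y * (U + 80 * V + 100) + 5)" for t
      using less.IH[of Y] less.prems Node by auto
    have step: "computes prog f_clean_step [k, Y, t, L] (clean X t L)
        (len Y * (U + 80 * V + 100) + 5 + 80 * V + 60)"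
      by (rule computesI, simp, rule prog_nth, unfold clean_step_body_def,
          (rule takes_rules IH computes_mem computes_ins | (simp; fail))+)
        (use k in \<open>auto simp: enc_bool_if Node k_def Let_def\<close>)
    show ?thesis
      by (rule computesI, simp, rule prog_nth, unfold clean_body_def,
          (rule takes_rules canon[folded e] step[folded e, unfolded k_def, folded e] | (simp; fail))+)
        (simp_all add: Node)
  qed
qed

lemma computes_relab_table:
  assumes "\<forall>e\<in>set (items X). computes prog f_relab [left e, a, b] (relab (left e) a b) U"
  shows "computes prog f_relab_table [X, a, b] (relab_table X a b) (len X * (U + 50) + 5)"
  using assms
proof (induction X rule: measure_induct_rule[where f = input_size])
  case (less X)
  show ?case
  proof (cases X)
    case Leaf
    show ?thesis
      by (rule computesI, simp, rule prog_nth, unfold relab_table_body_def Leaf,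
          rule takes_Cond, rule takes_rules, simp, rule takes_rules)
        simp_all
  next
    case (Node e Y)
    have e: "left X = e" "right X = Y"
      using Node by auto
    have op: "computes prog f_relab [left e, a, b] (relab (left e) a b) U"
      using less.prems Node by auto
    have IH: "computes prog f_relab_table [Y, a, b] (relab_table Y a b) (len Y * (U + 50) + 5)"
      using less.IH[of Y] less.prems Node by auto
    show ?thesis
      by (rule computesI, simp, rule prog_nth, unfold relab_table_body_def,
          (rule takes_rules op[folded e] IH[folded e] | (simp; fail))+)
        (simp_all add: Node)
  qed
qed

lemma computes_join_table:
  assumes "\<forall>e\<in>set (items X). computes prog f_join [left e, a, b] (join (left e) a b) U"
  shows "computes prog f_join_table [X, a, b] (join_table X a b) (len X * (U + 50) + 5)"
  using assms
proof (induction X rule: measure_induct_rule[where f = input_size])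
  case (less X)
  show ?case
  proof (cases X)
    case Leaf
    show ?thesis
      by (rule computesI, simp, rule prog_nth, unfold join_table_body_def Leaf,
          rule takes_Cond, rule takes_rules, simp, rule takes_rules)
        simp_all
  next
    case (Node e Y)
    have e: "left X = e" "right X = Y"
      using Node by auto
    have op: "computes prog f_join [left e, a, b] (join (left e) a b) U"
      using less.prems Node by auto
    have IH: "computes prog f_join_table [Y, a, b] (join_table Y a b) (len Y * (U + 50) + 5)"
      using less.IH[of Y] less.prems Node by auto
    show ?thesis
      by (rule computesI, simp, rule prog_nth, unfold join_table_body_def,
          (rule takes_rules op[folded e] IH[folded e] | (simp; fail))+)
        (simp_all add: Node)
  qed
qed

lemma computes_forget_table:
  assumes "\<forall>e\<in>set (items X). computes prog f_forget [left e, a] (forget (left e) a) U"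
  shows "computes prog f_forget_table [X, a] (forget_table X a) (len X * (U + 50) + 5)"
  using assms
proof (induction X rule: measure_induct_rule[where f = input_size])
  case (less X)
  show ?case
  proof (cases X)
    case Leaf
    show ?thesis
      by (rule computesI, simp, rule prog_nth, unfold forget_table_body_def Leaf,
          rule takes_Cond, rule takes_rules, simp, rule takes_rules)
        simp_all
  next
    case (Node e Y)
    have e: "left X = e" "right X = Y"
      using Node by auto
    have op: "computes prog f_forget [left e, a] (forget (left e) a) U"
      using less.prems Node by auto
    have IH: "computes prog f_forget_table [Y, a] (forget_table Y a) (len Y * (U + 50) + 5)"
      using less.IH[of Y] less.prems Node by auto
    show ?thesis
      by (rule computesI, simp, rule prog_nth, unfold forget_table_body_def,
          (rule takes_rules op[folded e] IH[folded e] | (simp; fail))+)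
        (simp_all add: Node)
  qed
qed

lemma computes_union_row:
  assumes "\<forall>e\<in>set (items Y). computes prog f_fuse [L, app (left k) (tag (left e))]
      (fuse L (app (left k) (tag (left e)))) U \<and> len (left e) \<le> m"
    "len (left k) \<le> m" "len (right k) \<le> n"
  shows "computes prog f_union_row [k, Y, L, Z] (union_row k Y L Z)
    (len Y * (U + 70 * m + 20 * n + 100) + 5)"
  using assms(1)
proof (induction Y rule: measure_induct_rule[where f = input_size])
  case (less Y)
  show ?case
  proof (cases Y)
    case Leaf
    show ?thesis
      by (rule computesI, simp, rule prog_nth, unfold union_row_body_def Leaf,
          rule takes_Cond, rule takes_rules, simp, rule takes_rules)
        simp_all
  next
    case (Node e Y')
    have e: "left Y = e" "right Y = Y'"
      using Node by auto
    have op: "computes prog f_fuse [L, app (left k) (tag (left e))]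
        (fuse L (app (left k) (tag (left e)))) U" and m: "len (left e) \<le> m"
      using less.prems Node by auto
    have IH: "computes prog f_union_row [k, Y', L, Z] (union_row k Y' L Z)
      (len Y' * (U + 70 * m + 20 * n + 100) + 5)"
      using less.IH[of Y'] less.prems Node by auto
    show ?thesis
      by (rule computesI, simp, rule prog_nth, unfold union_row_body_def,
          (rule takes_rules op[folded e] IH[folded e] computes_app computes_tag | (simp; fail))+)
        (use m assms(2,3) in \<open>simp_all add: Node\<close>)
  qed
qed

lemma computes_union_table:
  assumes "\<forall>k\<in>set (items X). \<forall>Z. computes prog f_union_row [k, Y, L, Z] (union_row k Y L Z) U"
  shows "computes prog f_union_table [X, Y, L] (union_table X Y L) (len X * (U + 50) + 5)"
  using assms
proof (induction X rule: measure_induct_rule[where f = input_size])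
  case (less X)
  show ?case
  proof (cases X)
    case Leaf
    show ?thesis
      by (rule computesI, simp, rule prog_nth, unfold union_table_body_def Leaf,
          rule takes_Cond, rule takes_rules, simp, rule takes_rules)
        simp_all
  next
    case (Node k X')
    have k: "left X = k" "right X = X'"
      using Node by auto
    have op: "computes prog f_union_row [k, Y, L, Z] (union_row k Y L Z) U" for Z
      using less.prems Node by auto
    have IH: "computes prog f_union_table [X', Y, L] (union_table X' Y L) (len X' * (U + 50) + 5)"
      using less.IH[of X'] less.prems Node by auto
    show ?thesis
      by (rule computesI, simp, rule prog_nth, unfold union_table_body_def,
          (rule takes_rules op[folded k] IH[folded k] | (simp; fail))+)
        (simp_all add: Node)
  qed
qed

lemma computes_blank: "computes prog f_blank [L] (blank L) (len L * 20 + 5)"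
proof (induction L rule: measure_induct_rule[where f = input_size])
  case (less L)
  show ?case
    by (rule computesI, simp, rule prog_nth, unfold blank_body_def,
        (rule takes_rules less.IH | (simp; fail))+)
      (cases L; auto)+
qed

lemma computes_elem:
  "computes prog f_elem [K, x] (enc_bool (x \<in> set (items K))) (len K * (20 * input_size x + 20) + 5)"
proof (induction K rule: measure_induct_rule[where f = input_size])
  case (less K)
  show ?case
    by (rule computesI, simp, rule prog_nth, unfold elem_body_def,
        (rule takes_rules less.IH computes_eq | (simp; fail))+)
      (cases K; auto simp: enc_bool_if)+
qed

lemma len_blank [simp]: "len (blank L) = len L"
  by (induction L) auto

lemma computes_leaf_table:
  "computes prog f_leaf_table [L, T, a, v] (leaf_table L T a v)
    (len L * (100 * input_size a + 200) + len T * (100 * input_size v + 100) + 100)"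
  by (rule computesI, simp, rule prog_nth, unfold leaf_table_body_def,
      (rule takes_rules computes_blank computes_elem computes_upd | (simp; fail))+)
    (auto simp: leaf_table_def enc_bool_if algebra_simps)

lemma computes_add: "computes prog f_add [x, K] (add x K) (len K * (20 * input_size x + 20) + 20)"
  by (rule computesI, simp, rule prog_nth, unfold add_body_def,
      (rule takes_rules computes_elem | (simp; fail))+)
    (auto simp: add_def)

lemma computes_half: "computes prog f_half [u] (half u) (len u * 20 + 5)"
proof (induction u rule: measure_induct_rule[where f = input_size])
  case (less u)
  have *: "u \<noteq> Leaf \<Longrightarrow> input_size (right (right u)) < input_size u"
    by (meson input_size_right_le input_size_right_less le_less_trans)
  show ?case
    by (rule computesI, simp, rule prog_nth, unfold half_body_def,
        (rule takes_rules less.IH * | assumption | (simp; fail))+)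
      (cases u; cases "right u"; auto)+
qed

lemma len_half_le: "len (half u) \<le> len u"
  by (induction u rule: half.induct) auto

lemma len_right_le: "len (right u) \<le> len u"
  by (cases u) auto

lemma computes_leq: "computes prog f_leq [u, k] (enc_bool (leq u k)) (len k * (20 * len u + 30) + 10)"
proof (induction k arbitrary: u rule: measure_induct_rule[where f = input_size])
  case (less k)
  define u' where "u' = half (if left k = Leaf then u else right u)"
  \<comment> \<open>The unary number never grows, so the cost of a round for the initial
    \<open>u\<close> covers all later rounds.\<close>
  have u': "len u' \<le> len u"
    unfolding u'_def using len_half_le[of u] len_half_le[of "right u"] len_right_le[of u] by auto
  then have "len (right k) * (20 * len u' + 30) \<le> len (right k) * (20 * len u + 30)"
    by (intro mult_left_mono) auto
  with less.IH[of "right k" u'] have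
    IH: "k \<noteq> Leaf \<Longrightarrow> computes prog f_leq [u', right k] (enc_bool (leq u' (right k)))
      (len (right k) * (20 * len u + 30) + 10)"
    using computes_mono by fastforce
  show ?case
    by (rule computesI, simp, rule prog_nth, unfold leq_body_def,
        (rule takes_rules IH[unfolded u'_def] computes_half | assumption | (simp; fail))+)
      (cases k; use len_right_le[of u] in \<open>auto simp: enc_bool_if\<close>)+
qed

lemma computes_accept:
  assumes "\<forall>e\<in>set (items X). len (right e) \<le> n"
  shows "computes prog f_accept [X, k] (enc_bool (accept X k)) (len X * (len k * (20 * n + 30) + 40) + 5)"
  using assms
proof (induction X rule: measure_induct_rule[where f = input_size])
  case (less X)
  show ?case
  proof (cases X)
    case Leaf
    show ?thesis
      by (rule computesI, simp, rule prog_nth, unfold accept_body_def Leaf,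
          rule takes_Cond, rule takes_rules, simp, rule takes_rules)
        simp_all
  next
    case (Node e X')
    have e: "left X = e" "right X = X'"
      using Node by auto
    have "len k * (20 * len (right e) + 30) \<le> len k * (20 * n + 30)"
      using less.prems Node by (intro mult_left_mono) auto
    then have op: "computes prog f_leq [right e, k] (enc_bool (leq (right e) k)) (len k * (20 * n + 30) + 10)"
      by (intro computes_mono[OF computes_leq]) auto
    have IH: "computes prog f_accept [X', k] (enc_bool (accept X' k))
      (len X' * (len k * (20 * n + 30) + 40) + 5)"
      using less.IH[of X'] less.prems Node by auto
    show ?thesis
      by (rule computesI, simp, rule prog_nth, unfold accept_body_def,
          (rule takes_rules op[folded e] IH[folded e] | (simp; fail))+)
        (auto simp: Node enc_bool_if)
  qed
qed

section \<open>States and partial solutions\<close>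

lemma assoc_notin: "a \<notin> left ` set (items s) \<Longrightarrow> assoc s a = Leaf"
  by (induction s a rule: assoc.induct) auto

lemma keys_upd [simp]: "map left (items (upd s a v)) = map left (items s)"
  by (induction s a v rule: upd.induct) auto

lemma keys_subst [simp]: "map left (items (subst s u v)) = map left (items s)"
  by (induction s u v rule: subst.induct) auto

lemma assoc_upd_same: "a \<in> left ` set (items s) \<Longrightarrow> assoc (upd s a v) a = v"
  by (induction s a v rule: upd.induct) auto

lemma assoc_upd_other: "c \<noteq> a \<Longrightarrow> assoc (upd s a v) c = assoc s c"
  by (induction s a v rule: upd.induct) auto

lemma assoc_upd: "a \<in> left ` set (items s) \<Longrightarrow> assoc (upd s a v) = (assoc s)(a := v)"
  using assoc_upd_same assoc_upd_other by (intro ext) (metis fun_upd_apply)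

lemma assoc_subst:
  "u \<noteq> Leaf \<Longrightarrow> assoc (subst s u v) c = (if assoc s c = u then v else assoc s c)"
  by (induction s u v rule: subst.induct) auto

lemma subst_eq_Leaf [simp]: "subst s u v = Leaf \<longleftrightarrow> s = Leaf"
  by (cases s) auto

lemma upd_eq_Leaf [simp]: "upd s a v = Leaf \<longleftrightarrow> s = Leaf"
  by (cases s) auto

lemma keys_app: "left ` set (items (app s t)) = left ` set (items s) \<union> left ` set (items t)"
  by (induction s t rule: app.induct) auto

lemma assoc_app:
  "assoc (app s t) a = (if a \<in> left ` set (items s) then assoc s a else assoc t a)"
  by (induction s t rule: app.induct) auto

lemma keys_tag: "left ` set (items (tag s)) = (\<lambda>a. Node a Leaf) ` left ` set (items s)"
  by (induction s rule: tag.induct) auto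

lemma tag_value_Leaf [simp]: "tag_value Leaf = Leaf"
  by (simp add: tag_value_def)

lemma assoc_tag: "assoc (tag s) (Node a Leaf) = tag_value (assoc s a)"
  by (induction s rule: tag.induct) auto

lemma assoc_keys: "assoc s a \<noteq> Leaf \<Longrightarrow> a \<in> left ` set (items s)"
  using assoc_notin by blast

text \<open>
  Here \<open>X\<close> is the set of live vertices with labels \<open>l\<close>, and \<open>C\<close> holds for the vertices whose label is
  mapped to a class of \<open>R\<close>.
\<close>

definition represents ::
  "'v set \<Rightarrow> ('v \<Rightarrow> data) \<Rightarrow> 'v set \<Rightarrow> ('v \<times> 'v) set \<Rightarrow> ('v \<Rightarrow> bool) \<Rightarrow> (data \<Rightarrow> data) \<Rightarrow> bool"
where
  "represents X l T R C \<sigma> \<longleftrightarrow>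
    equiv X R \<and>
    (\<forall>x\<in>X. \<sigma> (l x) \<noteq> Leaf \<and> (C x \<longleftrightarrow> left (\<sigma> (l x)) \<noteq> Leaf)) \<and>
    (\<forall>a. \<sigma> a \<noteq> Leaf \<longrightarrow> a \<in> l ` X) \<and>
    (\<forall>x\<in>X. \<not> C x \<longrightarrow> \<sigma> (l x) = one) \<and>
    (\<forall>x\<in>X. right (\<sigma> (l x)) \<in> {Leaf, one}) \<and>
    (\<forall>x\<in>X. \<forall>y\<in>X. C x \<longrightarrow> C y \<longrightarrow> (left (\<sigma> (l x)) = left (\<sigma> (l y)) \<longleftrightarrow> (x, y) \<in> R)) \<and>
    (\<forall>x\<in>X. C x \<longrightarrow> (right (\<sigma> (l x)) \<noteq> Leaf \<longleftrightarrow> (\<exists>t\<in>T \<inter> X. (x, t) \<in> R))) \<and>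
    (\<forall>t\<in>T \<inter> X. \<forall>t'\<in>T \<inter> X. (t, t') \<in> R \<longrightarrow> t = t')"

lemma data_eqI: "right x = right y \<Longrightarrow> left x = left y \<Longrightarrow> left x \<noteq> Leaf \<Longrightarrow> x = y"
  by (cases x; cases y) auto

lemma representsD:
  assumes "represents X l T R C \<sigma>"
  shows "equiv X R"
    and "\<And>x. x \<in> X \<Longrightarrow> \<sigma> (l x) \<noteq> Leaf"
    and "\<And>x. x \<in> X \<Longrightarrow> C x \<longleftrightarrow> left (\<sigma> (l x)) \<noteq> Leaf"
    and "\<And>a. \<sigma> a \<noteq> Leaf \<Longrightarrow> a \<in> l ` X"
    and "\<And>x. x \<in> X \<Longrightarrow> \<not> C x \<Longrightarrow> \<sigma> (l x) = one"
    and "\<And>x. x \<in> X \<Longrightarrow> right (\<sigma> (l x)) \<in> {Leaf, one}"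
    and "\<And>x y. x \<in> X \<Longrightarrow> y \<in> X \<Longrightarrow> C x \<Longrightarrow> C y \<Longrightarrow>
      left (\<sigma> (l x)) = left (\<sigma> (l y)) \<longleftrightarrow> (x, y) \<in> R"
    and "\<And>x. x \<in> X \<Longrightarrow> C x \<Longrightarrow>
      right (\<sigma> (l x)) \<noteq> Leaf \<longleftrightarrow> (\<exists>t\<in>T \<inter> X. (x, t) \<in> R)"
    and "\<And>t t'. t \<in> T \<inter> X \<Longrightarrow> t' \<in> T \<inter> X \<Longrightarrow> (t, t') \<in> R \<Longrightarrow> t = t'"
  using assms unfolding represents_def by blast+

lemma representsI:
  assumes "equiv X R"
    and "\<And>x. x \<in> X \<Longrightarrow> \<sigma> (l x) \<noteq> Leaf"
    and "\<And>x. x \<in> X \<Longrightarrow> C x \<longleftrightarrow> left (\<sigma> (l x)) \<noteq> Leaf"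
    and "\<And>a. \<sigma> a \<noteq> Leaf \<Longrightarrow> a \<in> l ` X"
    and "\<And>x. x \<in> X \<Longrightarrow> \<not> C x \<Longrightarrow> \<sigma> (l x) = one"
    and "\<And>x. x \<in> X \<Longrightarrow> right (\<sigma> (l x)) \<in> {Leaf, one}"
    and "\<And>x y. x \<in> X \<Longrightarrow> y \<in> X \<Longrightarrow> C x \<Longrightarrow> C y \<Longrightarrow>
      left (\<sigma> (l x)) = left (\<sigma> (l y)) \<longleftrightarrow> (x, y) \<in> R"
    and "\<And>x. x \<in> X \<Longrightarrow> C x \<Longrightarrow>
      right (\<sigma> (l x)) \<noteq> Leaf \<longleftrightarrow> (\<exists>t\<in>T \<inter> X. (x, t) \<in> R)"
    and "\<And>t t'. t \<in> T \<inter> X \<Longrightarrow> t' \<in> T \<inter> X \<Longrightarrow> (t, t') \<in> R \<Longrightarrow> t = t'"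
  shows "represents X l T R C \<sigma>"
  unfolding represents_def
  by (intro conjI ballI allI impI) ((rule assms; assumption) | rule assms(1))+

text \<open>The definition compares only names, the program compares whole values. Equivalent
  vertices are equivalent to the same terminals, so their bits agree as well.\<close>

lemma represents_value_eq:
  assumes rep: "represents X l T R C \<sigma>" and x: "x \<in> X" "C x" and y: "y \<in> X" "C y"
  shows "\<sigma> (l x) = \<sigma> (l y) \<longleftrightarrow> (x, y) \<in> R"
proof
  assume "\<sigma> (l x) = \<sigma> (l y)"
  then show "(x, y) \<in> R"
    using representsD(7)[OF rep x(1) y(1) x(2) y(2)] by simp
next
  assume R: "(x, y) \<in> R"
  have "(x, t) \<in> R \<longleftrightarrow> (y, t) \<in> R" for t
    using R representsD(1)[OF rep] by (meson equivE symE transE)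
  then have "right (\<sigma> (l x)) \<noteq> Leaf \<longleftrightarrow> right (\<sigma> (l y)) \<noteq> Leaf"
    using representsD(8)[OF rep x] representsD(8)[OF rep y] by simp
  then have "right (\<sigma> (l x)) = right (\<sigma> (l y))"
    using representsD(6)[OF rep x(1)] representsD(6)[OF rep y(1)] by auto
  moreover have "left (\<sigma> (l x)) = left (\<sigma> (l y))"
    using representsD(7)[OF rep x(1) y(1) x(2) y(2)] R by simp
  moreover have "left (\<sigma> (l x)) \<noteq> Leaf"
    using representsD(3)[OF rep x(1)] x(2) by simp
  ultimately show "\<sigma> (l x) = \<sigma> (l y)"
    by (rule data_eqI)
qed

text \<open>On live vertices only the composition of labelling and state matters; the two may
  therefore be renamed together.\<close>

lemma represents_cong:
  assumes rep: "represents X l T R C \<sigma>" and eq: "\<And>x. x \<in> X \<Longrightarrow> \<sigma>' (l' x) = \<sigma> (l x)"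
    and dom: "\<And>a. \<sigma>' a \<noteq> Leaf \<Longrightarrow> a \<in> l' ` X"
  shows "represents X l' T R C \<sigma>'"
  by (rule representsI) (simp_all add: eq dom representsD[OF rep] representsD(6)[OF rep, simplified]
      del: IntI Int_iff)

section \<open>Merging two classes of an equivalence relation\<close>

text \<open>No closure has to be taken: adding the full square on the union of two classes to an
  equivalence relation gives an equivalence relation again.\<close>

definition merge_classes :: "('v \<times> 'v) set \<Rightarrow> 'v \<Rightarrow> 'v \<Rightarrow> ('v \<times> 'v) set" where
  "merge_classes R x y = R \<union> R `` {x, y} \<times> R `` {x, y}"

lemma subset_merge_classes: "R \<subseteq> merge_classes R x y"
  by (simp add: merge_classes_def)

lemma merge_classes_commute: "merge_classes R x y = merge_classes R y x"
  by (simp add: merge_classes_def insert_commute)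

lemma mem_merge_classes: "equiv X R \<Longrightarrow> x \<in> X \<Longrightarrow> y \<in> X \<Longrightarrow> (x, y) \<in> merge_classes R x y"
  unfolding merge_classes_def by (auto simp: equiv_def refl_on_def)

lemma merge_classes_least:
  assumes "sym Q" "trans Q" "R \<subseteq> Q" "(x, y) \<in> Q"
  shows "merge_classes R x y \<subseteq> Q"
proof -
  have "(x, z) \<in> Q" if "z \<in> R `` {x, y}" for z
    using that assms by (auto dest: transD)
  then show ?thesis
    using assms unfolding merge_classes_def by (blast dest: symD transD)
qed

lemma merge_classes_trivial: "equiv X R \<Longrightarrow> (x, y) \<in> R \<Longrightarrow> merge_classes R x y = R"
  using merge_classes_least[of R R x y] subset_merge_classes[of R x y] by (auto simp: equiv_def)

text \<open>The merged relation is the pullback of \<open>R\<close> along the map that sends the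
  whole class of \<open>x\<close> to \<open>y\<close>. This mirrors a substitution of values and
  reduces statements about the merged relation to statements about \<open>R\<close>.\<close>

lemma merge_classes_iff:
  assumes "equiv X R" "x \<in> X" "y \<in> X"
  shows "(a, b) \<in> merge_classes R x y \<longleftrightarrow>
    ((if (x, a) \<in> R then y else a), (if (x, b) \<in> R then y else b)) \<in> R"
proof -
  have refl: "(x, x) \<in> R" "(y, y) \<in> R"
    using assms by (auto simp: equiv_def refl_on_def)
  have sym: "(b, a) \<in> R" if "(a, b) \<in> R" for a b
    using assms that by (auto simp: equiv_def sym_def)
  have trans: "(a, c) \<in> R" if "(a, b) \<in> R" "(b, c) \<in> R" for a b c
    using assms that by (auto simp: equiv_def trans_def)
  have "(a, b) \<in> merge_classes R x y \<longleftrightarrow>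
      (a, b) \<in> R \<or> ((x, a) \<in> R \<or> (y, a) \<in> R) \<and> ((x, b) \<in> R \<or> (y, b) \<in> R)"
    by (auto simp: merge_classes_def)
  then show ?thesis
    using refl(2) sym[of a b] sym[of a y] sym[of y a] trans[of x a b] trans[of x b a] trans[of a y b]
    by simp blast
qed

lemma equiv_merge_classes:
  assumes "equiv X R" "x \<in> X" "y \<in> X"
  shows "equiv X (merge_classes R x y)"
proof (rule equivI)
  show "merge_classes R x y \<subseteq> X \<times> X"
    using assms unfolding merge_classes_def equiv_def refl_on_def by auto
  show "refl_on X (merge_classes R x y)"
    using assms unfolding merge_classes_def equiv_def refl_on_def by auto
  show "sym (merge_classes R x y)"
    using assms unfolding merge_classes_def equiv_def by (auto simp: sym_def)
  show "trans (merge_classes R x y)"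
    using assms(1) by (intro transI) (unfold merge_classes_iff[OF assms] equiv_def, blast dest: transD)
qed

text \<open>On vertices in classes, the new values and the new relation are the old ones composed
  with the map \<open>r\<close>. Terminals are fixed by \<open>r\<close>, because the bit of the
  class of \<open>x\<close> excludes terminals from it; hence bits and the separation of terminals
  carry over.\<close>

lemma represents_subst:
  assumes rep: "represents X l T R C \<sigma>" and x: "x \<in> X" "C x" and y: "y \<in> X" "C y"
    and bit: "right (\<sigma> (l x)) = Leaf"
    and \<sigma>': "\<And>a. \<sigma>' a = (if \<sigma> a = \<sigma> (l x) then \<sigma> (l y) else \<sigma> a)"
  shows "represents X l T (merge_classes R x y) C \<sigma>'"
proof -
  define r where "r a = (if (x, a) \<in> R then y else a)" for a
  have eq: "equiv X R"
    using rep by (rule representsD(1))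
  have iff: "(a, b) \<in> merge_classes R x y \<longleftrightarrow> (r a, r b) \<in> R" for a b
    using merge_classes_iff[OF eq x(1) y(1)] by (simp add: r_def)
  have r: "r a \<in> X" "C a \<Longrightarrow> C (r a)" if "a \<in> X" for a
    using that y by (auto simp: r_def)
  have val: "\<sigma>' (l a) = \<sigma> (l (r a))" if "a \<in> X" "C a" for a
    using represents_value_eq[OF rep x that] by (auto simp: r_def \<sigma>')
  \<comment> \<open>The value of a class has a name different from \<open>Leaf\<close>, so the
    substitution leaves labels with value \<open>one\<close> alone.\<close>
  have "\<sigma> (l x) \<noteq> one"
    using representsD(3)[OF rep x(1)] x(2) by auto
  then have val': "\<sigma>' (l a) = \<sigma> (l a)" if "a \<in> X" "\<not> C a" for a
    using representsD(5)[OF rep that] by (simp add: \<sigma>')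
  have rt: "r t = t" if "t \<in> T \<inter> X" for t
    using representsD(8)[OF rep x] bit that by (auto simp: r_def)
  show ?thesis
  proof (rule representsI)
    show "equiv X (merge_classes R x y)"
      using eq x(1) y(1) by (rule equiv_merge_classes)
    show "\<sigma>' (l a) \<noteq> Leaf" if "a \<in> X" for a
      using representsD(2)[OF rep] that r[OF that] val[OF that] val'[OF that] by (cases "C a") auto
    show "C a \<longleftrightarrow> left (\<sigma>' (l a)) \<noteq> Leaf" if "a \<in> X" for a
      using representsD(3)[OF rep] that r[OF that] val[OF that] val'[OF that] by (cases "C a") auto
    show "c \<in> l ` X" if "\<sigma>' c \<noteq> Leaf" for c
      using that representsD(2)[OF rep x(1)] by (intro representsD(4)[OF rep]) (auto simp: \<sigma>' split: if_splits)
    show "\<sigma>' (l a) = one" if "a \<in> X" "\<not> C a" for a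
      using val'[OF that] representsD(5)[OF rep that] by simp
    show "right (\<sigma>' (l a)) \<in> {Leaf, one}" if "a \<in> X" for a
      using representsD(6)[OF rep] that r[OF that] val[OF that] val'[OF that] by (cases "C a") auto
    show "left (\<sigma>' (l a)) = left (\<sigma>' (l b)) \<longleftrightarrow> (a, b) \<in> merge_classes R x y"
      if "a \<in> X" "b \<in> X" "C a" "C b" for a b
      using that r by (simp add: iff val representsD(7)[OF rep])
    show "right (\<sigma>' (l a)) \<noteq> Leaf \<longleftrightarrow> (\<exists>t\<in>T \<inter> X. (a, t) \<in> merge_classes R x y)"
      if "a \<in> X" "C a" for a
      using that r by (simp add: iff val rt representsD(8)[OF rep] cong: bex_cong del: Int_iff)
    show "t = t'" if "t \<in> T \<inter> X" "t' \<in> T \<inter> X" "(t, t') \<in> merge_classes R x y" for t t'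
      using that representsD(9)[OF rep that(1,2)] by (simp add: iff rt del: Int_iff)
  qed
qed

text \<open>Success means equal values or a class without a terminal, which is then substituted by
  the other. Both directions of substitution yield the same relation, as merging is symmetric in
  \<open>x\<close> and \<open>y\<close>.\<close>

lemma represents_merge:
  assumes rep: "represents X l T R C (assoc s)" and x: "x \<in> X" "C x" and y: "y \<in> X" "C y"
    and ne: "merge s (assoc s (l x)) (assoc s (l y)) \<noteq> Leaf"
  shows "represents X l T (merge_classes R x y) C
    (assoc (merge s (assoc s (l x)) (assoc s (l y))))"
proof (cases "assoc s (l x) = assoc s (l y)")
  case True
  then have "(x, y) \<in> R"
    using represents_value_eq[OF rep x y] by simp
  with True show ?thesis
    using rep merge_classes_trivial[OF representsD(1)[OF rep]] by (simp add: merge_def)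
next
  case False
  have left: "left (assoc s (l x)) \<noteq> Leaf" "left (assoc s (l y)) \<noteq> Leaf"
    using representsD(3)[OF rep] x y by auto
  then have Leaf: "assoc s (l x) \<noteq> Leaf" "assoc s (l y) \<noteq> Leaf"
    by auto
  show ?thesis
  proof (cases "right (assoc s (l x)) = Leaf")
    case True
    with False left have "merge s (assoc s (l x)) (assoc s (l y)) =
        subst s (assoc s (l x)) (assoc s (l y))"
      by (simp add: merge_def)
    then show ?thesis
      using represents_subst[OF rep x y True] assoc_subst[OF Leaf(1)] by simp
  next
    case bit: False
    then have bit': "right (assoc s (l y)) = Leaf"
      using ne False left by (auto simp: merge_def split: if_splits)
    with False bit left have "merge s (assoc s (l x)) (assoc s (l y)) =
        subst s (assoc s (l y)) (assoc s (l x))"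
      by (simp add: merge_def)
    then show ?thesis
      using represents_subst[OF rep y x bit'] assoc_subst[OF Leaf(2)]
      by (simp add: merge_classes_commute[of R x y])
  qed
qed

text \<open>A failure requires terminals in two different classes. \<open>Q\<close> relates these
  two terminals, so they are equal, and then the classes are not different.\<close>

lemma merge_neq_Leaf:
  assumes rep: "represents X l T R C (assoc s)" and x: "x \<in> X" "C x" and y: "y \<in> X" "C y"
    and Q: "sym Q" "trans Q" "R \<subseteq> Q" "(x, y) \<in> Q"
    and T: "\<And>t t'. t \<in> T \<inter> X \<Longrightarrow> t' \<in> T \<inter> X \<Longrightarrow> (t, t') \<in> Q \<Longrightarrow> t = t'"
  shows "merge s (assoc s (l x)) (assoc s (l y)) \<noteq> Leaf"
proof
  assume *: "merge s (assoc s (l x)) (assoc s (l y)) = Leaf"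
  have left: "left (assoc s (l x)) \<noteq> Leaf" "left (assoc s (l y)) \<noteq> Leaf"
    using representsD(3)[OF rep] x y by auto
  then have "s \<noteq> Leaf"
    by auto
  with * left have "right (assoc s (l x)) \<noteq> Leaf" "right (assoc s (l y)) \<noteq> Leaf"
    and ne: "assoc s (l x) \<noteq> assoc s (l y)"
    by (auto simp: merge_def split: if_splits)
  then obtain t t' where t: "t \<in> T \<inter> X" "(x, t) \<in> R" "t' \<in> T \<inter> X" "(y, t') \<in> R"
    using representsD(8)[OF rep x] representsD(8)[OF rep y] by blast
  then have "(t, t') \<in> Q"
    using Q by (meson subsetD symD transD)
  then have "t = t'"
    using t T by blast
  then have "(x, y) \<in> R"
    using t representsD(1)[OF rep] by (meson equivE symE transE)
  then show False
    using represents_value_eq[OF rep x y] ne by simp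
qed

lemma keys_merge: "merge s u v \<noteq> Leaf \<Longrightarrow> map left (items (merge s u v)) = map left (items s)"
  by (auto simp: merge_def split: if_splits)

lemma keys_relab: "relab s a b \<noteq> Leaf \<Longrightarrow> map left (items (relab s a b)) = map left (items s)"
  by (auto simp: relab_def keys_merge split: if_splits)

text \<open>This is the renaming part of a relabelling, separated from the merge: it applies once
  the values of two live labels agree.\<close>

lemma represents_move:
  assumes rep: "represents X l T R C \<sigma>" and "a \<noteq> b"
    and eq: "\<And>x y. x \<in> X \<Longrightarrow> y \<in> X \<Longrightarrow> l x = a \<Longrightarrow> l y = b \<Longrightarrow> \<sigma> a = \<sigma> b"
  shows "represents X (\<lambda>x. if l x = a then b else l x) T R C
    (\<sigma>(b := if \<sigma> b = Leaf then \<sigma> a else \<sigma> b, a := Leaf))"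
proof (rule represents_cong[OF rep])
  let ?l' = "\<lambda>x. if l x = a then b else l x"
  let ?\<sigma>' = "\<sigma>(b := if \<sigma> b = Leaf then \<sigma> a else \<sigma> b, a := Leaf)"
  show "?\<sigma>' (?l' x) = \<sigma> (l x)" if "x \<in> X" for x
  proof (cases "l x = a")
    case True
    show ?thesis
    proof (cases "\<sigma> b = Leaf")
      case False
      then obtain y where "y \<in> X" "l y = b"
        using representsD(4)[OF rep] by blast
      with True False eq[OF that, of y] show ?thesis
        using \<open>a \<noteq> b\<close> by simp
    qed (use True \<open>a \<noteq> b\<close> in simp)
  next
    case False
    then show ?thesis
      using representsD(2)[OF rep that] by auto
  qed
  show "c \<in> ?l' ` X" if c: "?\<sigma>' c \<noteq> Leaf" for c
  proof (cases "c = b \<and> \<sigma> b = Leaf")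
    case True
    then have "\<sigma> a \<noteq> Leaf"
      using c \<open>a \<noteq> b\<close> by (auto split: if_splits)
    then obtain x where "x \<in> X" "l x = a"
      using representsD(4)[OF rep] by blast
    with True show ?thesis
      by (auto intro!: image_eqI[of _ _ x])
  next
    case False
    then have "\<sigma> c \<noteq> Leaf" "c \<noteq> a"
      using c by (auto split: if_splits)
    then obtain x where "x \<in> X" "l x = c"
      using representsD(4)[OF rep] by blast
    with \<open>c \<noteq> a\<close> show ?thesis
      by (auto intro!: image_eqI[of _ _ x])
  qed
qed

text \<open>The last clause is minimality: merges add only what every symmetric and transitive
  \<open>Q\<close> above \<open>R\<close> must contain if it relates the vertices labelled
  \<open>a\<close> in a class to those labelled \<open>b\<close>. Soundness of the tables needs that
  the relation grows, completeness that it grows no further than this.\<close>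

lemma represents_relab:
  assumes rep: "represents X l T R C (assoc s)" and ab: "{a, b} \<subseteq> left ` set (items s)"
    and ne: "relab s a b \<noteq> Leaf"
  shows "\<exists>R'. R \<subseteq> R' \<and>
    represents X (\<lambda>x. if l x = a then b else l x) T R' C (assoc (relab s a b)) \<and>
    (\<forall>Q. sym Q \<longrightarrow> trans Q \<longrightarrow> R \<subseteq> Q \<longrightarrow>
      (\<forall>x\<in>X. \<forall>y\<in>X. l x = a \<longrightarrow> l y = b \<longrightarrow> C x \<longrightarrow> (x, y) \<in> Q) \<longrightarrow> R' \<subseteq> Q)"
proof -
  have I: ?thesis if "R \<subseteq> R'"
    "represents X (\<lambda>x. if l x = a then b else l x) T R' C (assoc (relab s a b))"
    "\<And>Q. sym Q \<Longrightarrow> trans Q \<Longrightarrow> R \<subseteq> Q \<Longrightarrow>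
      (\<And>x y. x \<in> X \<Longrightarrow> y \<in> X \<Longrightarrow> l x = a \<Longrightarrow> l y = b \<Longrightarrow> C x \<Longrightarrow> (x, y) \<in> Q) \<Longrightarrow> R' \<subseteq> Q" for R'
    using that by (intro exI[of _ R']) simp
  show ?thesis
  proof (cases "a = b \<or> assoc s a = Leaf")
    case True
    then have *: "(if l x = a then b else l x) = l x" if "x \<in> X" for x
      using representsD(2)[OF rep that] by auto
    have "represents X (\<lambda>x. if l x = a then b else l x) T R C (assoc s)"
      by (rule represents_cong[OF rep]) (use * representsD(4)[OF rep] in \<open>auto simp: image_iff\<close>)
    with True show ?thesis
      by (intro I[of R]) (auto simp: relab_def)
  next
    case False
    then obtain x where x: "x \<in> X" "l x = a"
      using representsD(4)[OF rep] by blast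
    show ?thesis
    proof (cases "assoc s b = Leaf")
      case True
      then have "assoc (relab s a b) =
          (assoc s)(b := if assoc s b = Leaf then assoc s a else assoc s b, a := Leaf)"
        using False ab by (simp add: relab_def assoc_upd del: keys_upd)
          (simp add: assoc_upd set_map[symmetric] del: set_map)
      then have "represents X (\<lambda>x. if l x = a then b else l x) T R C (assoc (relab s a b))"
        using represents_move[OF rep, of a b] False True representsD(2)[OF rep] by force
      then show ?thesis
        by (intro I[of R]) auto
    next
      case b: False
      then obtain y where y: "y \<in> X" "l y = b"
        using representsD(4)[OF rep] by blast
      define s' where "s' = merge s (assoc s a) (assoc s b)"
      have relab: "relab s a b = upd s' a Leaf"
        using False b by (simp add: relab_def s'_def)
      then have s': "s' \<noteq> Leaf"
        using ne by auto
      have "a \<in> left ` set (items s')"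
        using keys_merge[of s "assoc s a" "assoc s b"] s' ab unfolding s'_def
        by (metis image_set insert_subset)
      then have assoc: "assoc (relab s a b) = (assoc s')(a := Leaf)"
        using relab by (simp add: assoc_upd)
      have "\<exists>R'. R \<subseteq> R' \<and> represents X l T R' C (assoc s') \<and> assoc s' a = assoc s' b \<and>
        (C x \<and> R' = merge_classes R x y \<or> R' = R)"
      proof (cases "C x \<and> C y")
        case True
        then have "represents X l T (merge_classes R x y) C (assoc s')"
          using represents_merge[OF rep x(1) _ y(1)] s' x y by (simp add: s'_def)
        moreover from this have "assoc s' a = assoc s' b"
          using represents_value_eq[of X l T "merge_classes R x y" C "assoc s'" x y] x y True
            mem_merge_classes[OF representsD(1)[OF rep], of x y] by simp
        ultimately show ?thesis
          using True subset_merge_classes[of R x y]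
          by (intro exI[of _ "merge_classes R x y"]) simp
      next
        case nC: False
        \<comment> \<open>One of the two values is \<open>one\<close>, and merging it with a
          different value fails. So the values agree, and neither the state nor the relation
          changes.\<close>
        then have "assoc s a = one \<or> assoc s b = one"
          using representsD(5)[OF rep x(1)] representsD(5)[OF rep y(1)] x y by auto
        then have "s' = s" "assoc s a = assoc s b"
          using s' by (auto simp: s'_def merge_def split: if_splits)
        with rep show ?thesis
          by auto
      qed
      then obtain R' where R': "R \<subseteq> R'" "represents X l T R' C (assoc s')" "assoc s' a = assoc s' b"
        "C x \<and> R' = merge_classes R x y \<or> R' = R"
        by blast
      have "assoc s' b \<noteq> Leaf"
        using representsD(2)[OF R'(2) y(1)] y by simp
      then have "(assoc s')(b := if assoc s' b = Leaf then assoc s' a else assoc s' b, a := Leaf) =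
          (assoc s')(a := Leaf)"
        by auto
      then have "represents X (\<lambda>x. if l x = a then b else l x) T R' C (assoc (relab s a b))"
        using represents_move[OF R'(2), of a b] False R'(3) assoc by simp
      with R'(1) show ?thesis
      proof (rule I)
        fix Q
        assume Q: "sym Q" "trans Q" "R \<subseteq> Q"
          "\<And>x y. x \<in> X \<Longrightarrow> y \<in> X \<Longrightarrow> l x = a \<Longrightarrow> l y = b \<Longrightarrow> C x \<Longrightarrow> (x, y) \<in> Q"
        show "R' \<subseteq> Q"
          using R'(4) merge_classes_least[OF Q(1-3)] Q(3) Q(4)[OF x(1) y(1) x(2) y(2)] by blast
      qed
    qed
  qed
qed

lemma relab_neq_Leaf:
  assumes rep: "represents X l T R C (assoc s)" and "s \<noteq> Leaf"
    and Q: "sym Q" "trans Q" "R \<subseteq> Q"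
    and T: "\<And>t t'. t \<in> T \<inter> X \<Longrightarrow> t' \<in> T \<inter> X \<Longrightarrow> (t, t') \<in> Q \<Longrightarrow> t = t'"
    and C: "\<And>x y. x \<in> X \<Longrightarrow> y \<in> X \<Longrightarrow> l x = a \<Longrightarrow> l y = b \<Longrightarrow>
      C x = C y \<and> (C x \<longrightarrow> (x, y) \<in> Q)"
  shows "relab s a b \<noteq> Leaf"
proof (cases "a = b \<or> assoc s a = Leaf \<or> assoc s b = Leaf")
  case True
  with \<open>s \<noteq> Leaf\<close> show ?thesis
    by (auto simp: relab_def)
next
  case False
  then obtain x y where x: "x \<in> X" "l x = a" and y: "y \<in> X" "l y = b"
    using representsD(4)[OF rep] by blast
  have "merge s (assoc s a) (assoc s b) \<noteq> Leaf"
  proof (cases "C x")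
    case True
    then show ?thesis
      using merge_neq_Leaf[OF rep x(1) _ y(1) _ Q _ T] C[OF x(1) y(1) x(2) y(2)] x y by auto
  next
    case False
    then have "assoc s a = assoc s b"
      using representsD(5)[OF rep x(1)] representsD(5)[OF rep y(1)] C[OF x(1) y(1) x(2) y(2)] x y
      by auto
    then show ?thesis
      using \<open>s \<noteq> Leaf\<close> by (simp add: merge_def)
  qed
  then show ?thesis
    using False by (simp add: relab_def)
qed

text \<open>Success forces both live labels to be classes. Each of them then lies in a single class,
  so one merge relates all vertices labelled \<open>a\<close> to all vertices labelled
  \<open>b\<close>.\<close>

lemma represents_join:
  assumes rep: "represents X l T R C (assoc s)" and ne: "join s a b \<noteq> Leaf"
  shows "\<exists>R'. R \<subseteq> R' \<and> represents X l T R' C (assoc (join s a b)) \<and>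
    (\<forall>x\<in>X. \<forall>y\<in>X. l x = a \<longrightarrow> l y = b \<longrightarrow> (x, y) \<in> R') \<and>
    (\<forall>Q. sym Q \<longrightarrow> trans Q \<longrightarrow> R \<subseteq> Q \<longrightarrow>
      (\<forall>x\<in>X. \<forall>y\<in>X. l x = a \<longrightarrow> l y = b \<longrightarrow> (x, y) \<in> Q) \<longrightarrow> R' \<subseteq> Q)"
proof -
  have I: ?thesis if "R \<subseteq> R'" "represents X l T R' C (assoc (join s a b))"
    "\<And>x y. x \<in> X \<Longrightarrow> y \<in> X \<Longrightarrow> l x = a \<Longrightarrow> l y = b \<Longrightarrow> (x, y) \<in> R'"
    "\<And>Q. sym Q \<Longrightarrow> trans Q \<Longrightarrow> R \<subseteq> Q \<Longrightarrow>
      (\<And>x y. x \<in> X \<Longrightarrow> y \<in> X \<Longrightarrow> l x = a \<Longrightarrow> l y = b \<Longrightarrow> (x, y) \<in> Q) \<Longrightarrow> R' \<subseteq> Q" for R'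
    using that by (intro exI[of _ R']) simp
  show ?thesis
  proof (cases "assoc s a = Leaf \<or> assoc s b = Leaf")
    case True
    show ?thesis
    proof (rule I[of R])
      show "(x, y) \<in> R" if "x \<in> X" "y \<in> X" "l x = a" "l y = b" for x y
        using True representsD(2)[OF rep] that by blast
    qed (use True rep in \<open>auto simp: join_def\<close>)
  next
    case False
    then obtain x y where x: "x \<in> X" "l x = a" and y: "y \<in> X" "l y = b"
      using representsD(4)[OF rep] by blast
    have C: "C z" if "z \<in> X" "l z \<in> {a, b}" for z
      using representsD(3)[OF rep that(1)] that(2) ne False by (auto simp: join_def split: if_splits)
    have join: "join s a b = merge s (assoc s (l x)) (assoc s (l y))"
      using ne False x y by (auto simp: join_def split: if_splits)
    show ?thesis
    proof (rule I[of "merge_classes R x y"])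
      show "represents X l T (merge_classes R x y) C (assoc (join s a b))"
        unfolding join using represents_merge[OF rep x(1) C y(1) C] x y ne join by simp
      show "(u, v) \<in> merge_classes R x y" if "u \<in> X" "v \<in> X" "l u = a" "l v = b" for u v
      proof -
        have "(x, u) \<in> R" "(y, v) \<in> R"
          using represents_value_eq[OF rep x(1) C that(1) C]
            represents_value_eq[OF rep y(1) C that(2) C] x y that by auto
        then show ?thesis
          by (auto simp: merge_classes_def)
      qed
      show "merge_classes R x y \<subseteq> Q" if "sym Q" "trans Q" "R \<subseteq> Q"
        "\<And>x y. x \<in> X \<Longrightarrow> y \<in> X \<Longrightarrow> l x = a \<Longrightarrow> l y = b \<Longrightarrow> (x, y) \<in> Q" for Q
        using merge_classes_least that x y by metis
    qed (rule subset_merge_classes)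
  qed
qed

lemma join_neq_Leaf:
  assumes rep: "represents X l T R C (assoc s)" and "s \<noteq> Leaf"
    and Q: "sym Q" "trans Q" "R \<subseteq> Q"
    and T: "\<And>t t'. t \<in> T \<inter> X \<Longrightarrow> t' \<in> T \<inter> X \<Longrightarrow> (t, t') \<in> Q \<Longrightarrow> t = t'"
    and C: "\<And>x y. x \<in> X \<Longrightarrow> y \<in> X \<Longrightarrow> l x = a \<Longrightarrow> l y = b \<Longrightarrow> C x \<and> C y \<and> (x, y) \<in> Q"
  shows "join s a b \<noteq> Leaf"
proof (cases "assoc s a = Leaf \<or> assoc s b = Leaf")
  case True
  with \<open>s \<noteq> Leaf\<close> show ?thesis
    by (auto simp: join_def)
next
  case False
  then obtain x y where x: "x \<in> X" "l x = a" and y: "y \<in> X" "l y = b"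
    using representsD(4)[OF rep] by blast
  have *: "C x" "C y" "(x, y) \<in> Q"
    using C[OF x(1) y(1) x(2) y(2)] by auto
  have "merge s (assoc s (l x)) (assoc s (l y)) \<noteq> Leaf"
    using merge_neq_Leaf[OF rep x(1) _ y(1) _ Q _ T] * by blast
  then show ?thesis
    using False x y * representsD(3)[OF rep x(1)] representsD(3)[OF rep y(1)]
    by (simp add: join_def)
qed

lemma represents_commit_cong:
  assumes "\<And>x. x \<in> X \<Longrightarrow> C x = C' x"
  shows "represents X l T R C \<sigma> \<longleftrightarrow> represents X l T R C' \<sigma>"
proof -
  have *: "represents X l T R C' \<sigma>" if eq: "\<And>x. x \<in> X \<Longrightarrow> C x = C' x"
    and rep: "represents X l T R C \<sigma>" for C C'
    by (rule representsI) (use representsD[OF rep] eq in \<open>auto simp del: Int_iff\<close>)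
  show ?thesis
    using *[of C C'] *[of C' C] assms by auto
qed

text \<open>The relation stays the same. Conditions on names and bits concern only vertices with
  \<open>C\<close>, so shrinking \<open>C\<close> drops some of them and adds only that forgotten
  labels have value \<open>one\<close>.\<close>

lemma represents_forget:
  assumes rep: "represents X l T R C (assoc s)"
  shows "represents X l T R (\<lambda>x. C x \<and> l x \<noteq> a) (assoc (forget s a))"
proof (cases "assoc s a = Leaf")
  case True
  then have "l x \<noteq> a" if "x \<in> X" for x
    using representsD(2)[OF rep that] by auto
  then have "represents X l T R (\<lambda>x. C x \<and> l x \<noteq> a) (assoc s)"
    using rep represents_commit_cong[of X C "\<lambda>x. C x \<and> l x \<noteq> a"] by simp
  with True show ?thesis
    by (simp add: forget_def)
next
  case False
  then have *: "assoc (forget s a) = (assoc s)(a := one)"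
    using assoc_upd[OF assoc_keys[OF False]] by (simp add: forget_def)
  have a: "a \<in> l ` X"
    using representsD(4)[OF rep False] .
  show ?thesis
    unfolding *
    by (rule representsI)
      (use a representsD[OF rep] in \<open>auto split: if_splits\<close>)
qed

section \<open>Disjoint union as concatenation of tagged states followed by relabellings\<close>

definition untag :: "data \<Rightarrow> data \<Rightarrow> data" where
  "untag K c = (if \<exists>a\<in>set (items K). c = Node a Leaf then left c else c)"

lemma untag_Leaf [simp]: "untag Leaf c = c"
  by (simp add: untag_def)

text \<open>Removals do not cascade: the label that remains after removing a tag is, by hypothesis,
  not itself a tagged label from the rest of the list.\<close>

lemma untag_Node:
  "\<forall>a'\<in>set (items K). a \<noteq> Node a' Leaf \<Longrightarrow>
    untag (Node a K) c = untag K (if c = Node a Leaf then a else c)"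
  by (auto simp: untag_def)

lemma relab_Leaf [simp]: "relab Leaf a b = Leaf"
  by (simp add: relab_def)

lemma fuse_Leaf [simp]: "fuse K Leaf = Leaf"
  by (induction K) auto

text \<open>Minimality composes along the list: two labels merged in one step have the same final
  untagged label, so their vertices are among the pairs that \<open>Q\<close> is assumed to
  contain.\<close>

lemma represents_fuse:
  assumes "represents X l T R C (assoc s)" "fuse K s \<noteq> Leaf"
    and "\<forall>a\<in>set (items K). {Node a Leaf, a} \<subseteq> left ` set (items s)"
    and "\<forall>a\<in>set (items K). \<forall>a'\<in>set (items K). a \<noteq> Node a' Leaf"
  shows "\<exists>R'. R \<subseteq> R' \<and> represents X (\<lambda>x. untag K (l x)) T R' C (assoc (fuse K s)) \<and>
    (\<forall>Q. sym Q \<longrightarrow> trans Q \<longrightarrow> R \<subseteq> Q \<longrightarrow>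
      (\<forall>x\<in>X. \<forall>y\<in>X. untag K (l x) = untag K (l y) \<longrightarrow> C x \<longrightarrow> (x, y) \<in> Q) \<longrightarrow> R' \<subseteq> Q)"
  using assms
proof (induction K arbitrary: l R s)
  case Leaf
  then show ?case
    by (intro exI[of _ R]) auto
next
  case (Node a K)
  define s1 where "s1 = relab s (Node a Leaf) a"
  define l1 where "l1 = (\<lambda>x. if l x = Node a Leaf then a else l x)"
  have fuse: "fuse (Node a K) s = fuse K s1"
    by (simp add: s1_def)
  then have s1: "s1 \<noteq> Leaf"
    using Node.prems(2) by auto
  have keys: "left ` set (items s1) = left ` set (items s)"
    using keys_relab[of s "Node a Leaf" a] s1 unfolding s1_def by (metis image_set)
  have untag: "untag (Node a K) (l x) = untag K (l1 x)" for x
    unfolding l1_def by (rule untag_Node) (use Node.prems(4) in auto)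
  have ab: "{Node a Leaf, a} \<subseteq> left ` set (items s)"
    using Node.prems(3) by simp
  obtain R1 where R1: "R \<subseteq> R1" "represents X l1 T R1 C (assoc s1)"
    and least: "\<forall>Q. sym Q \<longrightarrow> trans Q \<longrightarrow> R \<subseteq> Q \<longrightarrow>
      (\<forall>x\<in>X. \<forall>y\<in>X. l x = Node a Leaf \<longrightarrow> l y = a \<longrightarrow> C x \<longrightarrow> (x, y) \<in> Q) \<longrightarrow> R1 \<subseteq> Q"
    using represents_relab[OF Node.prems(1) ab s1[unfolded s1_def], folded s1_def l1_def]
    by (elim exE conjE) (rule that)
  obtain R' where R': "R1 \<subseteq> R'" "represents X (\<lambda>x. untag K (l1 x)) T R' C (assoc (fuse K s1))"
    and least': "\<And>Q. sym Q \<Longrightarrow> trans Q \<Longrightarrow> R1 \<subseteq> Q \<Longrightarrow>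
      (\<forall>x\<in>X. \<forall>y\<in>X. untag K (l1 x) = untag K (l1 y) \<longrightarrow> C x \<longrightarrow> (x, y) \<in> Q) \<Longrightarrow> R' \<subseteq> Q"
    using Node.IH(2)[OF R1(2)] Node.prems(2-4) keys fuse by auto
  show ?case
  proof (intro exI[of _ R'] conjI allI impI)
    fix Q
    assume Q: "sym Q" "trans Q" "R \<subseteq> Q"
      "\<forall>x\<in>X. \<forall>y\<in>X. untag (Node a K) (l x) = untag (Node a K) (l y) \<longrightarrow> C x \<longrightarrow> (x, y) \<in> Q"
    have "(x, y) \<in> Q" if "x \<in> X" "y \<in> X" "l x = Node a Leaf" "l y = a" "C x" for x y
    proof -
      have "l1 x = l1 y"
        using that by (auto simp: l1_def)
      then have "untag (Node a K) (l x) = untag (Node a K) (l y)"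
        by (simp only: untag)
      then show ?thesis
        using Q(4) that(1,2,5) by blast
    qed
    then have "R1 \<subseteq> Q"
      using least Q(1-3) by blast
    then show "R' \<subseteq> Q"
      using Q by (intro least') (simp_all add: untag)
  qed (use R' R1 in \<open>auto simp: untag s1_def\<close>)
qed

text \<open>Here minimality of the single relabelling is used: it brings the intermediate relation
  back inside \<open>Q\<close>, without which the next step could not be shown to succeed.\<close>

lemma fuse_neq_Leaf:
  assumes "represents X l T R C (assoc s)" "s \<noteq> Leaf" "R \<subseteq> Q"
    and "\<forall>a\<in>set (items K). {Node a Leaf, a} \<subseteq> left ` set (items s)"
    and "\<forall>a\<in>set (items K). \<forall>a'\<in>set (items K). a \<noteq> Node a' Leaf"
    and "\<forall>x\<in>X. \<forall>y\<in>X. untag K (l x) = untag K (l y) \<longrightarrow> C x = C y \<and> (C x \<longrightarrow> (x, y) \<in> Q)"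
    and Q: "sym Q" "trans Q"
    and T: "\<And>t t'. t \<in> T \<inter> X \<Longrightarrow> t' \<in> T \<inter> X \<Longrightarrow> (t, t') \<in> Q \<Longrightarrow> t = t'"
  shows "fuse K s \<noteq> Leaf"
  using assms(1-6)
proof (induction K arbitrary: l R s)
  case Leaf
  then show ?case by simp
next
  case (Node a K)
  define s1 where "s1 = relab s (Node a Leaf) a"
  define l1 where "l1 = (\<lambda>x. if l x = Node a Leaf then a else l x)"
  have untag: "untag (Node a K) (l x) = untag K (l1 x)" for x
    unfolding l1_def by (rule untag_Node) (use Node.prems(5) in auto)
  have C: "C x = C y \<and> (C x \<longrightarrow> (x, y) \<in> Q)"
    if "x \<in> X" "y \<in> X" "l x = Node a Leaf" "l y = a" for x y
  proof -
    have "l1 x = l1 y"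
      using that by (auto simp: l1_def)
    then have "untag (Node a K) (l x) = untag (Node a K) (l y)"
      by (simp only: untag)
    then show ?thesis
      using Node.prems(6) that(1,2) by blast
  qed
  have s1: "s1 \<noteq> Leaf"
    unfolding s1_def
    by (rule relab_neq_Leaf[OF Node.prems(1,2) Q Node.prems(3) T C])
  have keys: "left ` set (items s1) = left ` set (items s)"
    using keys_relab[of s "Node a Leaf" a] s1 unfolding s1_def by (metis image_set)
  have ab: "{Node a Leaf, a} \<subseteq> left ` set (items s)"
    using Node.prems(4) by simp
  obtain R1 where R1: "R \<subseteq> R1" "represents X l1 T R1 C (assoc s1)"
    and least: "\<forall>Q. sym Q \<longrightarrow> trans Q \<longrightarrow> R \<subseteq> Q \<longrightarrow>
      (\<forall>x\<in>X. \<forall>y\<in>X. l x = Node a Leaf \<longrightarrow> l y = a \<longrightarrow> C x \<longrightarrow> (x, y) \<in> Q) \<longrightarrow> R1 \<subseteq> Q"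
    using represents_relab[OF Node.prems(1) ab s1[unfolded s1_def], folded s1_def l1_def]
    by (elim exE conjE) (rule that)
  have "R1 \<subseteq> Q"
    using least Q Node.prems(3) C by blast
  moreover have "\<forall>a\<in>set (items K). {Node a Leaf, a} \<subseteq> left ` set (items s1)"
    unfolding keys using Node.prems(4) by simp
  moreover have "\<forall>a\<in>set (items K). \<forall>a'\<in>set (items K). a \<noteq> Node a' Leaf"
    using Node.prems(5) by simp
  ultimately have "fuse K s1 \<noteq> Leaf"
    using Node.prems(6) unfolding untag by (rule Node.IH(2)[OF R1(2) s1])
  then show ?case
    by (simp add: s1_def)
qed

text \<open>\<open>sep\<close> keeps the labels of the two sides apart and \<open>names\<close>
  their class names; a coincidence of names would read as one class spanning both sides, although
  \<open>R1 \<union> R2\<close> relates no such vertices.\<close>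

lemma represents_app_tag:
  assumes rep1: "represents X1 l1 T R1 C (assoc s1)" and rep2: "represents X2 l2 T R2 C (assoc s2)"
    and disj: "X1 \<inter> X2 = {}"
    and sep: "\<And>a b. a \<in> left ` set (items s1) \<Longrightarrow> b \<in> left ` set (items s2) \<Longrightarrow> a \<noteq> Node b Leaf"
    and names: "\<And>x y. x \<in> X1 \<Longrightarrow> y \<in> X2 \<Longrightarrow> C x \<Longrightarrow> C y \<Longrightarrow>
      left (assoc s1 (l1 x)) \<noteq> Node (left (assoc s2 (l2 y))) Leaf"
  shows "represents (X1 \<union> X2) (\<lambda>x. if x \<in> X1 then l1 x else Node (l2 x) Leaf) T (R1 \<union> R2) C
    (assoc (app s1 (tag s2)))"
proof -
  let ?l = "\<lambda>x. if x \<in> X1 then l1 x else Node (l2 x) Leaf"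
  let ?\<sigma> = "assoc (app s1 (tag s2))"
  have \<sigma>1: "?\<sigma> (?l x) = assoc s1 (l1 x)" if "x \<in> X1" for x
    using that assoc_keys[OF representsD(2)[OF rep1 that]] by (simp add: assoc_app)
  have \<sigma>2: "?\<sigma> (?l x) = tag_value (assoc s2 (l2 x))" "x \<notin> X1" if "x \<in> X2" for x
    using that assoc_keys[OF representsD(2)[OF rep2 that]] sep disj
    by (auto simp: assoc_app assoc_tag)
  have R1: "R1 \<subseteq> X1 \<times> X1" and R2: "R2 \<subseteq> X2 \<times> X2"
    using representsD(1)[OF rep1] representsD(1)[OF rep2] by (auto simp: equiv_def refl_on_def)
  have cross: "(x, y) \<notin> R1 \<union> R2" if "x \<in> X1 \<and> y \<in> X2 \<or> x \<in> X2 \<and> y \<in> X1" for x y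
    using that R1 R2 disj by auto
  have tv: "tag_value v = Leaf \<longleftrightarrow> v = Leaf" "left (tag_value v) = Leaf \<longleftrightarrow> left v = Leaf"
    "right (tag_value v) = right v" for v
    by (cases v; auto simp: tag_value_def)+
  have tvl: "left (tag_value v) = Node (left v) Leaf" if "left v \<noteq> Leaf" for v
    using that by (simp add: tag_value_def)
  show ?thesis
  proof (rule representsI)
    show "equiv (X1 \<union> X2) (R1 \<union> R2)"
    proof (rule equivI)
      show "R1 \<union> R2 \<subseteq> (X1 \<union> X2) \<times> (X1 \<union> X2)"
        using R1 R2 by auto
      show "refl_on (X1 \<union> X2) (R1 \<union> R2)"
        using representsD(1)[OF rep1] representsD(1)[OF rep2] by (auto simp: equiv_def refl_on_def)
      show "sym (R1 \<union> R2)"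
        using representsD(1)[OF rep1] representsD(1)[OF rep2] by (simp add: equiv_def sym_Un)
      have "trans R1" "trans R2"
        using representsD(1)[OF rep1] representsD(1)[OF rep2] by (auto simp: equiv_def)
      then show "trans (R1 \<union> R2)"
        using R1 R2 disj unfolding trans_def by blast
    qed
    show "?\<sigma> (?l x) \<noteq> Leaf" if "x \<in> X1 \<union> X2" for x
      using that representsD(2)[OF rep1] representsD(2)[OF rep2] \<sigma>1 \<sigma>2 tv by (metis UnE)
    show "C x \<longleftrightarrow> left (?\<sigma> (?l x)) \<noteq> Leaf" if "x \<in> X1 \<union> X2" for x
      using that representsD(3)[OF rep1] representsD(3)[OF rep2] \<sigma>1 \<sigma>2 tv by (metis UnE)
    show "c \<in> ?l ` (X1 \<union> X2)" if c: "?\<sigma> c \<noteq> Leaf" for c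
    proof (cases "c \<in> left ` set (items s1)")
      case True
      then have "assoc s1 c \<noteq> Leaf"
        using c by (simp add: assoc_app)
      then obtain x where "x \<in> X1" "l1 x = c"
        using representsD(4)[OF rep1] by blast
      then show ?thesis
        by (intro image_eqI[of _ _ x]) auto
    next
      case False
      then have c': "assoc (tag s2) c \<noteq> Leaf"
        using c by (simp add: assoc_app)
      then obtain d where d: "c = Node d Leaf"
        using assoc_keys[OF c'] by (auto simp: keys_tag)
      then have "assoc s2 d \<noteq> Leaf"
        using c' by (simp add: assoc_tag tv)
      then obtain x where "x \<in> X2" "l2 x = d"
        using representsD(4)[OF rep2] by blast
      then show ?thesis
        using d \<sigma>2(2) by (intro image_eqI[of _ _ x]) auto
    qed
    show "?\<sigma> (?l x) = one" if "x \<in> X1 \<union> X2" "\<not> C x" for x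
      using that representsD(5)[OF rep1] representsD(5)[OF rep2] \<sigma>1 \<sigma>2
      by (metis UnE tag_value_def left.simps(2))
    show "right (?\<sigma> (?l x)) \<in> {Leaf, one}" if "x \<in> X1 \<union> X2" for x
      using that representsD(6)[OF rep1] representsD(6)[OF rep2] \<sigma>1 \<sigma>2 tv by (metis UnE)
    show "left (?\<sigma> (?l x)) = left (?\<sigma> (?l y)) \<longleftrightarrow> (x, y) \<in> R1 \<union> R2"
      if "x \<in> X1 \<union> X2" "y \<in> X1 \<union> X2" "C x" "C y" for x y
    proof -
      have l2: "left (assoc s2 (l2 z)) \<noteq> Leaf" if "z \<in> X2" "C z" for z
        using representsD(3)[OF rep2 that(1)] that(2) by simp
      consider "x \<in> X1" "y \<in> X1" | "x \<in> X1" "y \<in> X2" | "x \<in> X2" "y \<in> X1" | "x \<in> X2" "y \<in> X2"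
        using \<open>x \<in> X1 \<union> X2\<close> \<open>y \<in> X1 \<union> X2\<close> by blast
      then show ?thesis
      proof cases
        case 1
        then have "(x, y) \<notin> R2"
          using R2 disj by auto
        with 1 show ?thesis
          using \<sigma>1 representsD(7)[OF rep1 1 that(3,4)] by simp
      next
        case 2
        then show ?thesis
          using \<sigma>1 \<sigma>2 cross[of x y] names[OF 2 that(3,4)] tvl[OF l2[OF 2(2) that(4)]] by simp
      next
        case 3
        then show ?thesis
          using \<sigma>1 \<sigma>2 cross[of x y] names[OF 3(2,1) that(4,3)] tvl[OF l2[OF 3(1) that(3)]] by simp
      next
        case 4
        then have "(x, y) \<notin> R1"
          using R1 disj by auto
        with 4 show ?thesis
          using \<sigma>2 representsD(7)[OF rep2 4 that(3,4)] tvl[OF l2[OF 4(1) that(3)]]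
            tvl[OF l2[OF 4(2) that(4)]] by simp
      qed
    qed
    show "right (?\<sigma> (?l x)) \<noteq> Leaf \<longleftrightarrow> (\<exists>t\<in>T \<inter> (X1 \<union> X2). (x, t) \<in> R1 \<union> R2)"
      if "x \<in> X1 \<union> X2" "C x" for x
    proof (cases "x \<in> X1")
      case True
      have "(\<exists>t\<in>T \<inter> (X1 \<union> X2). (x, t) \<in> R1 \<union> R2) \<longleftrightarrow> (\<exists>t\<in>T \<inter> X1. (x, t) \<in> R1)"
        using True R1 R2 disj by blast
      then show ?thesis
        using representsD(8)[OF rep1 True that(2)] \<sigma>1[OF True] by simp
    next
      case False
      then have x: "x \<in> X2"
        using that by simp
      have "(\<exists>t\<in>T \<inter> (X1 \<union> X2). (x, t) \<in> R1 \<union> R2) \<longleftrightarrow> (\<exists>t\<in>T \<inter> X2. (x, t) \<in> R2)"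
        using x R1 R2 disj by blast
      then show ?thesis
        using representsD(8)[OF rep2 x that(2)] \<sigma>2(1)[OF x] tv(3) by simp
    qed
    show "t = t'" if "t \<in> T \<inter> (X1 \<union> X2)" "t' \<in> T \<inter> (X1 \<union> X2)" "(t, t') \<in> R1 \<union> R2" for t t'
      using that representsD(9)[OF rep1, of t t'] representsD(9)[OF rep2, of t t'] R1 R2 by auto
  qed
qed

section \<open>Canonical names of classes\<close>

lemma first_eq:
  "a \<in> set (items K) \<Longrightarrow> assoc s a = v \<Longrightarrow> first K s v \<in> set (items K) \<and> assoc s (first K s v) = v"
  by (induction K) auto

lemma items_canon_list:
  "items (canon_list K L s) = map (\<lambda>a. Node a (canon_value L s (assoc s a))) (items K)"
  by (induction K) auto

lemma assoc_map:
  "items s = map (\<lambda>a. Node a (f a)) K \<Longrightarrow> assoc s a = (if a \<in> set K then f a else Leaf)"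
proof (induction K arbitrary: s)
  case Nil
  then show ?case by (cases s) auto
next
  case (Cons b K)
  then show ?case by (cases s) auto
qed

lemma assoc_canon:
  "s \<noteq> Leaf \<Longrightarrow> assoc (canon L s) a =
    (if a \<in> set (items L) then canon_value L s (assoc s a) else Leaf)"
  using assoc_map[OF items_canon_list[of L L s]] by (simp add: canon_def)

text \<open>The first label of a given value determines that value, so the renaming is injective on
  classes; and labels differ from \<open>Leaf\<close>, so a class remains recognisable as
  one.\<close>

lemma represents_canon:
  assumes rep: "represents X l T R C (assoc s)" and "s \<noteq> Leaf"
    and L: "l ` X \<subseteq> set (items L)" "Leaf \<notin> set (items L)"
  shows "represents X l T R C (assoc (canon L s))"
proof -
  define f where "f x = first L s (assoc s (l x))" for x
  have f: "f x \<in> set (items L)" "assoc s (f x) = assoc s (l x)" "f x \<noteq> Leaf" if "x \<in> X" for x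
    using first_eq[of "l x" L s "assoc s (l x)"] that L by (auto simp: f_def)
  have val: "assoc (canon L s) (l x) = canon_value L s (assoc s (l x))" if "x \<in> X" for x
    using assoc_canon[OF \<open>s \<noteq> Leaf\<close>] that L by auto
  have C: "assoc (canon L s) (l x) = Node (f x) (right (assoc s (l x)))" if "x \<in> X" "C x" for x
    using representsD(3,6)[OF rep that(1)] that(2) by (auto simp: val[OF that(1)] canon_value_def f_def)
  have nC: "assoc (canon L s) (l x) = one" if "x \<in> X" "\<not> C x" for x
    using representsD(5)[OF rep that] by (auto simp: val[OF that(1)] canon_value_def)
  show ?thesis
  proof (rule representsI)
    show "a \<in> l ` X" if a: "assoc (canon L s) a \<noteq> Leaf" for a
      using a assoc_canon[OF \<open>s \<noteq> Leaf\<close>, of L a]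
      by (intro representsD(4)[OF rep]) (auto simp: canon_value_def split: if_splits)
    show "left (assoc (canon L s) (l x)) = left (assoc (canon L s) (l y)) \<longleftrightarrow> (x, y) \<in> R"
      if "x \<in> X" "y \<in> X" "C x" "C y" for x y
    proof -
      have "f x = f y \<longleftrightarrow> assoc s (l x) = assoc s (l y)"
        using f(2)[OF that(1)] f(2)[OF that(2)] unfolding f_def by metis
      then show ?thesis
        using represents_value_eq[OF rep that(1,3,2,4)] C that by simp
    qed
    show "equiv X R"
      using rep by (rule representsD(1))
    show "t = t'" if "t \<in> T \<inter> X" "t' \<in> T \<inter> X" "(t, t') \<in> R" for t t'
      using rep that by (rule representsD(9))
    show "assoc (canon L s) (l x) = one" if "x \<in> X" "\<not> C x" for x
      using that by (rule nC)
    show "right (assoc (canon L s) (l x)) \<noteq> Leaf \<longleftrightarrow> (\<exists>t\<in>T \<inter> X. (x, t) \<in> R)"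
      if "x \<in> X" "C x" for x
      using representsD(8)[OF rep that] C[OF that] by simp
    show "assoc (canon L s) (l x) \<noteq> Leaf" if "x \<in> X" for x
      using C[OF that] nC[OF that] by (cases "C x") auto
    show "C x \<longleftrightarrow> left (assoc (canon L s) (l x)) \<noteq> Leaf" if "x \<in> X" for x
      using C[OF that] nC[OF that] f(3)[OF that] by (cases "C x") auto
    show "right (assoc (canon L s) (l x)) \<in> {Leaf, one}" if "x \<in> X" for x
      using C[OF that] nC[OF that] representsD(6)[OF rep that] by (cases "C x") auto
  qed
qed

section \<open>Canonical states and tables\<close>

text \<open>\<open>Leaf\<close> is excluded since it marks values that are not classes. The last
  condition says that no label looks like a tagged label, so tagging really separates the two sides
  of a union.\<close>

definition label_list :: "data \<Rightarrow> bool" where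
  "label_list L \<longleftrightarrow> L \<noteq> Leaf \<and> distinct (items L) \<and> Leaf \<notin> set (items L) \<and>
    (\<forall>a\<in>set (items L). \<forall>b\<in>set (items L). a \<noteq> Node b Leaf)"

text \<open>A class is named by one of its own members: the label \<open>b\<close> itself has the
  value that carries its name. The counting of states rests on this.\<close>

definition wf_value :: "data \<Rightarrow> data \<Rightarrow> data \<Rightarrow> bool" where
  "wf_value L s v \<longleftrightarrow> v = Leaf \<or> v = one \<or>
    (\<exists>b\<in>set (items L). v = assoc s b \<and> (v = Node b Leaf \<or> v = Node b one))"

definition wf_state :: "data \<Rightarrow> data \<Rightarrow> bool" where
  "wf_state L s \<longleftrightarrow> items s = map (\<lambda>a. Node a (assoc s a)) (items L) \<and>
    (\<forall>a\<in>set (items L). wf_value L s (assoc s a))"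

lemma keys_wf_state: "wf_state L s \<Longrightarrow> left ` set (items s) = set (items L)"
  by (simp add: wf_state_def image_image)

lemma wf_state_canon:
  assumes "s \<noteq> Leaf"
  shows "wf_state L (canon L s)"
  unfolding wf_state_def
proof
  show "items (canon L s) = map (\<lambda>a. Node a (assoc (canon L s) a)) (items L)"
    using assms by (simp add: assoc_canon) (simp add: canon_def items_canon_list)
  show "\<forall>a\<in>set (items L). wf_value L (canon L s) (assoc (canon L s) a)"
  proof
    fix a
    assume a: "a \<in> set (items L)"
    define b where "b = first L s (assoc s a)"
    have b: "b \<in> set (items L)" "assoc s b = assoc s a"
      using first_eq[OF a] by (auto simp: b_def)
    then have "assoc (canon L s) b = assoc (canon L s) a"
      using a assms by (simp add: assoc_canon)
    moreover have "assoc (canon L s) a \<in> {Leaf, one, Node b Leaf, Node b one}"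
      using a assms by (auto simp: assoc_canon canon_value_def b_def)
    ultimately show "wf_value L (canon L s) (assoc (canon L s) a)"
      using b(1) unfolding wf_value_def by force
  qed
qed

lemma assoc_blank [simp]: "assoc (blank L) a = Leaf"
  by (induction L) auto

lemma keys_blank [simp]: "map left (items (blank L)) = items L"
  by (induction L) auto

lemma items_eq_assoc:
  assumes "map left (items s) = items L" "distinct (items L)" "Leaf \<notin> set (items L)"
  shows "items s = map (\<lambda>a. Node a (assoc s a)) (items L)"
  using assms
proof (induction s arbitrary: L)
  case Leaf
  then show ?case by simp
next
  case (Node e s)
  then obtain a K where L: "L = Node a K"
    by (cases L) auto
  with Node.prems have a: "left e = a" "a \<noteq> Leaf" "a \<notin> set (items K)"
    by auto
  then have "e = Node a (right e)"
    by (cases e) auto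
  moreover have "items s = map (\<lambda>a. Node a (assoc s a)) (items K)"
    using Node.IH(2)[of K] Node.prems L by auto
  ultimately show ?case
    using a by (auto simp: L)
qed

lemma wf_state_blank: "label_list L \<Longrightarrow> wf_state L (blank L)"
  using items_eq_assoc[of "blank L" L] by (simp add: wf_state_def wf_value_def label_list_def)

lemma wf_state_upd_blank:
  assumes L: "label_list L" and a: "a \<in> set (items L)" and v: "v \<in> {one, Node a Leaf, Node a one}"
  shows "wf_state L (upd (blank L) a v)"
proof -
  have a': "a \<in> left ` set (items (blank L))"
    using a by (metis image_set keys_blank)
  have "assoc (upd (blank L) a v) = (\<lambda>_. Leaf)(a := v)"
    using assoc_upd[OF a', of v] by auto
  then show ?thesis
    using a v L items_eq_assoc[of "upd (blank L) a v" L]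
    by (auto simp: wf_state_def wf_value_def label_list_def)
qed

text \<open>
  The first label of a class is encoded by itself or, if the class contains a terminal, by a special
  symbol, and the other labels of the class by the first one, which leaves \<open>m + 3\<close> symbols.
\<close>

definition code :: "data \<Rightarrow> data \<Rightarrow> nat + data" where
  "code a v = (if v = Leaf then Inl 0 else if v = one then Inl 1 else if v = Node a one then Inl 2
    else Inr (left v))"

lemma code_Inr:
  assumes "wf_value L s v" "code a v = Inr b"
  shows "b \<in> set (items L)" "assoc s b = v" "v = Node b Leaf \<or> v = Node b one"
proof -
  have "v \<noteq> Leaf" "v \<noteq> one" and b: "left v = b"
    using assms(2) by (auto simp: code_def split: if_splits)
  then obtain b' where b': "b' \<in> set (items L)" "v = assoc s b'" "v = Node b' Leaf \<or> v = Node b' one"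
    using assms(1) by (auto simp: wf_value_def)
  have "b' = b"
    using b'(3) b by (metis left.simps(2))
  with b' show "b \<in> set (items L)" "assoc s b = v" "v = Node b Leaf \<or> v = Node b one"
    by simp_all
qed

text \<open>The code \<open>Inr b\<close> of a label reveals the name \<open>b\<close> of its class
  but not the bit. The bit is read off the code of \<open>b\<close>, which belongs to the same
  class: it is \<open>Inl 2\<close> if there is a terminal and \<open>Inr b\<close>
  otherwise.\<close>

lemma code_inject:
  assumes L: "label_list L" and s: "wf_state L s" and s': "wf_state L s'"
    and code: "\<And>a. a \<in> set (items L) \<Longrightarrow> code a (assoc s a) = code a (assoc s' a)"
  shows "s = s'"
proof -
  have ne: "a \<noteq> Leaf" if "a \<in> set (items L)" for a
    using L that by (auto simp: label_list_def)
  have "assoc s a = assoc s' a" if a: "a \<in> set (items L)" for a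
  proof (cases "\<exists>b. code a (assoc s a) = Inr b")
    case False
    then show ?thesis
      using code[OF a] by (auto simp: code_def split: if_splits)
  next
    case True
    then obtain b where b: "code a (assoc s a) = Inr b" "code a (assoc s' a) = Inr b"
      using code[OF a] by auto
    have "wf_value L s (assoc s a)" "wf_value L s' (assoc s' a)"
      using s s' a by (auto simp: wf_state_def)
    note * = code_Inr[OF this(1) b(1)] code_Inr[OF this(2) b(2)]
    show ?thesis
      using code[OF *(1)] * ne[OF *(1)] by (auto simp: code_def)
  qed
  then have "items s = items s'"
    using s s' unfolding wf_state_def by (metis (no_types, lifting) map_cong)
  then show ?thesis
    by simp
qed

lemma card_wf_states:
  assumes L: "label_list L"
  shows "finite {s. wf_state L s}" "card {s. wf_state L s} \<le> (len L + 3) ^ len L"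
proof -
  let ?A = "Inl ` {0, 1, 2} \<union> Inr ` set (items L) :: (nat + data) set"
  let ?f = "\<lambda>s. map (\<lambda>a. code a (assoc s a)) (items L)"
  let ?B = "{xs. set xs \<subseteq> ?A \<and> length xs = len L}"
  have inj: "inj_on ?f {s. wf_state L s}"
    using code_inject[OF L] by (intro inj_onI) auto
  have "code a (assoc s a) \<in> ?A" if s: "wf_state L s" and a: "a \<in> set (items L)" for s a
  proof (cases "\<exists>b. code a (assoc s a) = Inr b")
    case True
    moreover have "wf_value L s (assoc s a)"
      using s a by (simp add: wf_state_def)
    ultimately show ?thesis
      using code_Inr(1) by fastforce
  qed (auto simp: code_def split: if_splits)
  then have "set (?f s) \<subseteq> ?A" if "wf_state L s" for s
    using that unfolding set_map by (intro image_subsetI)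
  then have image: "?f ` {s. wf_state L s} \<subseteq> ?B"
    by (intro image_subsetI CollectI conjI length_map) blast
  have "card ?A = card (Inl ` {0, 1, 2} :: (nat + data) set) + card (Inr ` set (items L) :: (nat + data) set)"
    by (intro card_Un_disjoint) auto
  also have "\<dots> = 3 + len L"
    using L by (simp add: card_image label_list_def distinct_card)
  finally have card: "card ?A = len L + 3"
    by simp
  have fin: "finite ?B"
    by (rule finite_lists_length_eq) simp
  show "finite {s. wf_state L s}"
    using inj_on_finite[OF inj image fin] .
  have "card {s. wf_state L s} \<le> card ?B"
    using card_inj_on_le[OF inj image fin] .
  also have "card ?B = (len L + 3) ^ len L"
    using card_lists_length_eq[of ?A "len L"] card by simp
  finally show "card {s. wf_state L s} \<le> (len L + 3) ^ len L" .
qed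

definition wf_key :: "data \<Rightarrow> nat \<Rightarrow> data \<Rightarrow> bool" where
  "wf_key L n k \<longleftrightarrow> k \<noteq> Leaf \<and> wf_state L (left k) \<and>
    (\<exists>c\<le>n. right k = enc_list (replicate c Leaf))"

lemma wf_keys_subset:
  "{k. wf_key L n k} \<subseteq> (\<lambda>(s, c). Node s (enc_list (replicate c Leaf))) ` ({s. wf_state L s} \<times> {..n})"
proof
  fix k
  assume "k \<in> {k. wf_key L n k}"
  then obtain c where "c \<le> n" "right k = enc_list (replicate c Leaf)" "wf_state L (left k)" "k \<noteq> Leaf"
    by (auto simp: wf_key_def)
  then show "k \<in> (\<lambda>(s, c). Node s (enc_list (replicate c Leaf))) ` ({s. wf_state L s} \<times> {..n})"
    by (intro image_eqI[of _ _ "(left k, c)"]) (cases k; auto)+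
qed

lemma card_wf_keys:
  assumes "label_list L"
  shows "finite {k. wf_key L n k}" "card {k. wf_key L n k} \<le> (len L + 3) ^ len L * (n + 1)"
proof -
  have fin: "finite ({s. wf_state L s} \<times> {..n})"
    using card_wf_states(1)[OF assms] by simp
  then show "finite {k. wf_key L n k}"
    using wf_keys_subset by (rule finite_subset[OF _ finite_imageI, rotated])
  have "card {k. wf_key L n k} \<le> card ({s. wf_state L s} \<times> {..n})"
    using surj_card_le[OF fin wf_keys_subset] .
  also have "\<dots> \<le> (len L + 3) ^ len L * (n + 1)"
    unfolding card_cartesian_product card_atMost Suc_eq_plus1
    using card_wf_states(2)[OF assms] by (rule mult_right_mono) simp
  finally show "card {k. wf_key L n k} \<le> (len L + 3) ^ len L * (n + 1)" .
qed

section \<open>Removal of duplicates and the length of tables\<close>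

lemma mem_Leaf [simp]: "\<not> mem Leaf st"
  by (induction Leaf st rule: mem.induct) auto

text \<open>Preorder readings of stacks of equal height are prefix-free, so different stacks part at
  some node of the trie. The heights matter: a shorter stack could end on the path of a longer one
  and would wrongly count as stored.\<close>

lemma mem_ins: "len st = len st' \<Longrightarrow> mem (ins t st) st' \<longleftrightarrow> st = st' \<or> mem t st'"
proof (induction t st arbitrary: st' rule: ins.induct)
  case (1 t)
  then show ?case by (cases st') auto
next
  case (2 t st)
  then obtain x st2 where st': "st' = Node x st2"
    by (cases st') auto
  with 2 show ?case by (cases x) auto
next
  case (3 t x y st)
  then obtain z st2 where st': "st' = Node z st2"
    by (cases st') auto
  show ?case
  proof (cases z)
    case (Node z1 z2)
    then show ?thesis
      using 3 st' by auto
  qed (use st' in simp)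
qed

text \<open>The two parts need a common induction: a key put in front does not reappear because the
  description of the remaining list excludes everything stored in the trie.\<close>

lemma clean_items:
  "distinct (items (clean X t L))"
  "k \<in> set (items (clean X t L)) \<longleftrightarrow> \<not> mem t (Node k Leaf) \<and> left k \<noteq> Leaf \<and>
    (\<exists>e\<in>set (items X). k = Node (canon L (left e)) (right e))"
proof (induction X t L arbitrary: k rule: clean.induct)
  case (2 e X t L)
  define k0 where "k0 = Node (canon L (left e)) (right e)"
  have clean: "clean (Node e X) t L = (if left k0 = Leaf \<or> mem t (Node k0 Leaf) then clean X t L
      else Node k0 (clean X (ins t (Node k0 Leaf)) L))"
    by (simp add: k0_def Let_def)
  have IH: "distinct (items (clean X t L))"
    "k \<in> set (items (clean X t L)) \<longleftrightarrow> \<not> mem t (Node k Leaf) \<and> left k \<noteq> Leaf \<and>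
      (\<exists>e\<in>set (items X). k = Node (canon L (left e)) (right e))"
    if "left k0 = Leaf \<or> mem t (Node k0 Leaf)" for k
    using "2.IH"(1,2)[of k0] that k0_def by blast+
  have IH': "distinct (items (clean X (ins t (Node k0 Leaf)) L))"
    "k \<in> set (items (clean X (ins t (Node k0 Leaf)) L)) \<longleftrightarrow>
      \<not> mem (ins t (Node k0 Leaf)) (Node k Leaf) \<and> left k \<noteq> Leaf \<and>
      (\<exists>e\<in>set (items X). k = Node (canon L (left e)) (right e))"
    if "\<not> (left k0 = Leaf \<or> mem t (Node k0 Leaf))" for k
    using "2.IH"(3,4)[of k0] that k0_def by blast+
  have mem: "mem (ins t (Node k0 Leaf)) (Node k Leaf) \<longleftrightarrow> k0 = k \<or> mem t (Node k Leaf)" for k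
    by (subst mem_ins) auto
  have ex: "(\<exists>e'\<in>set (items (Node e X)). k = Node (canon L (left e')) (right e')) \<longleftrightarrow>
      k = k0 \<or> (\<exists>e\<in>set (items X). k = Node (canon L (left e)) (right e))" for k
    by (simp add: k0_def)
  {
    case 1
    show ?case
    proof (cases "left k0 = Leaf \<or> mem t (Node k0 Leaf)")
      case True
      then have "clean (Node e X) t L = clean X t L"
        using clean by presburger
      then show ?thesis
        using IH(1)[OF True] by presburger
    next
      case False
      then have *: "clean (Node e X) t L = Node k0 (clean X (ins t (Node k0 Leaf)) L)"
        using clean by presburger
      have "k0 \<notin> set (items (clean X (ins t (Node k0 Leaf)) L))"
        using IH'(2)[OF False, of k0] mem[of k0] by blast
      then show ?thesis
        unfolding * using IH'(1)[OF False] by simp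
    qed
  next
    case 2
    show ?case
    proof (cases "left k0 = Leaf \<or> mem t (Node k0 Leaf)")
      case True
      then have *: "clean (Node e X) t L = clean X t L"
        using clean by presburger
      show ?thesis
        unfolding * ex IH(2)[OF True] using True by blast
    next
      case False
      then have *: "clean (Node e X) t L = Node k0 (clean X (ins t (Node k0 Leaf)) L)"
        using clean by presburger
      have "k \<in> set (items (clean (Node e X) t L)) \<longleftrightarrow>
          k = k0 \<or> k \<in> set (items (clean X (ins t (Node k0 Leaf)) L))"
        unfolding * by simp
      then show ?thesis
        unfolding ex IH'(2)[OF False] mem using False by blast
    qed
  }
qed auto

lemma items_relab_table:
  "items (relab_table X a b) = map (\<lambda>e. Node (relab (left e) a b) (right e)) (items X)"
  by (induction X) auto

lemma items_join_table:
  "items (join_table X a b) = map (\<lambda>e. Node (join (left e) a b) (right e)) (items X)"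
  by (induction X) auto

lemma set_forget_table:
  "set (items (forget_table X a)) =
    set (items X) \<union> (\<lambda>e. Node (forget (left e) a) (right e)) ` set (items X)"
  by (induction X) auto

lemma len_forget_table: "len (forget_table X a) = 2 * len X"
  by (induction X) auto

lemma items_union_row:
  "items (union_row k Y L Z) =
    map (\<lambda>e. Node (fuse L (app (left k) (tag (left e)))) (app (right k) (right e))) (items Y) @ items Z"
  by (induction Y) auto

lemma items_union_table:
  "items (union_table X Y L) =
    concat (map (\<lambda>k. map (\<lambda>e. Node (fuse L (app (left k) (tag (left e)))) (app (right k) (right e)))
      (items Y)) (items X))"
  by (induction X) (auto simp: items_union_row)

lemma len_union_table: "len (union_table X Y L) = len X * len Y"
  by (induction X) (auto simp: items_union_row)

lemma app_enc_list [simp]: "app (enc_list xs) (enc_list ys) = enc_list (xs @ ys)"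
  by (induction xs) auto

lemma wf_key_clean:
  assumes "k \<in> set (items (clean X Leaf L))"
    and "\<And>e. e \<in> set (items X) \<Longrightarrow> \<exists>c\<le>n. right e = enc_list (replicate c Leaf)"
  shows "wf_key L n k"
proof -
  obtain e where e: "e \<in> set (items X)" "k = Node (canon L (left e)) (right e)" "left k \<noteq> Leaf"
    using assms(1) by (auto simp: clean_items)
  then have "left e \<noteq> Leaf"
    by (auto simp: canon_def)
  then show ?thesis
    using e assms(2)[OF e(1)] by (simp add: wf_key_def wf_state_canon)
qed

primrec wlabels :: "'a wexp \<Rightarrow> nat set" where
  "wlabels (Vertex i v) = {i}"
| "wlabels (DUnion \<phi> \<psi>) = wlabels \<phi> \<union> wlabels \<psi>"
| "wlabels (Relabel i j \<phi>) = {i, j} \<union> wlabels \<phi>"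
| "wlabels (Join i j \<phi>) = {i, j} \<union> wlabels \<phi>"

lemma finite_wverts [simp]: "finite (wverts \<phi>)"
  by (induction \<phi>) auto

text \<open>This reduces the length of a table to the number of possible keys. Every operation on
  tables ends in \<open>clean\<close>, which yields canonical states without duplicates, so only the
  tables of single vertices need a direct check; the counters add up because the two sides of a
  union are disjoint.\<close>

lemma wf_key_table:
  assumes "label_list L" "w_expression w \<phi>" "enc_nat ` wlabels \<phi> \<subseteq> set (items L)"
  shows "distinct (items (table L T \<phi>))"
    "k \<in> set (items (table L T \<phi>)) \<Longrightarrow> wf_key L (card (wverts \<phi>)) k"
proof -
  have "distinct (items (table L T \<phi>)) \<and>
    (\<forall>k\<in>set (items (table L T \<phi>)). wf_key L (card (wverts \<phi>)) k)"
    using assms(2,3)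
  proof (induction \<phi>)
    case (Vertex i v)
    let ?a = "enc_nat i"
    have a: "?a \<in> set (items L)" and a0: "?a \<noteq> Leaf"
      using Vertex assms(1) by (auto simp: label_list_def)
    have a': "?a \<in> left ` set (items (blank L))"
      using a by (metis image_set keys_blank)
    have "upd (blank L) ?a one \<noteq> upd (blank L) ?a v" if "v \<noteq> one" for v
      using that assoc_upd_same[OF a'] by metis
    moreover have "blank L \<noteq> upd (blank L) ?a v" if "v \<noteq> Leaf" for v
      using that assoc_upd_same[OF a', of v] by (metis assoc_blank)
    ultimately have "distinct (items (table L T (Vertex i v)))"
      using a0 by (auto simp: leaf_table_def)
    moreover have "wf_key L 1 k" if mem: "k \<in> set (items (table L T (Vertex i v)))" for k
    proof -
      have zero: "\<exists>c\<le>1. Leaf = enc_list (replicate c Leaf)"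
        by (rule exI[of _ 0]) simp
      have one: "\<exists>c\<le>1. one = enc_list (replicate c Leaf)"
        by (rule exI[of _ 1]) simp
      obtain s c where k: "k = Node s c" "c = Leaf \<or> c = one"
        "s = blank L \<or> s = upd (blank L) ?a one \<or> s = upd (blank L) ?a (Node ?a Leaf) \<or>
          s = upd (blank L) ?a (Node ?a one)"
        using mem by (auto simp: leaf_table_def enc_bool_if split: if_splits)
      have "wf_state L s"
        using k(3) wf_state_blank[OF assms(1)] wf_state_upd_blank[OF assms(1) a] by blast
      then show ?thesis
        using k(1,2) zero one unfolding wf_key_def by auto
    qed
    ultimately show ?case
      by simp
  next
    case (DUnion \<phi> \<psi>)
    have card: "card (wverts (DUnion \<phi> \<psi>)) = card (wverts \<phi>) + card (wverts \<psi>)"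
      using DUnion.prems by (simp add: card_Un_disjoint)
    have "\<exists>c\<le>card (wverts (DUnion \<phi> \<psi>)). right e = enc_list (replicate c Leaf)"
      if e: "e \<in> set (items (union_table (table L T \<phi>) (table L T \<psi>) L))" for e
    proof -
      obtain k k' where k: "k \<in> set (items (table L T \<phi>))" "k' \<in> set (items (table L T \<psi>))"
        "right e = app (right k) (right k')"
        using e by (auto simp: items_union_table)
      then obtain c c' where "c \<le> card (wverts \<phi>)" "c' \<le> card (wverts \<psi>)"
        "right k = enc_list (replicate c Leaf)" "right k' = enc_list (replicate c' Leaf)"
        using DUnion by (fastforce simp: wf_key_def)
      with k(3) card show ?thesis
        by (intro exI[of _ "c + c'"]) (simp add: replicate_add)
    qed
    then show ?case
      by (simp add: clean_items(1) wf_key_clean)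
  next
    case (Relabel i j \<phi>)
    then have "\<exists>c\<le>card (wverts \<phi>). right e = enc_list (replicate c Leaf)"
      if "e \<in> set (items (relab_table (table L T \<phi>) (enc_nat i) (enc_nat j)))" for e
      using that by (auto simp: items_relab_table wf_key_def)
    then show ?case
      by (simp add: clean_items(1) wf_key_clean)
  next
    case (Join i j \<phi>)
    then have "\<exists>c\<le>card (wverts \<phi>). right e = enc_list (replicate c Leaf)"
      if "e \<in> set (items (forget_table (forget_table (join_table (table L T \<phi>) (enc_nat i) (enc_nat j))
        (enc_nat i)) (enc_nat j)))" for e
      using that by (auto simp: set_forget_table items_join_table wf_key_def)
    then show ?case
      by (simp add: clean_items(1) wf_key_clean)
  qed
  then show "distinct (items (table L T \<phi>))"
    "k \<in> set (items (table L T \<phi>)) \<Longrightarrow> wf_key L (card (wverts \<phi>)) k"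
    by auto
qed

lemma len_table_le:
  assumes "label_list L" "w_expression w \<phi>" "enc_nat ` wlabels \<phi> \<subseteq> set (items L)"
  shows "len (table L T \<phi>) \<le> (len L + 3) ^ len L * (card (wverts \<phi>) + 1)"
proof -
  have "len (table L T \<phi>) = card (set (items (table L T \<phi>)))"
    using wf_key_table(1)[OF assms] by (simp add: distinct_card)
  also have "\<dots> \<le> card {k. wf_key L (card (wverts \<phi>)) k}"
    using wf_key_table(2)[OF assms] card_wf_keys(1)[OF assms(1)] by (intro card_mono) auto
  also have "\<dots> \<le> (len L + 3) ^ len L * (card (wverts \<phi>) + 1)"
    by (rule card_wf_keys(2)[OF assms(1)])
  finally show ?thesis .
qed

section \<open>Soundness and completeness of the tables\<close>

lemma wf_state_neq_Leaf: "label_list L \<Longrightarrow> wf_state L s \<Longrightarrow> s \<noteq> Leaf"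
  by (cases L) (auto simp: wf_state_def label_list_def)

lemma wf_state_left:
  assumes "wf_state L s" "left (assoc s a) \<noteq> Leaf"
  shows "left (assoc s a) \<in> set (items L)"
proof -
  have "a \<in> set (items L)"
    using assms assoc_notin[of a s] keys_wf_state[OF assms(1)] by auto
  then have "wf_value L s (assoc s a)"
    using assms(1) by (simp add: wf_state_def)
  then show ?thesis
    using assms(2) unfolding wf_value_def by (metis left.simps)
qed

lemma represents_label:
  "wf_state L s \<Longrightarrow> represents X l T R C (assoc s) \<Longrightarrow> x \<in> X \<Longrightarrow> l x \<in> set (items L)"
  using assoc_keys[of s "l x"] representsD(2)[of X l T R C "assoc s" x] keys_wf_state[of L s] by simp

text \<open>In well-formed states labels and class names all come from \<open>L\<close>, which
  contains no tagged label. This discharges both separation conditions at once.\<close>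

lemma represents_union_aux:
  assumes L: "label_list L" and wf: "wf_state L s1" "wf_state L s2"
    and rep1: "represents X1 l1 T R1 C (assoc s1)" and rep2: "represents X2 l2 T R2 C (assoc s2)"
    and disj: "X1 \<inter> X2 = {}"
  shows "represents (X1 \<union> X2) (\<lambda>x. if x \<in> X1 then l1 x else Node (l2 x) Leaf) T (R1 \<union> R2) C
      (assoc (app s1 (tag s2)))"
    "\<forall>a\<in>set (items L). {Node a Leaf, a} \<subseteq> left ` set (items (app s1 (tag s2)))"
    "x \<in> X1 \<union> X2 \<Longrightarrow> untag L (if x \<in> X1 then l1 x else Node (l2 x) Leaf) = (if x \<in> X1 then l1 x else l2 x)"
proof -
  have sep: "a \<noteq> Node b Leaf" if "a \<in> set (items L)" "b \<in> set (items L)" for a b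
    using L that by (simp add: label_list_def)
  show "represents (X1 \<union> X2) (\<lambda>x. if x \<in> X1 then l1 x else Node (l2 x) Leaf) T (R1 \<union> R2) C
      (assoc (app s1 (tag s2)))"
  proof (rule represents_app_tag[OF rep1 rep2 disj])
    show "a \<noteq> Node b Leaf" if "a \<in> left ` set (items s1)" "b \<in> left ` set (items s2)" for a b
      using that unfolding keys_wf_state[OF wf(1)] keys_wf_state[OF wf(2)] by (rule sep)
    show "left (assoc s1 (l1 x)) \<noteq> Node (left (assoc s2 (l2 y))) Leaf"
      if "x \<in> X1" "y \<in> X2" "C x" "C y" for x y
      using that representsD(3)[OF rep1] representsD(3)[OF rep2] wf
      by (intro sep wf_state_left) auto
  qed
  show "\<forall>a\<in>set (items L). {Node a Leaf, a} \<subseteq> left ` set (items (app s1 (tag s2)))"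
    unfolding keys_app keys_tag keys_wf_state[OF wf(1)] keys_wf_state[OF wf(2)] by auto
  show "untag L (if x \<in> X1 then l1 x else Node (l2 x) Leaf) = (if x \<in> X1 then l1 x else l2 x)"
    if "x \<in> X1 \<union> X2"
    using that represents_label[OF wf(1) rep1] represents_label[OF wf(2) rep2] sep
    by (auto simp: untag_def)
qed

lemma represents_union:
  assumes L: "label_list L" and wf: "wf_state L s1" "wf_state L s2"
    and rep: "represents X1 l1 T R1 C (assoc s1)" "represents X2 l2 T R2 C (assoc s2)"
    and disj: "X1 \<inter> X2 = {}" and ne: "fuse L (app s1 (tag s2)) \<noteq> Leaf"
    and l: "\<And>x. x \<in> X1 \<union> X2 \<Longrightarrow> l x = (if x \<in> X1 then l1 x else l2 x)"
  shows "\<exists>R'. R1 \<union> R2 \<subseteq> R' \<and>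
    represents (X1 \<union> X2) l T R' C (assoc (canon L (fuse L (app s1 (tag s2))))) \<and>
    (\<forall>Q. sym Q \<longrightarrow> trans Q \<longrightarrow> R1 \<union> R2 \<subseteq> Q \<longrightarrow>
      (\<forall>x\<in>X1 \<union> X2. \<forall>y\<in>X1 \<union> X2. l x = l y \<longrightarrow> C x \<longrightarrow> (x, y) \<in> Q) \<longrightarrow> R' \<subseteq> Q)"
proof -
  let ?X = "X1 \<union> X2" and ?u = "fuse L (app s1 (tag s2))"
  let ?l = "\<lambda>x. if x \<in> X1 then l1 x else Node (l2 x) Leaf"
  note aux = represents_union_aux[OF L wf rep disj]
  have sep: "\<forall>a\<in>set (items L). \<forall>b\<in>set (items L). a \<noteq> Node b Leaf"
    using L by (simp add: label_list_def)
  have untag: "untag L (?l x) = l x" if "x \<in> ?X" for x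
    using aux(3)[OF that] l[OF that] by simp
  obtain R' where R': "R1 \<union> R2 \<subseteq> R'" "represents ?X (\<lambda>x. untag L (?l x)) T R' C (assoc ?u)"
    and least: "\<forall>Q. sym Q \<longrightarrow> trans Q \<longrightarrow> R1 \<union> R2 \<subseteq> Q \<longrightarrow>
      (\<forall>x\<in>?X. \<forall>y\<in>?X. untag L (?l x) = untag L (?l y) \<longrightarrow> C x \<longrightarrow> (x, y) \<in> Q) \<longrightarrow> R' \<subseteq> Q"
    using represents_fuse[OF aux(1) ne aux(2) sep] by blast
  have "represents ?X l T R' C (assoc ?u)"
  proof (rule represents_cong[OF R'(2)])
    show "assoc ?u (l x) = assoc ?u (untag L (?l x))" if "x \<in> ?X" for x
      using untag[OF that] by simp
    have "(\<lambda>x. untag L (?l x)) ` ?X = l ` ?X"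
      using untag by (rule image_cong[OF refl])
    then show "a \<in> l ` ?X" if "assoc ?u a \<noteq> Leaf" for a
      using representsD(4)[OF R'(2) that] by simp
  qed
  moreover have "l ` ?X \<subseteq> set (items L)"
    using l represents_label[OF wf(1) rep(1)] represents_label[OF wf(2) rep(2)] by auto
  moreover have "Leaf \<notin> set (items L)"
    using L by (simp add: label_list_def)
  ultimately have "represents ?X l T R' C (assoc (canon L ?u))"
    using ne by (intro represents_canon)
  moreover have "R' \<subseteq> Q" if "sym Q" "trans Q" "R1 \<union> R2 \<subseteq> Q"
    "\<forall>x\<in>?X. \<forall>y\<in>?X. l x = l y \<longrightarrow> C x \<longrightarrow> (x, y) \<in> Q" for Q
  proof -
    have "\<forall>x\<in>?X. \<forall>y\<in>?X. untag L (?l x) = untag L (?l y) \<longrightarrow> C x \<longrightarrow> (x, y) \<in> Q"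
      using that(4) untag by metis
    then show ?thesis
      using least that(1-3) by blast
  qed
  ultimately show ?thesis
    using R'(1) by blast
qed

lemma union_neq_Leaf:
  assumes L: "label_list L" and wf: "wf_state L s1" "wf_state L s2"
    and rep: "represents X1 l1 T R1 C (assoc s1)" "represents X2 l2 T R2 C (assoc s2)"
    and disj: "X1 \<inter> X2 = {}"
    and l: "\<And>x. x \<in> X1 \<union> X2 \<Longrightarrow> l x = (if x \<in> X1 then l1 x else l2 x)"
    and Q: "sym Q" "trans Q" "R1 \<union> R2 \<subseteq> Q"
    and T: "\<And>t t'. t \<in> T \<inter> (X1 \<union> X2) \<Longrightarrow> t' \<in> T \<inter> (X1 \<union> X2) \<Longrightarrow> (t, t') \<in> Q \<Longrightarrow> t = t'"
    and C: "\<forall>x\<in>X1 \<union> X2. \<forall>y\<in>X1 \<union> X2. l x = l y \<longrightarrow> C x = C y \<and> (C x \<longrightarrow> (x, y) \<in> Q)"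
  shows "fuse L (app s1 (tag s2)) \<noteq> Leaf"
proof -
  let ?X = "X1 \<union> X2"
  let ?l = "\<lambda>x. if x \<in> X1 then l1 x else Node (l2 x) Leaf"
  note aux = represents_union_aux[OF L wf rep disj]
  have untag: "untag L (?l x) = l x" if "x \<in> ?X" for x
    using aux(3)[OF that] l[OF that] by simp
  have "app s1 (tag s2) \<noteq> Leaf"
    using wf_state_neq_Leaf[OF L wf(1)] by (cases s1) auto
  moreover have "\<forall>a\<in>set (items L). \<forall>b\<in>set (items L). a \<noteq> Node b Leaf"
    using L by (simp add: label_list_def)
  moreover have "\<forall>x\<in>?X. \<forall>y\<in>?X. untag L (?l x) = untag L (?l y) \<longrightarrow>
      C x = C y \<and> (C x \<longrightarrow> (x, y) \<in> Q)"
    using C untag by metis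
  ultimately show ?thesis
    using fuse_neq_Leaf[OF aux(1) _ Q(3) aux(2) _ _ Q(1,2) T] by blast
qed

section \<open>Encoded labels are distinct and never look tagged\<close>

lemma enc_bool_inject [simp]: "enc_bool a = enc_bool b \<longleftrightarrow> a = b"
  by (cases a; cases b) auto

lemma enc_nat_0 [simp]: "enc_nat 0 = Leaf"
  by (simp add: enc_nat.simps)

lemma enc_nat_pos: "0 < n \<Longrightarrow> enc_nat n = Node (enc_bool (odd n)) (enc_nat (n div 2))"
  by (subst enc_nat.simps) simp

lemma enc_nat_eq_Leaf [simp]: "enc_nat n = Leaf \<longleftrightarrow> n = 0"
  by (cases "n = 0") (auto simp: enc_nat_pos)

lemma enc_nat_inject [simp]: "enc_nat m = enc_nat n \<longleftrightarrow> m = n"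
proof (induction m arbitrary: n rule: less_induct)
  case (less m)
  show ?case
  proof (cases "m = 0 \<or> n = 0")
    case True
    then show ?thesis
      by (metis enc_nat_eq_Leaf)
  next
    case False
    then have "enc_nat m = enc_nat n \<longleftrightarrow> odd m = odd n \<and> m div 2 = n div 2"
      using less.IH[of "m div 2" "n div 2"] by (simp add: enc_nat_pos)
    then show ?thesis
      by (metis odd_two_times_div_two_succ even_two_times_div_two)
  qed
qed

text \<open>The first component of an encoded number is a bit, \<open>Leaf\<close> or
  \<open>one\<close>. The encoding of a positive number is neither, because \<open>one\<close> would
  be a number whose only digit is 0.\<close>

lemma enc_nat_neq_tagged: "0 < m \<Longrightarrow> 0 < n \<Longrightarrow> enc_nat m \<noteq> Node (enc_nat n) Leaf"
proof
  assume "0 < m" "0 < n" "enc_nat m = Node (enc_nat n) Leaf"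
  then have "enc_bool (odd m) = Node (enc_bool (odd n)) (enc_nat (n div 2))"
    by (simp add: enc_nat_pos)
  then show False
    using \<open>0 < n\<close> enc_nat_eq_Leaf[of "n div 2"]
    by (cases "odd m"; cases "odd n") (auto elim: evenE)
qed

lemma wlabel_mem: "x \<in> wverts \<phi> \<Longrightarrow> wlabel \<phi> x \<in> wlabels \<phi>"
  by (induction \<phi>) auto

lemma enc_wlabel_mem: "enc_nat ` wlabels \<phi> \<subseteq> A \<Longrightarrow> x \<in> wverts \<phi> \<Longrightarrow> enc_nat (wlabel \<phi> x) \<in> A"
  using wlabel_mem[of x \<phi>] by auto

lemma card_union_parts:
  assumes "finite V1" "finite V2" "V1 \<inter> V2 = {}" "S1 \<subseteq> V1" "S2 \<subseteq> V2"
  shows "card (S1 \<union> S2) = card S1 + card S2"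
  using assms by (intro card_Un_disjoint) (auto intro: finite_subset)

lemma warcs_subset: "warcs \<phi> \<subseteq> wverts \<phi> \<times> wverts \<phi>"
  by (induction \<phi>) auto

lemma canon_Leaf [simp]: "canon L Leaf = Leaf"
  by (simp add: canon_def)

lemma canon_eq_Leaf: "label_list L \<Longrightarrow> canon L s = Leaf \<longleftrightarrow> s = Leaf"
  using wf_state_neq_Leaf wf_state_canon by (metis canon_Leaf)

lemma forget_Leaf [simp]: "forget Leaf a = Leaf"
  by (simp add: forget_def)

lemma forget_eq_Leaf [simp]: "forget s a = Leaf \<longleftrightarrow> s = Leaf"
  by (simp add: forget_def)

text \<open>Nothing is demanded of \<open>C\<close>: an entry whose guesses about later edges never
  come true still has a relation that contains all remaining edges and separates the terminals. So
  every entry of the final table may be accepted.\<close>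

lemma table_sound:
  assumes L: "label_list L" and T: "\<And>v. v \<in> T \<longleftrightarrow> enc_nat v \<in> set (items Ts)"
    and "w_expression w \<phi>" "enc_nat ` wlabels \<phi> \<subseteq> set (items L)" "k \<in> set (items (table L Ts \<phi>))"
  shows "\<exists>S R C. S \<subseteq> wverts \<phi> - T \<and> len (right k) = card S \<and>
    represents (wverts \<phi> - S) (\<lambda>x. enc_nat (wlabel \<phi> x)) T R C (assoc (left k)) \<and>
    (\<forall>x y. (x, y) \<in> warcs \<phi> \<longrightarrow> x \<notin> S \<longrightarrow> y \<notin> S \<longrightarrow> (x, y) \<in> R)"
  using assms(3-5)
proof (induction \<phi> arbitrary: k)
  case (Vertex i v)
  let ?a = "enc_nat i" and ?l = "\<lambda>x. enc_nat (wlabel (Vertex i v) x)"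
  have a: "?a \<in> set (items L)" "?a \<noteq> Leaf"
    using Vertex L by (auto simp: label_list_def)
  then have "?a \<in> left ` set (items (blank L))"
    by (metis image_set keys_blank)
  then have upd: "assoc (upd (blank L) ?a u) = (\<lambda>_. Leaf)(?a := u)" for u
    using assoc_upd[of ?a "blank L" u] by auto
  consider "k = Node (upd (blank L) ?a one) Leaf"
    | "k = Node (upd (blank L) ?a (Node ?a (enc_bool (v \<in> T)))) Leaf"
    | "k = Node (blank L) one" "v \<notin> T"
    using Vertex.prems(3) T by (auto simp: leaf_table_def split: if_splits)
  then show ?case
  proof cases
    case 1
    have "represents {v} ?l T {(v, v)} (\<lambda>_. False) ((\<lambda>_. Leaf)(?a := one))"
      by (rule representsI) (auto simp: equiv_def refl_on_def sym_def trans_def split: if_splits)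
    then show ?thesis
      by (intro exI[of _ "{} :: nat set"] exI[of _ "{(v, v)}"] exI[of _ "\<lambda>_. False"]) (use 1 upd in \<open>simp add: fun_upd_def\<close>)
  next
    case 2
    have "represents {v} ?l T {(v, v)} (\<lambda>_. True) ((\<lambda>_. Leaf)(?a := Node ?a (enc_bool (v \<in> T))))"
      by (rule representsI)
        (use a in \<open>auto simp: equiv_def refl_on_def sym_def trans_def enc_bool_if split: if_splits\<close>)
    then show ?thesis
      by (intro exI[of _ "{} :: nat set"] exI[of _ "{(v, v)}"] exI[of _ "\<lambda>_. True"]) (use 2 upd in \<open>simp add: fun_upd_def\<close>)
  next
    case 3
    have "represents {} ?l T {} (\<lambda>_. True) (\<lambda>_. Leaf)"
      by (rule representsI) (auto simp: equiv_def refl_on_def sym_def trans_def)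
    then show ?thesis
      by (intro exI[of _ "{v}"] exI[of _ "{} :: (nat \<times> nat) set"] exI[of _ "\<lambda>_. True"]) (use 3 in simp)
  qed
next
  case (DUnion \<phi> \<psi>)
  then obtain e where e: "e \<in> set (items (union_table (table L Ts \<phi>) (table L Ts \<psi>) L))"
    "k = Node (canon L (left e)) (right e)" "left k \<noteq> Leaf"
    by (auto simp: clean_items)
  then obtain k1 k2 where k: "k1 \<in> set (items (table L Ts \<phi>))" "k2 \<in> set (items (table L Ts \<psi>))"
    "left e = fuse L (app (left k1) (tag (left k2)))" "right e = app (right k1) (right k2)"
    by (auto simp: items_union_table)
  have pre: "w_expression w \<phi>" "enc_nat ` wlabels \<phi> \<subseteq> set (items L)"
    "w_expression w \<psi>" "enc_nat ` wlabels \<psi> \<subseteq> set (items L)"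
    using DUnion.prems(1,2) by (simp_all add: image_Un)
  have wf: "wf_state L (left k1)" "wf_state L (left k2)"
    using wf_key_table(2)[OF L pre(1,2) k(1)] wf_key_table(2)[OF L pre(3,4) k(2)]
    by (simp_all add: wf_key_def)
  have ne: "fuse L (app (left k1) (tag (left k2))) \<noteq> Leaf"
    using e k(3) by (metis canon_Leaf left.simps(2))
  obtain S1 R1 C1 where 1: "S1 \<subseteq> wverts \<phi> - T" "len (right k1) = card S1"
    "represents (wverts \<phi> - S1) (\<lambda>x. enc_nat (wlabel \<phi> x)) T R1 C1 (assoc (left k1))"
    "\<forall>x y. (x, y) \<in> warcs \<phi> \<longrightarrow> x \<notin> S1 \<longrightarrow> y \<notin> S1 \<longrightarrow> (x, y) \<in> R1"
    using DUnion.IH(1)[OF pre(1,2) k(1)] by blast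
  obtain S2 R2 C2 where 2: "S2 \<subseteq> wverts \<psi> - T" "len (right k2) = card S2"
    "represents (wverts \<psi> - S2) (\<lambda>x. enc_nat (wlabel \<psi> x)) T R2 C2 (assoc (left k2))"
    "\<forall>x y. (x, y) \<in> warcs \<psi> \<longrightarrow> x \<notin> S2 \<longrightarrow> y \<notin> S2 \<longrightarrow> (x, y) \<in> R2"
    using DUnion.IH(2)[OF pre(3,4) k(2)] by blast
  have disj: "wverts \<phi> \<inter> wverts \<psi> = {}"
    using DUnion.prems by simp
  \<comment> \<open>The guesses of the two sides concern disjoint sets of vertices, so one predicate
    can express both.\<close>
  define C where "C x = (if x \<in> wverts \<phi> then C1 x else C2 x)" for x
  have rep1: "represents (wverts \<phi> - S1) (\<lambda>x. enc_nat (wlabel \<phi> x)) T R1 C (assoc (left k1))"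
    using 1(3) represents_commit_cong[of "wverts \<phi> - S1" C1 C] by (simp add: C_def)
  have rep2: "represents (wverts \<psi> - S2) (\<lambda>x. enc_nat (wlabel \<psi> x)) T R2 C (assoc (left k2))"
  proof -
    have "C2 x = C x" if "x \<in> wverts \<psi> - S2" for x
      using disj that by (auto simp: C_def)
    then show ?thesis
      using 2(3) represents_commit_cong[of "wverts \<psi> - S2" C2 C] by blast
  qed
  have X: "wverts (DUnion \<phi> \<psi>) - (S1 \<union> S2) = (wverts \<phi> - S1) \<union> (wverts \<psi> - S2)"
    using 1(1) 2(1) disj by auto
  have lab: "enc_nat (wlabel (DUnion \<phi> \<psi>) x) =
      (if x \<in> wverts \<phi> - S1 then enc_nat (wlabel \<phi> x) else enc_nat (wlabel \<psi> x))"
    if "x \<in> (wverts \<phi> - S1) \<union> (wverts \<psi> - S2)" for x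
    using that disj by auto
  have disj': "(wverts \<phi> - S1) \<inter> (wverts \<psi> - S2) = {}"
    using disj by blast
  have left: "left k = canon L (fuse L (app (left k1) (tag (left k2))))"
    using e(2) k(3) by simp
  obtain R' where R': "R1 \<union> R2 \<subseteq> R'" "represents ((wverts \<phi> - S1) \<union> (wverts \<psi> - S2))
      (\<lambda>x. enc_nat (wlabel (DUnion \<phi> \<psi>) x)) T R' C (assoc (left k))"
    using represents_union[OF L wf rep1 rep2 disj' ne lab] left by metis
  have "card (S1 \<union> S2) = card S1 + card S2"
    using card_union_parts[OF finite_wverts finite_wverts disj, of S1 S2] 1(1) 2(1) by auto
  then have "len (right k) = card (S1 \<union> S2)"
    using 1(2) 2(2) e(2) k(4) by simp
  moreover have "S1 \<union> S2 \<subseteq> wverts (DUnion \<phi> \<psi>) - T"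
    using 1(1) 2(1) by auto
  moreover have "\<forall>x y. (x, y) \<in> warcs (DUnion \<phi> \<psi>) \<longrightarrow> x \<notin> S1 \<union> S2 \<longrightarrow> y \<notin> S1 \<union> S2 \<longrightarrow> (x, y) \<in> R'"
    using 1(4) 2(4) R'(1) by auto
  ultimately show ?case
    using R'(2) unfolding X[symmetric] by blast
next
  case (Relabel i j \<phi>)
  then obtain e where e: "e \<in> set (items (table L Ts \<phi>))" "left k \<noteq> Leaf"
    "k = Node (canon L (relab (left e) (enc_nat i) (enc_nat j))) (right e)"
    by (auto simp: clean_items items_relab_table)
  have pre: "w_expression w \<phi>" "enc_nat ` wlabels \<phi> \<subseteq> set (items L)"
    using Relabel.prems(1,2) by simp_all
  have wf: "wf_state L (left e)"
    using wf_key_table(2)[OF L pre e(1)] by (simp add: wf_key_def)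
  have ne: "relab (left e) (enc_nat i) (enc_nat j) \<noteq> Leaf"
    using e by (metis canon_Leaf left.simps(2))
  obtain S R C where 1: "S \<subseteq> wverts \<phi> - T" "len (right e) = card S"
    "represents (wverts \<phi> - S) (\<lambda>x. enc_nat (wlabel \<phi> x)) T R C (assoc (left e))"
    "\<forall>x y. (x, y) \<in> warcs \<phi> \<longrightarrow> x \<notin> S \<longrightarrow> y \<notin> S \<longrightarrow> (x, y) \<in> R"
    using Relabel.IH[OF pre e(1)] by blast
  have ab: "{enc_nat i, enc_nat j} \<subseteq> left ` set (items (left e))"
    using Relabel.prems(2) unfolding keys_wf_state[OF wf] by auto
  obtain R' where R': "R \<subseteq> R'" "represents (wverts \<phi> - S)
      (\<lambda>x. if enc_nat (wlabel \<phi> x) = enc_nat i then enc_nat j else enc_nat (wlabel \<phi> x)) T R' C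
      (assoc (relab (left e) (enc_nat i) (enc_nat j)))"
    using represents_relab[OF 1(3) ab ne] by (elim exE conjE) (rule that)
  have l: "(\<lambda>x. if enc_nat (wlabel \<phi> x) = enc_nat i then enc_nat j else enc_nat (wlabel \<phi> x)) =
      (\<lambda>x. enc_nat (wlabel (Relabel i j \<phi>) x))"
    by auto
  have "(\<lambda>x. enc_nat (wlabel (Relabel i j \<phi>) x)) ` (wverts \<phi> - S) \<subseteq> set (items L)"
    by (intro image_subsetI enc_wlabel_mem[OF Relabel.prems(2)]) simp
  then have "represents (wverts \<phi> - S) (\<lambda>x. enc_nat (wlabel (Relabel i j \<phi>) x)) T R' C (assoc (left k))"
    using represents_canon[OF R'(2)[unfolded l] ne] L e(3) by (simp add: label_list_def)
  then show ?case
    using 1 R'(1) e(3) by (intro exI[of _ S] exI[of _ R'] exI[of _ C]) auto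
next
  case (Join i j \<phi>)
  let ?a = "enc_nat i" and ?b = "enc_nat j" and ?l = "\<lambda>x. enc_nat (wlabel \<phi> x)"
  obtain e where e: "left k \<noteq> Leaf" "k = Node (canon L (left e)) (right e)" "e \<in> set (items
      (forget_table (forget_table (join_table (table L Ts \<phi>) ?a ?b) ?a) ?b))"
    using Join.prems(3) by (auto simp: clean_items)
  then obtain e0 where e0: "e0 \<in> set (items (table L Ts \<phi>))" "right e = right e0"
    "left e \<in> {join (left e0) ?a ?b, forget (join (left e0) ?a ?b) ?a,
      forget (join (left e0) ?a ?b) ?b, forget (forget (join (left e0) ?a ?b) ?a) ?b}"
    by (auto simp: set_forget_table items_join_table)
  have ne': "left e \<noteq> Leaf"
    using e by (metis canon_Leaf left.simps(2))
  have pre: "w_expression w \<phi>" "enc_nat ` wlabels \<phi> \<subseteq> set (items L)"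
    using Join.prems(1,2) by simp_all
  have ne: "join (left e0) ?a ?b \<noteq> Leaf"
    using e0(3) ne' by auto
  obtain S R C where 1: "S \<subseteq> wverts \<phi> - T" "len (right e0) = card S"
    "represents (wverts \<phi> - S) ?l T R C (assoc (left e0))"
    "\<forall>x y. (x, y) \<in> warcs \<phi> \<longrightarrow> x \<notin> S \<longrightarrow> y \<notin> S \<longrightarrow> (x, y) \<in> R"
    using Join.IH[OF pre e0(1)] by blast
  obtain R' where R': "R \<subseteq> R'" "represents (wverts \<phi> - S) ?l T R' C (assoc (join (left e0) ?a ?b))"
    "\<forall>x\<in>wverts \<phi> - S. \<forall>y\<in>wverts \<phi> - S. ?l x = ?a \<longrightarrow> ?l y = ?b \<longrightarrow> (x, y) \<in> R'"
    using represents_join[OF 1(3) ne] by (elim exE conjE) (rule that)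
  have forget: "\<exists>C. represents (wverts \<phi> - S) ?l T R' C (assoc (forget s a))"
    if "\<exists>C. represents (wverts \<phi> - S) ?l T R' C (assoc s)" for s a
    using that represents_forget by blast
  have J: "\<exists>C. represents (wverts \<phi> - S) ?l T R' C (assoc (join (left e0) ?a ?b))"
    using R'(2) by (rule exI[of _ C])
  have "\<exists>C'. represents (wverts \<phi> - S) ?l T R' C' (assoc (left e))"
    using e0(3) J forget[OF J, of ?a] forget[OF J, of ?b] forget[OF forget[OF J, of ?a], of ?b]
    by (elim insertE emptyE) simp_all
  then obtain C' where "represents (wverts \<phi> - S) ?l T R' C' (assoc (left e))"
    by blast
  moreover have "?l ` (wverts \<phi> - S) \<subseteq> set (items L)"
    by (intro image_subsetI enc_wlabel_mem[OF pre(2)]) simp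
  ultimately have "represents (wverts \<phi> - S) ?l T R' C' (assoc (left k))"
    using represents_canon[of "wverts \<phi> - S" ?l T R' C' "left e" L, OF _ ne'] L e(2)
    by (simp add: label_list_def)
  moreover have "\<forall>x y. (x, y) \<in> warcs (Join i j \<phi>) \<longrightarrow> x \<notin> S \<longrightarrow> y \<notin> S \<longrightarrow> (x, y) \<in> R'"
  proof (intro allI impI)
    fix x y
    assume xy: "(x, y) \<in> warcs (Join i j \<phi>)" "x \<notin> S" "y \<notin> S"
    have sym: "(y, x) \<in> R' \<Longrightarrow> (x, y) \<in> R'"
      using representsD(1)[OF R'(2)] by (auto simp: equiv_def sym_def)
    show "(x, y) \<in> R'"
    proof (cases "(x, y) \<in> warcs \<phi>")
      case True
      then show ?thesis
        using xy 1(4) R'(1) by blast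
    next
      case False
      then have "x \<in> wverts \<phi> - S" "y \<in> wverts \<phi> - S"
        "?l x = ?a \<and> ?l y = ?b \<or> ?l y = ?a \<and> ?l x = ?b"
        using xy by auto
      then show ?thesis
        using R'(3) sym by blast
    qed
  qed
  ultimately show ?case
    using 1(1,2) e(2) e0(2) by (intro exI[of _ S] exI[of _ R'] exI[of _ C']) simp
qed


lemma forget_table_mem:
  "Node s c \<in> set (items X) \<Longrightarrow> s' \<in> {s, forget s a} \<Longrightarrow> Node s' c \<in> set (items (forget_table X a))"
  by (auto simp: set_forget_table intro!: image_eqI[of _ _ "Node s c"])

text \<open>As \<open>C\<close> is constant on labels, keeping or forgetting the label
  \<open>a\<close> as a whole suffices to adjust the classes to \<open>C\<close> there.\<close>

lemma represents_forget_optional: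
  assumes rep: "represents X l T R C' (assoc s)"
    and C: "\<forall>x\<in>X. \<forall>y\<in>X. l x = l y \<longrightarrow> C x = C y"
  shows "\<exists>s'\<in>{s, forget s a}. represents X l T R (\<lambda>x. C' x \<and> (l x = a \<longrightarrow> C x)) (assoc s')"
proof (cases "\<exists>x\<in>X. l x = a \<and> \<not> C x")
  case True
  then have "(C' x \<and> l x \<noteq> a) = (C' x \<and> (l x = a \<longrightarrow> C x))" if "x \<in> X" for x
    using C that by metis
  note * = represents_commit_cong[OF this, where l = l and T = T and R = R and \<sigma> = "assoc (forget s a)"]
  show ?thesis
    by (rule bexI[of _ "forget s a"]) (use * represents_forget[OF rep, of a] in simp_all)
next
  case False
  then have "C' x = (C' x \<and> (l x = a \<longrightarrow> C x))" if "x \<in> X" for x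
    using that by blast
  note * = represents_commit_cong[OF this, where l = l and T = T and R = R and \<sigma> = "assoc s"]
  show ?thesis
    by (rule bexI[of _ s]) (use * rep in simp_all)
qed

text \<open>\<open>C\<close> prescribes which labels have to be classes. It varies in the induction
  because a join demands more classes of its subexpression than are demanded of its own result. The
  last hypothesis makes the prescription compatible with the solution: it is constant on labels, and
  the vertices of a prescribed label are related by \<open>Q\<close>. The conclusion
  \<open>R \<subseteq> Q\<close> ensures that the next operation does not fail.\<close>

lemma table_complete:
  assumes L: "label_list L" and T: "\<And>v. v \<in> T \<longleftrightarrow> enc_nat v \<in> set (items Ts)"
    and Q: "sym Q" "trans Q"
    and "w_expression w \<phi>" "enc_nat ` wlabels \<phi> \<subseteq> set (items L)" "S \<subseteq> wverts \<phi> - T"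
    and "\<forall>x\<in>wverts \<phi> - S. (x, x) \<in> Q"
    and "\<forall>x y. (x, y) \<in> warcs \<phi> \<longrightarrow> x \<notin> S \<longrightarrow> y \<notin> S \<longrightarrow> (x, y) \<in> Q"
    and "\<forall>t\<in>T \<inter> (wverts \<phi> - S). \<forall>t'\<in>T \<inter> (wverts \<phi> - S). (t, t') \<in> Q \<longrightarrow> t = t'"
    and "\<forall>x\<in>wverts \<phi> - S. \<forall>y\<in>wverts \<phi> - S.
      wlabel \<phi> x = wlabel \<phi> y \<longrightarrow> C x = C y \<and> (C x \<longrightarrow> (x, y) \<in> Q)"
  shows "\<exists>k\<in>set (items (table L Ts \<phi>)). \<exists>R. len (right k) = card S \<and> R \<subseteq> Q \<and>
    represents (wverts \<phi> - S) (\<lambda>x. enc_nat (wlabel \<phi> x)) T R C (assoc (left k))"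
  using assms(5-11)
proof (induction \<phi> arbitrary: S C)
  case (Vertex i v)
  let ?a = "enc_nat i" and ?l = "\<lambda>x. enc_nat (wlabel (Vertex i v) x)"
  have a: "?a \<in> set (items L)" "?a \<noteq> Leaf"
    using Vertex L by (auto simp: label_list_def)
  then have "?a \<in> left ` set (items (blank L))"
    by (metis image_set keys_blank)
  then have upd: "assoc (upd (blank L) ?a u) = (\<lambda>_. Leaf)(?a := u)" for u
    using assoc_upd[of ?a "blank L" u] by auto
  consider "S = {}" "\<not> C v" | "S = {}" "C v" | "S = {v}" "v \<notin> T"
    using Vertex.prems(3) by auto
  then show ?case
  proof cases
    case 1
    have "represents {v} ?l T {(v, v)} C ((\<lambda>_. Leaf)(?a := one))"
      by (rule representsI) (use 1 in \<open>auto simp: equiv_def refl_on_def sym_def trans_def split: if_splits\<close>)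
    then show ?thesis
      by (intro bexI[of _ "Node (upd (blank L) ?a one) Leaf"] exI[of _ "{(v, v)}"])
        (use 1 upd Vertex.prems(4) in \<open>simp_all add: fun_upd_def leaf_table_def\<close>)
  next
    case 2
    have "represents {v} ?l T {(v, v)} C ((\<lambda>_. Leaf)(?a := Node ?a (enc_bool (v \<in> T))))"
      by (rule representsI)
        (use a 2 in \<open>auto simp: equiv_def refl_on_def sym_def trans_def enc_bool_if split: if_splits\<close>)
    then show ?thesis
      by (intro bexI[of _ "Node (upd (blank L) ?a (Node ?a (enc_bool (v \<in> T)))) Leaf"]
          exI[of _ "{(v, v)}"])
        (use 2 upd Vertex.prems(4) T in \<open>simp_all add: fun_upd_def leaf_table_def\<close>)
  next
    case 3
    have "represents {} ?l T {} C (\<lambda>_. Leaf)"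
      by (rule representsI) (auto simp: equiv_def refl_on_def sym_def trans_def)
    then show ?thesis
      by (intro bexI[of _ "Node (blank L) one"] exI[of _ "{}"])
        (use 3 T in \<open>simp_all add: leaf_table_def\<close>)
  qed
next
  case (DUnion \<phi> \<psi>)
  have pre: "w_expression w \<phi>" "enc_nat ` wlabels \<phi> \<subseteq> set (items L)"
    "w_expression w \<psi>" "enc_nat ` wlabels \<psi> \<subseteq> set (items L)"
    and disj: "wverts \<phi> \<inter> wverts \<psi> = {}"
    using DUnion.prems(1,2) by (simp_all add: image_Un)
  define S1 where "S1 = S \<inter> wverts \<phi>"
  define S2 where "S2 = S \<inter> wverts \<psi>"
  have S: "S = S1 \<union> S2"
    using DUnion.prems(3) by (auto simp: S1_def S2_def)
  have X1: "wverts \<phi> - S1 \<subseteq> wverts (DUnion \<phi> \<psi>) - S" "wverts \<phi> - S1 = wverts \<phi> - S"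
    and X2: "wverts \<psi> - S2 \<subseteq> wverts (DUnion \<phi> \<psi>) - S" "wverts \<psi> - S2 = wverts \<psi> - S"
    by (auto simp: S1_def S2_def)
  have X: "wverts (DUnion \<phi> \<psi>) - S = (wverts \<phi> - S1) \<union> (wverts \<psi> - S2)"
    unfolding X1(2) X2(2) by auto
  have lab1: "wlabel (DUnion \<phi> \<psi>) x = wlabel \<phi> x" if "x \<in> wverts \<phi> - S1" for x
    using that by simp
  have lab2: "wlabel (DUnion \<phi> \<psi>) x = wlabel \<psi> x" if "x \<in> wverts \<psi> - S2" for x
    using that disj by auto
  have "\<exists>k\<in>set (items (table L Ts \<phi>)). \<exists>R. len (right k) = card S1 \<and> R \<subseteq> Q \<and>
    represents (wverts \<phi> - S1) (\<lambda>x. enc_nat (wlabel \<phi> x)) T R C (assoc (left k))"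
  proof (rule DUnion.IH(1)[OF pre(1,2)])
    show "S1 \<subseteq> wverts \<phi> - T"
      using DUnion.prems(3) by (auto simp: S1_def)
    show "\<forall>x\<in>wverts \<phi> - S1. (x, x) \<in> Q"
      using DUnion.prems(4) X1(1) by blast
    show "\<forall>x y. (x, y) \<in> warcs \<phi> \<longrightarrow> x \<notin> S1 \<longrightarrow> y \<notin> S1 \<longrightarrow> (x, y) \<in> Q"
      using DUnion.prems(5) warcs_subset[of \<phi>] by (auto simp: S1_def)
    show "\<forall>t\<in>T \<inter> (wverts \<phi> - S1). \<forall>t'\<in>T \<inter> (wverts \<phi> - S1). (t, t') \<in> Q \<longrightarrow> t = t'"
      using DUnion.prems(6) X1(1) by blast
    show "\<forall>x\<in>wverts \<phi> - S1. \<forall>y\<in>wverts \<phi> - S1. wlabel \<phi> x = wlabel \<phi> y \<longrightarrow>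
        C x = C y \<and> (C x \<longrightarrow> (x, y) \<in> Q)"
    proof (intro ballI impI)
      fix x y
      assume xy: "x \<in> wverts \<phi> - S1" "y \<in> wverts \<phi> - S1" "wlabel \<phi> x = wlabel \<phi> y"
      then have "wlabel (DUnion \<phi> \<psi>) x = wlabel (DUnion \<phi> \<psi>) y"
        using lab1 by presburger
      then show "C x = C y \<and> (C x \<longrightarrow> (x, y) \<in> Q)"
        using DUnion.prems(7) X1(1) xy(1,2) by blast
    qed
  qed
  then obtain k1 R1 where 1: "k1 \<in> set (items (table L Ts \<phi>))" "len (right k1) = card S1" "R1 \<subseteq> Q"
    "represents (wverts \<phi> - S1) (\<lambda>x. enc_nat (wlabel \<phi> x)) T R1 C (assoc (left k1))"
    by blast
  have "\<exists>k\<in>set (items (table L Ts \<psi>)). \<exists>R. len (right k) = card S2 \<and> R \<subseteq> Q \<and>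
    represents (wverts \<psi> - S2) (\<lambda>x. enc_nat (wlabel \<psi> x)) T R C (assoc (left k))"
  proof (rule DUnion.IH(2)[OF pre(3,4)])
    show "S2 \<subseteq> wverts \<psi> - T"
      using DUnion.prems(3) by (auto simp: S2_def)
    show "\<forall>x\<in>wverts \<psi> - S2. (x, x) \<in> Q"
      using DUnion.prems(4) X2(1) by blast
    show "\<forall>x y. (x, y) \<in> warcs \<psi> \<longrightarrow> x \<notin> S2 \<longrightarrow> y \<notin> S2 \<longrightarrow> (x, y) \<in> Q"
      using DUnion.prems(5) warcs_subset[of \<psi>] by (auto simp: S2_def)
    show "\<forall>t\<in>T \<inter> (wverts \<psi> - S2). \<forall>t'\<in>T \<inter> (wverts \<psi> - S2). (t, t') \<in> Q \<longrightarrow> t = t'"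
      using DUnion.prems(6) X2(1) by blast
    show "\<forall>x\<in>wverts \<psi> - S2. \<forall>y\<in>wverts \<psi> - S2. wlabel \<psi> x = wlabel \<psi> y \<longrightarrow>
        C x = C y \<and> (C x \<longrightarrow> (x, y) \<in> Q)"
    proof (intro ballI impI)
      fix x y
      assume xy: "x \<in> wverts \<psi> - S2" "y \<in> wverts \<psi> - S2" "wlabel \<psi> x = wlabel \<psi> y"
      then have "wlabel (DUnion \<phi> \<psi>) x = wlabel (DUnion \<phi> \<psi>) y"
        using lab2 by presburger
      then show "C x = C y \<and> (C x \<longrightarrow> (x, y) \<in> Q)"
        using DUnion.prems(7) X2(1) xy(1,2) by blast
    qed
  qed
  then obtain k2 R2 where 2: "k2 \<in> set (items (table L Ts \<psi>))" "len (right k2) = card S2" "R2 \<subseteq> Q"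
    "represents (wverts \<psi> - S2) (\<lambda>x. enc_nat (wlabel \<psi> x)) T R2 C (assoc (left k2))"
    by blast
  let ?u = "fuse L (app (left k1) (tag (left k2)))"
  have wf: "wf_state L (left k1)" "wf_state L (left k2)"
    using wf_key_table(2)[OF L pre(1,2) 1(1)] wf_key_table(2)[OF L pre(3,4) 2(1)]
    by (simp_all add: wf_key_def)
  have disj': "(wverts \<phi> - S1) \<inter> (wverts \<psi> - S2) = {}"
    using disj by blast
  have lab: "enc_nat (wlabel (DUnion \<phi> \<psi>) x) =
      (if x \<in> wverts \<phi> - S1 then enc_nat (wlabel \<phi> x) else enc_nat (wlabel \<psi> x))"
    if "x \<in> (wverts \<phi> - S1) \<union> (wverts \<psi> - S2)" for x
    using that disj by auto
  have RQ: "R1 \<union> R2 \<subseteq> Q"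
    using 1(3) 2(3) by blast
  have C: "\<forall>x\<in>wverts (DUnion \<phi> \<psi>) - S. \<forall>y\<in>wverts (DUnion \<phi> \<psi>) - S.
      enc_nat (wlabel (DUnion \<phi> \<psi>) x) = enc_nat (wlabel (DUnion \<phi> \<psi>) y) \<longrightarrow>
      C x = C y \<and> (C x \<longrightarrow> (x, y) \<in> Q)"
    using DUnion.prems(7) by (simp only: enc_nat_inject)
  have T': "t = t'" if "t \<in> T \<inter> ((wverts \<phi> - S1) \<union> (wverts \<psi> - S2))"
    "t' \<in> T \<inter> ((wverts \<phi> - S1) \<union> (wverts \<psi> - S2))" "(t, t') \<in> Q" for t t'
    using DUnion.prems(6) that unfolding X by blast
  have ne: "?u \<noteq> Leaf"
    by (rule union_neq_Leaf[OF L wf 1(4) 2(4) disj' lab Q RQ T' C[unfolded X]])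
  \<comment> \<open>Success of the union is known at this point; minimality for the given
    \<open>Q\<close> remains to be extracted, so that the new relation stays inside the
    solution.\<close>
  obtain R' where R': "represents ((wverts \<phi> - S1) \<union> (wverts \<psi> - S2))
      (\<lambda>x. enc_nat (wlabel (DUnion \<phi> \<psi>) x)) T R' C (assoc (canon L ?u))"
    "\<forall>Q. sym Q \<longrightarrow> trans Q \<longrightarrow> R1 \<union> R2 \<subseteq> Q \<longrightarrow>
      (\<forall>x\<in>(wverts \<phi> - S1) \<union> (wverts \<psi> - S2). \<forall>y\<in>(wverts \<phi> - S1) \<union> (wverts \<psi> - S2).
        enc_nat (wlabel (DUnion \<phi> \<psi>) x) = enc_nat (wlabel (DUnion \<phi> \<psi>) y) \<longrightarrow>
        C x \<longrightarrow> (x, y) \<in> Q) \<longrightarrow> R' \<subseteq> Q"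
    using represents_union[OF L wf 1(4) 2(4) disj' ne lab] by metis
  have "R' \<subseteq> Q"
    using R'(2) Q RQ C[unfolded X] by blast
  moreover have "Node (canon L ?u) (app (right k1) (right k2)) \<in> set (items (table L Ts (DUnion \<phi> \<psi>)))"
    using 1(1) 2(1) ne canon_eq_Leaf[OF L] by (force simp: clean_items items_union_table)
  moreover have "len (app (right k1) (right k2)) = card S"
    using 1(2) 2(2) card_union_parts[OF finite_wverts finite_wverts disj, of S1 S2]
    by (simp add: S) (simp add: S1_def S2_def)
  ultimately show ?case
    using R'(1) unfolding X
    by (intro bexI[of _ "Node (canon L ?u) (app (right k1) (right k2))"] exI[of _ R'] conjI)
      (simp_all only: left.simps right.simps)
next
  case (Relabel i j \<phi>)
  let ?a = "enc_nat i" and ?b = "enc_nat j"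
  let ?l = "\<lambda>x. enc_nat (wlabel \<phi> x)" and ?l' = "\<lambda>x. enc_nat (wlabel (Relabel i j \<phi>) x)"
  let ?X = "wverts \<phi> - S"
  have pre: "w_expression w \<phi>" "enc_nat ` wlabels \<phi> \<subseteq> set (items L)"
    using Relabel.prems(1,2) by simp_all
  have prem: "C x = C y \<and> (C x \<longrightarrow> (x, y) \<in> Q)"
    if "x \<in> ?X" "y \<in> ?X" "wlabel (Relabel i j \<phi>) x = wlabel (Relabel i j \<phi>) y" for x y
    by (rule Relabel.prems(7)[unfolded wverts.simps, rule_format, OF that])
  have "\<exists>k\<in>set (items (table L Ts \<phi>)). \<exists>R. len (right k) = card S \<and> R \<subseteq> Q \<and>
    represents ?X ?l T R C (assoc (left k))"
  proof (rule Relabel.IH[OF pre])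
    show "\<forall>x\<in>?X. \<forall>y\<in>?X. wlabel \<phi> x = wlabel \<phi> y \<longrightarrow> C x = C y \<and> (C x \<longrightarrow> (x, y) \<in> Q)"
    proof (intro ballI impI)
      fix x y
      assume xy: "x \<in> ?X" "y \<in> ?X" "wlabel \<phi> x = wlabel \<phi> y"
      then have "wlabel (Relabel i j \<phi>) x = wlabel (Relabel i j \<phi>) y"
        by simp
      then show "C x = C y \<and> (C x \<longrightarrow> (x, y) \<in> Q)"
        by (rule prem[OF xy(1,2)])
    qed
  qed (use Relabel.prems(3-6) in \<open>simp_all only: wverts.simps warcs.simps\<close>)
  then obtain k R where k: "k \<in> set (items (table L Ts \<phi>))" "len (right k) = card S" "R \<subseteq> Q"
    "represents ?X ?l T R C (assoc (left k))"
    by blast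
  have wf: "wf_state L (left k)"
    using wf_key_table(2)[OF L pre k(1)] by (simp add: wf_key_def)
  have C: "C x = C y \<and> (C x \<longrightarrow> (x, y) \<in> Q)" if "x \<in> ?X" "y \<in> ?X" "?l x = ?a" "?l y = ?b" for x y
  proof -
    have "wlabel (Relabel i j \<phi>) x = wlabel (Relabel i j \<phi>) y"
      using that(3,4) by simp
    then show ?thesis
      by (rule prem[OF that(1,2)])
  qed
  have T': "t = t'" if "t \<in> T \<inter> ?X" "t' \<in> T \<inter> ?X" "(t, t') \<in> Q" for t t'
    using Relabel.prems(6) that unfolding wverts.simps by blast
  have ne: "relab (left k) ?a ?b \<noteq> Leaf"
    by (rule relab_neq_Leaf[OF k(4) wf_state_neq_Leaf[OF L wf] Q k(3) T' C])
  have ab: "{?a, ?b} \<subseteq> left ` set (items (left k))"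
    using Relabel.prems(2) unfolding keys_wf_state[OF wf] by auto
  obtain R' where R': "represents ?X (\<lambda>x. if ?l x = ?a then ?b else ?l x) T R' C
      (assoc (relab (left k) ?a ?b))"
    "\<forall>Q. sym Q \<longrightarrow> trans Q \<longrightarrow> R \<subseteq> Q \<longrightarrow>
      (\<forall>x\<in>?X. \<forall>y\<in>?X. ?l x = ?a \<longrightarrow> ?l y = ?b \<longrightarrow> C x \<longrightarrow> (x, y) \<in> Q) \<longrightarrow> R' \<subseteq> Q"
    using represents_relab[OF k(4) ab ne] by (elim exE conjE) (rule that)
  have RQ: "R' \<subseteq> Q"
    using R'(2) Q k(3) C by blast
  have l: "(\<lambda>x. if ?l x = ?a then ?b else ?l x) = ?l'"
    by auto
  have "?l' ` ?X \<subseteq> set (items L)"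
    by (intro image_subsetI enc_wlabel_mem[OF Relabel.prems(2)]) simp
  then have "represents ?X ?l' T R' C (assoc (canon L (relab (left k) ?a ?b)))"
    using represents_canon[OF R'(1)[unfolded l] ne] L by (simp add: label_list_def)
  moreover have "Node (canon L (relab (left k) ?a ?b)) (right k) \<in> set (items (table L Ts (Relabel i j \<phi>)))"
    using k(1) ne canon_eq_Leaf[OF L] by (force simp: clean_items items_relab_table)
  ultimately show ?case
    unfolding wverts.simps using k(2) RQ
    by (intro bexI[of _ "Node (canon L (relab (left k) ?a ?b)) (right k)"] exI[of _ R'] conjI)
      (simp_all only: left.simps right.simps)
next
  case (Join i j \<phi>)
  let ?a = "enc_nat i" and ?b = "enc_nat j" and ?l = "\<lambda>x. enc_nat (wlabel \<phi> x)"
  let ?X = "wverts \<phi> - S"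
  have pre: "w_expression w \<phi>" "enc_nat ` wlabels \<phi> \<subseteq> set (items L)"
    using Join.prems(1,2) by simp_all
  \<comment> \<open>Below the join, \<open>i\<close> and \<open>j\<close> have to be classes if both
    are live, for then the join adds edges to each. On all other vertices the prescription stays the
    same.\<close>
  define C' where "C' x \<longleftrightarrow> C x \<or> wlabel \<phi> x \<in> {i, j} \<and>
    (\<exists>u\<in>?X. wlabel \<phi> u = i) \<and> (\<exists>v\<in>?X. wlabel \<phi> v = j)" for x
  have arc: "(x, y) \<in> Q" if "x \<in> ?X" "y \<in> ?X"
    "wlabel \<phi> x = i \<and> wlabel \<phi> y = j \<or> wlabel \<phi> x = j \<and> wlabel \<phi> y = i" for x y
    using Join.prems(5) that by auto
  have C: "C x = C y \<and> (C x \<longrightarrow> (x, y) \<in> Q)"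
    if "x \<in> ?X" "y \<in> ?X" "wlabel \<phi> x = wlabel \<phi> y" for x y
    by (rule Join.prems(7)[unfolded wverts.simps wlabel.simps, rule_format, OF that])
  have C': "C' x = C' y \<and> (C' x \<longrightarrow> (x, y) \<in> Q)"
    if "x \<in> ?X" "y \<in> ?X" "wlabel \<phi> x = wlabel \<phi> y" for x y
  proof -
    have "C' x = C' y"
      using C[OF that] that(3) by (simp add: C'_def)
    \<comment> \<open>Vertices of the same joined label are related through a live vertex
      \<open>z\<close> of the opposite label, to which the join makes both adjacent.\<close>
    moreover have "(x, y) \<in> Q" if "C' x" "\<not> C x"
    proof -
      obtain z where "z \<in> ?X"
        "wlabel \<phi> x = i \<and> wlabel \<phi> z = j \<or> wlabel \<phi> x = j \<and> wlabel \<phi> z = i"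
        using \<open>C' x\<close> \<open>\<not> C x\<close> unfolding C'_def by auto
      then have "(x, z) \<in> Q" "(z, y) \<in> Q"
        using arc[of x z] arc[of z y] \<open>x \<in> ?X\<close> \<open>y \<in> ?X\<close> \<open>wlabel \<phi> x = wlabel \<phi> y\<close> by auto
      then show ?thesis
        using Q(2) by (rule transD[rotated])
    qed
    ultimately show ?thesis
      using C[OF that] by blast
  qed
  have "\<exists>k\<in>set (items (table L Ts \<phi>)). \<exists>R. len (right k) = card S \<and> R \<subseteq> Q \<and>
    represents ?X ?l T R C' (assoc (left k))"
  proof (rule Join.IH[OF pre])
    show "\<forall>x\<in>?X. \<forall>y\<in>?X. wlabel \<phi> x = wlabel \<phi> y \<longrightarrow> C' x = C' y \<and> (C' x \<longrightarrow> (x, y) \<in> Q)"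
      using C' by blast
    show "\<forall>x y. (x, y) \<in> warcs \<phi> \<longrightarrow> x \<notin> S \<longrightarrow> y \<notin> S \<longrightarrow> (x, y) \<in> Q"
      using Join.prems(5) by simp
  qed (use Join.prems(3,4,6) in \<open>simp_all only: wverts.simps\<close>)
  then obtain k R where k: "k \<in> set (items (table L Ts \<phi>))" "len (right k) = card S" "R \<subseteq> Q"
    "represents ?X ?l T R C' (assoc (left k))"
    by blast
  have wf: "wf_state L (left k)"
    using wf_key_table(2)[OF L pre k(1)] by (simp add: wf_key_def)
  have T': "t = t'" if "t \<in> T \<inter> ?X" "t' \<in> T \<inter> ?X" "(t, t') \<in> Q" for t t'
    using Join.prems(6) that unfolding wverts.simps by blast
  have ab: "C' x \<and> C' y \<and> (x, y) \<in> Q" if "x \<in> ?X" "y \<in> ?X" "?l x = ?a" "?l y = ?b" for x y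
    using that arc[OF that(1,2)] unfolding C'_def enc_nat_inject by blast
  let ?s = "join (left k) ?a ?b"
  have ne: "?s \<noteq> Leaf"
    by (rule join_neq_Leaf[OF k(4) wf_state_neq_Leaf[OF L wf] Q k(3) T' ab])
  obtain R' where R': "represents ?X ?l T R' C' (assoc ?s)"
    "\<forall>Q. sym Q \<longrightarrow> trans Q \<longrightarrow> R \<subseteq> Q \<longrightarrow>
      (\<forall>x\<in>?X. \<forall>y\<in>?X. ?l x = ?a \<longrightarrow> ?l y = ?b \<longrightarrow> (x, y) \<in> Q) \<longrightarrow> R' \<subseteq> Q"
    using represents_join[OF k(4) ne] by (elim exE conjE) (rule that)
  have RQ: "R' \<subseteq> Q"
    using R'(2) Q k(3) ab by blast
  have Ceq: "\<forall>x\<in>?X. \<forall>y\<in>?X. ?l x = ?l y \<longrightarrow> C x = C y"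
    unfolding enc_nat_inject using C by blast
  obtain s1 where s1: "s1 \<in> {?s, forget ?s ?a}"
    "represents ?X ?l T R' (\<lambda>x. C' x \<and> (?l x = ?a \<longrightarrow> C x)) (assoc s1)"
    using represents_forget_optional[OF R'(1) Ceq, of ?a]
    by (elim bexE) (rule that)
  obtain s2 where s2: "s2 \<in> {s1, forget s1 ?b}"
    "represents ?X ?l T R' (\<lambda>x. (C' x \<and> (?l x = ?a \<longrightarrow> C x)) \<and> (?l x = ?b \<longrightarrow> C x)) (assoc s2)"
    using represents_forget_optional[OF s1(2) Ceq, of ?b]
    by (elim bexE) (rule that)
  \<comment> \<open>\<open>C'\<close> exceeds \<open>C\<close> only on the labels \<open>i\<close>
    and \<open>j\<close>, so the two optional forget steps lead back exactly to
    \<open>C\<close>.\<close>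
  have "((C' x \<and> (?l x = ?a \<longrightarrow> C x)) \<and> (?l x = ?b \<longrightarrow> C x)) = C x" if "x \<in> ?X" for x
    unfolding C'_def by auto
  from represents_commit_cong[OF this, where l = ?l and T = T and R = R' and \<sigma> = "assoc s2"]
  have "represents ?X ?l T R' C (assoc s2)"
    using s2(2) by (rule iffD1)
  moreover have ne2: "s2 \<noteq> Leaf"
    using ne s1(1) s2(1) by (metis forget_eq_Leaf insertE singletonD)
  moreover have "?l ` ?X \<subseteq> set (items L)"
    by (intro image_subsetI enc_wlabel_mem[OF pre(2)]) simp
  ultimately have "represents ?X ?l T R' C (assoc (canon L s2))"
    using represents_canon[of ?X ?l T R' C s2 L] L by (simp add: label_list_def)
  moreover have "Node (canon L s2) (right k) \<in> set (items (table L Ts (Join i j \<phi>)))"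
  proof -
    have "Node ?s (right k) \<in> set (items (join_table (table L Ts \<phi>) ?a ?b))"
      using k(1) by (force simp: items_join_table)
    then have "Node s1 (right k) \<in> set (items (forget_table (join_table (table L Ts \<phi>) ?a ?b) ?a))"
      using s1(1) by (rule forget_table_mem)
    then have "Node s2 (right k) \<in> set (items (forget_table
        (forget_table (join_table (table L Ts \<phi>) ?a ?b) ?a) ?b))"
      using s2(1) by (rule forget_table_mem)
    then show ?thesis
      using ne2 canon_eq_Leaf[OF L, of s2] unfolding table.simps clean_items
      by (intro conjI bexI[of _ "Node s2 (right k)"]) simp_all
  qed
  ultimately show ?case
    unfolding wverts.simps wlabel.simps using k(2) RQ
    by (intro bexI[of _ "Node (canon L s2) (right k)"] exI[of _ R'] conjI)
      (simp_all only: left.simps right.simps)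
qed

section \<open>Correctness\<close>

lemma len_half: "len (half u) = (len u + 1) div 2"
  by (induction u rule: half.induct) auto

lemma len_right: "len (right u) = len u - 1"
  by (cases u) auto

lemma leq_enc_nat: "leq u (enc_nat n) \<longleftrightarrow> len u \<le> n"
proof (induction n arbitrary: u rule: less_induct)
  case (less n)
  show ?case
  proof (cases "n = 0")
    case True
    then show ?thesis by (cases u) auto
  next
    case False
    then have "leq u (enc_nat n) \<longleftrightarrow> len (half (if odd n then right u else u)) \<le> n div 2"
      using less.IH[of "n div 2"] by (simp add: enc_nat_pos)
    also have "\<dots> \<longleftrightarrow> len u \<le> n"
      using False by (auto simp: len_half len_right elim!: oddE evenE)
    finally show ?thesis .
  qed
qed

lemma accept_iff: "accept X k \<longleftrightarrow> (\<exists>e\<in>set (items X). leq (right e) k)"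
  by (induction X) auto

lemma set_add [simp]: "set (items (add x K)) = insert x (set (items K))"
  by (auto simp: add_def)

lemma distinct_add [simp]: "distinct (items (add x K)) \<longleftrightarrow> distinct (items K)"
  by (auto simp: add_def)

lemma set_labels: "set (items (labels \<phi> K)) = enc_nat ` wlabels \<phi> \<union> set (items K)"
  by (induction \<phi> arbitrary: K) auto

lemma distinct_labels: "distinct (items K) \<Longrightarrow> distinct (items (labels \<phi> K))"
  by (induction \<phi> arbitrary: K) auto

lemma wlabels_subset: "w_expression w \<phi> \<Longrightarrow> wlabels \<phi> \<subseteq> {1..w}"
  by (induction \<phi>) auto

lemma wlabels_nonempty: "wlabels \<phi> \<noteq> {}"
  by (induction \<phi>) auto

lemma label_list_labels:
  assumes "w_expression w \<phi>"
  shows "label_list (labels \<phi> Leaf)" "len (labels \<phi> Leaf) \<le> w"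
proof -
  have set: "set (items (labels \<phi> Leaf)) = enc_nat ` wlabels \<phi>"
    by (simp add: set_labels)
  have pos: "0 < i" if "i \<in> wlabels \<phi>" for i
    using wlabels_subset[OF assms] that by auto
  have dist: "distinct (items (labels \<phi> Leaf))"
    by (rule distinct_labels) simp
  have "labels \<phi> Leaf \<noteq> Leaf"
    using set wlabels_nonempty[of \<phi>] by (metis empty_set image_is_empty items.simps(1))
  moreover have "Leaf \<notin> enc_nat ` wlabels \<phi>"
    using pos enc_nat_eq_Leaf by (metis imageE less_irrefl)
  moreover have "\<forall>a\<in>enc_nat ` wlabels \<phi>. \<forall>b\<in>enc_nat ` wlabels \<phi>. a \<noteq> Node b Leaf"
    using enc_nat_neq_tagged[OF pos pos] by (intro ballI) (elim imageE, simp)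
  ultimately show "label_list (labels \<phi> Leaf)"
    unfolding label_list_def set using dist by simp
  have "len (labels \<phi> Leaf) = card (enc_nat ` wlabels \<phi>)"
    using distinct_card[OF dist] set by simp
  also have "\<dots> \<le> card (wlabels \<phi>)"
    using wlabels_subset[OF assms] by (intro card_image_le) (auto intro: finite_subset)
  also have "\<dots> \<le> card {1..w}"
    using wlabels_subset[OF assms] by (intro card_mono) auto
  finally show "len (labels \<phi> Leaf) \<le> w"
    by simp
qed

lemma sym_warcs: "sym (warcs \<phi>)"
proof (induction \<phi>)
  case (DUnion \<phi> \<psi>)
  then show ?case by (simp add: sym_Un)
next
  case (Join i j \<phi>)
  then show ?case by (auto simp: sym_def)
qed (auto simp: sym_def)

lemma wf_digraph_delete_verts: "wf_digraph (delete_verts (wgraph \<phi>) S)"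
  using warcs_subset[of \<phi>] by unfold_locales (auto simp: delete_verts_def wgraph_def)

text \<open>Reachability is an equivalence relation on the surviving vertices and admits induction
  along edges; in this form the cut condition can be compared with the relations of the
  tables.\<close>

lemma apath_delete_verts_iff:
  "(\<exists>p. pre_digraph.apath (delete_verts (wgraph \<phi>) S) s p t) \<longleftrightarrow>
    (s, t) \<in> rtrancl_on (wverts \<phi> - S) {(u, v) \<in> warcs \<phi>. u \<notin> S \<and> v \<notin> S}"
proof -
  have "arcs_ends (delete_verts (wgraph \<phi>) S) = {(u, v) \<in> warcs \<phi>. u \<notin> S \<and> v \<notin> S}"
    using warcs_subset[of \<phi>]
    by (force simp: arcs_ends_def arc_to_ends_def delete_verts_def wgraph_def)
  moreover have "verts (delete_verts (wgraph \<phi>) S) = wverts \<phi> - S"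
    by (simp add: delete_verts_def wgraph_def)
  ultimately show ?thesis
    using wf_digraph.reachable_apath[OF wf_digraph_delete_verts[of \<phi> S], of s t]
    by (simp add: reachable_def)
qed

text \<open>A solution gives reachability in the remaining graph as the relation for completeness;
  conversely, the relation of an accepted entry contains reachability. The sign of \<open>k\<close>
  is tested separately because \<open>nat\<close> sends negative numbers to 0.\<close>

theorem table_correct:
  assumes w: "w_expression w \<phi>" and T: "\<And>v. v \<in> T \<longleftrightarrow> enc_nat v \<in> set (items Ts)"
    and TV: "T \<subseteq> wverts \<phi>"
  shows "node_multiway_cut (wgraph \<phi>) T k \<longleftrightarrow>
    0 \<le> k \<and> accept (table (labels \<phi> Leaf) Ts \<phi>) (enc_nat (nat k))"
proof -
  let ?L = "labels \<phi> Leaf"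
  note L = label_list_labels(1)[OF w]
  have lab: "enc_nat ` wlabels \<phi> \<subseteq> set (items ?L)"
    by (simp add: set_labels)
  let ?E = "\<lambda>S. {(u, v) \<in> warcs \<phi>. u \<notin> S \<and> v \<notin> S}"
  have cut: "multiway_cut (wgraph \<phi>) T S \<longleftrightarrow> S \<subseteq> wverts \<phi> - T \<and>
    (\<forall>s\<in>T. \<forall>t\<in>T. s \<noteq> t \<longrightarrow> (s, t) \<notin> rtrancl_on (wverts \<phi> - S) (?E S))" for S
    unfolding multiway_cut_def apath_delete_verts_iff by (simp add: wgraph_def)
  show ?thesis
  proof
    assume "node_multiway_cut (wgraph \<phi>) T k"
    then obtain S where S: "multiway_cut (wgraph \<phi>) T S" "int (card S) \<le> k"
      by (auto simp: node_multiway_cut_def)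
    let ?Q = "rtrancl_on (wverts \<phi> - S) (?E S)"
    have "sym (?E S)"
      using sym_warcs[of \<phi>] by (auto simp: sym_def)
    then have "sym ?Q"
      by (rule rtrancl_on_sym)
    moreover have "trans ?Q"
      by (rule transI) (rule rtrancl_on_trans)
    moreover have "(x, y) \<in> ?Q" if "(x, y) \<in> warcs \<phi>" "x \<notin> S" "y \<notin> S" for x y
      using that warcs_subset[of \<phi>] by (auto intro!: rtrancl_on_into_rtrancl_on[of x x])
    moreover have "(x, x) \<in> ?Q" if "x \<in> wverts \<phi> - S" for x
      using that by simp
    moreover have "S \<subseteq> wverts \<phi> - T" "t = t'" if "t \<in> T" "t' \<in> T" "(t, t') \<in> ?Q" for t t'
      using S(1) that unfolding cut by blast+
    moreover have "S \<subseteq> wverts \<phi> - T"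
      using S(1) unfolding cut by blast
    \<comment> \<open>No label is prescribed to be a class, since no edge is added above the
      root.\<close>
    ultimately obtain e where e: "e \<in> set (items (table ?L Ts \<phi>))" "len (right e) = card S"
      using table_complete[OF L T, of ?Q w \<phi> S "\<lambda>_. False"] w lab by blast
    then have "leq (right e) (enc_nat (nat k))"
      using S(2) by (simp add: leq_enc_nat)
    then show "0 \<le> k \<and> accept (table ?L Ts \<phi>) (enc_nat (nat k))"
      using e(1) S(2) by (auto simp: accept_iff)
  next
    assume k: "0 \<le> k \<and> accept (table ?L Ts \<phi>) (enc_nat (nat k))"
    then obtain e where e: "e \<in> set (items (table ?L Ts \<phi>))" "len (right e) \<le> nat k"
      by (auto simp: accept_iff leq_enc_nat)
    obtain S R C where S: "S \<subseteq> wverts \<phi> - T" "len (right e) = card S"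
      "represents (wverts \<phi> - S) (\<lambda>x. enc_nat (wlabel \<phi> x)) T R C (assoc (left e))"
      "\<forall>x y. (x, y) \<in> warcs \<phi> \<longrightarrow> x \<notin> S \<longrightarrow> y \<notin> S \<longrightarrow> (x, y) \<in> R"
      using table_sound[OF L T w lab e(1)] by blast
    have R: "(s, t) \<in> R" if "(s, t) \<in> rtrancl_on (wverts \<phi> - S) (?E S)" for s t
      using that
    proof (induction rule: rtrancl_on_induct)
      case base
      then show ?case
        using representsD(1)[OF S(3)] by (auto simp: equiv_def refl_on_def)
    next
      case (step y z)
      then have "(y, z) \<in> R"
        using S(4) by blast
      with step.IH show ?case
        using representsD(1)[OF S(3)] by (meson equivE transE)
    qed
    \<comment> \<open>Terminals lie in the graph and outside \<open>S\<close>, so they are live, and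
      the relation of the entry separates them.\<close>
    have "s = t" if "s \<in> T" "t \<in> T" "(s, t) \<in> rtrancl_on (wverts \<phi> - S) (?E S)" for s t
    proof (rule representsD(9)[OF S(3) _ _ R[OF that(3)]])
      show "s \<in> T \<inter> (wverts \<phi> - S)" "t \<in> T \<inter> (wverts \<phi> - S)"
        using that(1,2) TV S(1) by auto
    qed
    then have "multiway_cut (wgraph \<phi>) T S"
      unfolding cut using S(1) by blast
    moreover have "int (card S) \<le> k"
      using e(2) S(2) k by (simp add: le_nat_iff)
    ultimately show "node_multiway_cut (wgraph \<phi>) T k"
      unfolding node_multiway_cut_def by blast
  qed
qed

section \<open>Running time\<close>

text \<open>For guards of known outcome: neither a value nor a bound is asked for the other branch,
  which in the dispatch on constructors would take an expression apart in the wrong way.\<close>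

lemma takes_CondT:
  assumes "takes P env b x s" "x \<noteq> Leaf" "takes P env e1 y t"
  shows "takes P env (Cond b e1 e2) y (s + t + 1)"
  using takes_Cond[of P env b x s e1 y t e2 y 0] assms by simp

lemma takes_CondF:
  assumes "takes P env b x s" "x = Leaf" "takes P env e2 y t"
  shows "takes P env (Cond b e1 e2) y (s + t + 1)"
  using takes_Cond[of P env b x s e1 y 0 e2 y t] assms by simp

lemma takes_select:
  "takes P (Node x y # env) (Fst (Var 0)) x 2"
  "takes P (Node x0 (Node x y) # env) (Fst (Snd (Var 0))) x 3"
  "takes P (Node x0 (Node x1 (Node x y)) # env) (Fst (Snd (Snd (Var 0)))) x 4"
  "takes P (Node x0 (Node x1 (Node x2 (Node x y))) # env) (Fst (Snd (Snd (Snd (Var 0))))) x 5"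
  "takes P (Node x0 (Node x1 (Node x2 (Node x3 (Node x y)))) # env)
    (Fst (Snd (Snd (Snd (Snd (Var 0)))))) x 6"
  by (rule takes_mono, (rule takes_rules)+, simp, simp)+

lemma enc_tags: "enc_nat (Suc 0) = Node one Leaf" "enc_nat 2 = Node Leaf (Node one Leaf)"
  "enc_nat 3 = Node one (Node one Leaf)"
  by (simp_all add: enc_nat_pos)

primrec nodes :: "'a wexp \<Rightarrow> nat" where
  "nodes (Vertex i v) = 1"
| "nodes (DUnion \<phi> \<psi>) = nodes \<phi> + nodes \<psi> + 1"
| "nodes (Relabel i j \<phi>) = nodes \<phi> + 1"
| "nodes (Join i j \<phi>) = nodes \<phi> + 1"

lemma len_add_ge: "len K \<le> len (add x K)"
  by (simp add: add_def)

lemma len_labels_ge: "len K \<le> len (labels \<phi> K)"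
proof (induction \<phi> arbitrary: K)
  case (DUnion \<phi> \<psi>)
  then show ?case using le_trans by fastforce
qed (auto simp: add_def intro: le_SucI)

lemma computes_add_le:
  assumes "len K \<le> Z" "input_size x \<le> Z"
  shows "computes prog f_add [x, K] (add x K) (60 * Z * Z)"
proof (rule computes_mono[OF computes_add refl])
  have Z: "1 \<le> Z"
    using assms(2) input_size_pos le_trans by blast
  have "len K * (20 * input_size x + 20) \<le> Z * (40 * Z)"
    using assms Z by (intro mult_mono) auto
  moreover have "1 \<le> Z * Z" "Z * (40 * Z) + 20 * (Z * Z) = 60 * Z * Z"
    using Z by simp_all
  ultimately show "len K * (20 * input_size x + 20) + 20 \<le> 60 * Z * Z"
    by linarith
qed

text \<open>The list of labels only grows, so a bound on its final length applies to all
  intermediate lists.\<close>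

lemma computes_labels:
  assumes "len (labels \<phi> K) \<le> Z" "\<forall>i\<in>wlabels \<phi>. input_size (enc_nat i) \<le> Z" "1 \<le> Z"
  shows "computes prog f_labels [enc_wexp \<phi>, K] (labels \<phi> K) (nodes \<phi> * (200 * Z * Z))"
  using assms(1,2)
proof (induction \<phi> arbitrary: K)
  case (Vertex i v)
  define p where "p = Z * Z"
  have p: "1 \<le> p"
    using assms(3) by (simp add: p_def)
  have "len K \<le> Z"
    using Vertex.prems(1) len_add_ge[of K "enc_nat i"] by simp
  then have add: "computes prog f_add [enc_nat i, K] (add (enc_nat i) K) (60 * p)"
    using computes_add_le[of K Z "enc_nat i"] Vertex.prems(2) by (simp add: p_def mult.assoc)
  show ?case
    unfolding enc_wexp.simps enc_list.simps mult.assoc p_def[symmetric]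
    by (rule computesI, simp, rule prog_nth, unfold labels_body_def, rule takes_CondF,
        (rule takes_select takes_rules add | (simp; fail))+)
      (use p in simp_all)
next
  case (DUnion \<phi> \<psi>)
  define p where "p = Z * Z"
  have p: "1 \<le> p"
    using assms(3) by (simp add: p_def)
  have "len (labels \<psi> K) \<le> Z"
    using DUnion.prems(1) len_labels_ge[of "labels \<psi> K" \<phi>] by simp
  then have IH: "computes prog f_labels [enc_wexp \<psi>, K] (labels \<psi> K) (nodes \<psi> * (200 * p))"
    "computes prog f_labels [enc_wexp \<phi>, labels \<psi> K] (labels \<phi> (labels \<psi> K)) (nodes \<phi> * (200 * p))"
    using DUnion.IH(2)[of K] DUnion.IH(1)[of "labels \<psi> K"] DUnion.prems
    by (simp_all add: p_def mult.assoc)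
  show ?case
    unfolding enc_wexp.simps enc_list.simps mult.assoc p_def[symmetric]
    by (rule computesI, simp, rule prog_nth, unfold labels_body_def,
        rule takes_CondT, rule takes_select, simp, rule takes_CondF,
        rule takes_Snd, rule takes_select, simp add: enc_tags,
        (rule takes_select takes_rules IH)+)
      (use p in \<open>simp_all add: algebra_simps\<close>)
next
  case (Relabel i j \<phi>)
  define p where "p = Z * Z"
  have p: "1 \<le> p"
    using assms(3) by (simp add: p_def)
  have len: "len (labels \<phi> K) \<le> Z" "len (add (enc_nat j) (labels \<phi> K)) \<le> Z"
    using Relabel.prems(1) len_add_ge[of "labels \<phi> K" "enc_nat j"]
      len_add_ge[of "add (enc_nat j) (labels \<phi> K)" "enc_nat i"] by auto
  then have IH: "computes prog f_labels [enc_wexp \<phi>, K] (labels \<phi> K) (nodes \<phi> * (200 * p))"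
    using Relabel.IH[of K] Relabel.prems by (simp add: p_def mult.assoc)
  have add: "computes prog f_add [enc_nat j, labels \<phi> K] (add (enc_nat j) (labels \<phi> K)) (60 * p)"
    "computes prog f_add [enc_nat i, add (enc_nat j) (labels \<phi> K)]
      (add (enc_nat i) (add (enc_nat j) (labels \<phi> K))) (60 * p)"
    using computes_add_le[OF len(1), of "enc_nat j"] computes_add_le[OF len(2), of "enc_nat i"]
      Relabel.prems(2) by (simp_all add: p_def mult.assoc)
  show ?case
    unfolding enc_wexp.simps enc_list.simps mult.assoc p_def[symmetric]
    by (rule computesI, simp, rule prog_nth, unfold labels_body_def,
        rule takes_CondT, rule takes_select, simp, rule takes_CondT,
        rule takes_Snd, rule takes_select, simp add: enc_tags,
        (rule takes_select takes_rules IH add)+)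
      (use p in \<open>simp_all add: algebra_simps\<close>)
next
  case (Join i j \<phi>)
  define p where "p = Z * Z"
  have p: "1 \<le> p"
    using assms(3) by (simp add: p_def)
  have len: "len (labels \<phi> K) \<le> Z" "len (add (enc_nat j) (labels \<phi> K)) \<le> Z"
    using Join.prems(1) len_add_ge[of "labels \<phi> K" "enc_nat j"]
      len_add_ge[of "add (enc_nat j) (labels \<phi> K)" "enc_nat i"] by auto
  then have IH: "computes prog f_labels [enc_wexp \<phi>, K] (labels \<phi> K) (nodes \<phi> * (200 * p))"
    using Join.IH[of K] Join.prems by (simp add: p_def mult.assoc)
  have add: "computes prog f_add [enc_nat j, labels \<phi> K] (add (enc_nat j) (labels \<phi> K)) (60 * p)"
    "computes prog f_add [enc_nat i, add (enc_nat j) (labels \<phi> K)]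
      (add (enc_nat i) (add (enc_nat j) (labels \<phi> K))) (60 * p)"
    using computes_add_le[OF len(1), of "enc_nat j"] computes_add_le[OF len(2), of "enc_nat i"]
      Join.prems(2) by (simp_all add: p_def mult.assoc)
  show ?case
    unfolding enc_wexp.simps enc_list.simps mult.assoc p_def[symmetric]
    by (rule computesI, simp, rule prog_nth, unfold labels_body_def,
        rule takes_CondT, rule takes_select, simp, rule takes_CondT,
        rule takes_Snd, rule takes_select, simp add: enc_tags,
        (rule takes_select takes_rules IH add)+)
      (use p in \<open>simp_all add: algebra_simps\<close>)
qed

section \<open>Sizes of states and the cost of table operations\<close>

lemma small_mono: "small m A s \<Longrightarrow> m \<le> m' \<Longrightarrow> A \<le> A' \<Longrightarrow> small m' A' s"
  unfolding small_def using le_trans by blast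

text \<open>The 4 comes from the largest possible value: \<open>Node b one\<close> has size
  \<open>input_size b + 4\<close>.\<close>

lemma small_wf_state:
  assumes wf: "wf_state L s" and A: "\<forall>a\<in>set (items L). input_size a + 4 \<le> A" and L: "label_list L"
  shows "small (len L) A s"
  unfolding small_def
proof (intro conjI ballI)
  show "len s \<le> len L"
    using wf by (metis wf_state_def length_map order_refl)
  fix e
  assume "e \<in> set (items s)"
  then have "e \<in> set (map (\<lambda>a. Node a (assoc s a)) (items L))"
    using wf by (metis wf_state_def)
  then obtain a where a: "a \<in> set (items L)" "e = Node a (assoc s a)"
    by auto
  show "input_size (left e) \<le> A"
    using A a by auto
  have "wf_value L s (assoc s a)"
    using wf a by (simp add: wf_state_def)
  moreover have "5 \<le> A"
    using A a(1) input_size_pos[of a] by fastforce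
  ultimately consider "assoc s a = Leaf" | "assoc s a = one"
    | b where "b \<in> set (items L)" "assoc s a = Node b Leaf \<or> assoc s a = Node b one"
    unfolding wf_value_def by blast
  then show "input_size (right e) \<le> A"
  proof cases
    case (3 b)
    then have "input_size b + 4 \<le> A"
      using A by blast
    with 3 a show ?thesis
      by auto
  qed (use a \<open>5 \<le> A\<close> in auto)
qed

lemma small_fuse:
  "small m A s \<Longrightarrow> \<forall>a\<in>set (items K). input_size a + 2 \<le> A \<Longrightarrow> small m A (fuse K s)"
proof (induction K arbitrary: s)
  case (Node a K)
  then have "small m A (relab s (Node a Leaf) a)"
    by (intro small_relab) auto
  then show ?case
    using Node by simp
qed simp

lemma small_join:
  assumes "small m A s" "1 \<le> A"
  shows "small m A (join s a b)"
  using assms input_size_assoc[OF assms] by (simp add: join_def small_merge)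

lemma small_forget:
  assumes "small m A s" "input_size a \<le> A" "3 \<le> A"
  shows "small m A (forget s a)"
  using assms by (simp add: forget_def small_upd)

lemma forget_table_small:
  assumes "\<forall>e\<in>set (items X). small m A (left e) \<and> input_size (right e) \<le> r"
    and "input_size a \<le> A" "3 \<le> A"
  shows "\<forall>e\<in>set (items (forget_table X a)). small m A (left e) \<and> input_size (right e) \<le> r"
  using assms by (auto simp: set_forget_table small_forget)

lemma input_size_small: "small m A s \<Longrightarrow> input_size s \<le> m * (2 * A + 2) + 1"
proof (induction s arbitrary: m)
  case (Node e s)
  then obtain m' where m: "m = Suc m'" and s: "small m' A s"
    by (cases m) auto
  have "input_size e \<le> 2 * A + 1"
    using Node.prems by (cases e) auto
  with Node.IH(2)[OF s] show ?case
    by (simp add: m)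
qed simp

lemma input_size_enc_replicate: "input_size (enc_list (replicate c Leaf)) = 2 * c + 1"
  by (induction c) auto


lemma input_size_canon:
  assumes "label_list L" "\<forall>a\<in>set (items L). input_size a + 4 \<le> Z"
  shows "input_size (canon L s) \<le> len L * (2 * Z + 2) + 1"
proof (cases "s = Leaf")
  case False
  then show ?thesis
    using input_size_small[OF small_wf_state[OF wf_state_canon assms(2,1)]] by simp
qed simp

text \<open>An entry of a disjoint union still has tagged and untagged labels, hence
  \<open>2 * len L\<close>; a unary counter up to \<open>Z\<close> has size at most
  \<open>2 * Z + 1\<close>. The power \<open>Z ^ 4\<close> is the cost of canonicalisation, cubic in
  the number of labels and linear in their size.\<close>

lemma computes_clean_le:
  assumes L: "label_list L" "\<forall>a\<in>set (items L). input_size a + 4 \<le> Z" "len L \<le> Z"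
    and X: "\<forall>e\<in>set (items X). small (2 * len L) Z (left e) \<and> input_size (right e) \<le> 2 * Z + 1"
    and Z: "1 \<le> Z"
  shows "computes prog f_clean [X, t, L] (clean X t L) (len X * (5000 * Z ^ 4) + 5)"
proof -
  let ?m = "2 * len L"
  have L1: "1 \<le> len L"
    using L(1) by (cases L) (auto simp: label_list_def)
  have LZ: "\<forall>a\<in>set (items L). input_size a \<le> Z"
    using L(2) by auto
  have le: "1 \<le> Z ^ 4" "Z \<le> Z ^ 4" "Z ^ 2 \<le> Z ^ 4" "Z ^ 3 * Z = Z ^ 4"
    using Z power_increasing[of 1 4 Z] power_increasing[of 2 4 Z] by (simp_all add: power_numeral_reduce)
  have len: "len L * Z \<le> Z ^ 2"
    using L(3) by (simp add: power2_eq_square)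
  have "?m ^ 3 * Z \<le> (2 * Z) ^ 3 * Z"
    using L(3) by (intro mult_right_mono power_mono) auto
  also have "\<dots> = 8 * Z ^ 4"
    by (simp add: power_mult_distrib power_numeral_reduce)
  finally have U: "400 * (?m ^ 3 * Z) \<le> 3200 * Z ^ 4"
    by simp
  have V: "len L * (2 * Z + 2) + 1 + (2 * Z + 1) + 1 \<le> 10 * Z ^ 4"
  proof -
    have "len L * (2 * Z + 2) = 2 * (len L * Z) + 2 * len L"
      by simp
    then show ?thesis
      using len le L(3) by linarith
  qed
  have "\<forall>e\<in>set (items X). computes prog f_canon [L, left e] (canon L (left e)) (400 * (?m ^ 3 * Z)) \<and>
    input_size (canon L (left e)) + input_size (right e) + 1 \<le> 10 * Z ^ 4"
  proof
    fix e
    assume e: "e \<in> set (items X)"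
    have "computes prog f_canon [L, left e] (canon L (left e)) (400 * (?m ^ 3 * Z))"
      using X e L1 by (intro computes_canon[OF _ _ LZ _ Z]) auto
    moreover have "input_size (canon L (left e)) + input_size (right e) + 1 \<le> 10 * Z ^ 4"
      using input_size_canon[OF L(1,2), of "left e"] X e V by fastforce
    ultimately show "computes prog f_canon [L, left e] (canon L (left e)) (400 * (?m ^ 3 * Z)) \<and>
      input_size (canon L (left e)) + input_size (right e) + 1 \<le> 10 * Z ^ 4" ..
  qed
  then have "computes prog f_clean [X, t, L] (clean X t L)
    (len X * (400 * (?m ^ 3 * Z) + 80 * (10 * Z ^ 4) + 100) + 5)"
    by (rule computes_clean)
  then show ?thesis
  proof (rule computes_mono[OF _ refl])
    have "400 * (?m ^ 3 * Z) + 80 * (10 * Z ^ 4) + 100 \<le> 5000 * Z ^ 4"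
      using U le by linarith
    then show "len X * (400 * (?m ^ 3 * Z) + 80 * (10 * Z ^ 4) + 100) + 5 \<le> len X * (5000 * Z ^ 4) + 5"
      by (intro add_right_mono mult_left_mono) auto
  qed
qed

text \<open>\<open>M\<close> bounds the length of every table, and \<open>M * M\<close> pays for the
  pairs in a union; the other operations are charged as much to keep one bound per node of the
  expression. The slack of 6 in the label sizes consists of 4 for a value and 2 for a tag.\<close>

lemma computes_table:
  assumes L: "label_list L" "\<forall>a\<in>set (items L). input_size a + 6 \<le> Z" "len L \<le> Z"
    and Ts: "len Ts \<le> Z" and n: "n \<le> Z" and Z: "1 \<le> Z"
    and M: "M = (len L + 3) ^ len L * (n + 1)"
    and "w_expression w \<phi>" "enc_nat ` wlabels \<phi> \<subseteq> set (items L)" "card (wverts \<phi>) \<le> n"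
    and "\<forall>v\<in>wverts \<phi>. input_size (enc_nat v) \<le> Z"
  shows "computes prog f_table [enc_wexp \<phi>, L, Ts] (table L Ts \<phi>) (nodes \<phi> * (30000 * (M * M * Z ^ 4)))"
proof -
  define W where "W = M * M * Z ^ 4"
  have "M \<noteq> 0"
    unfolding M mult_eq_0_iff by simp
  then have M1: "1 \<le> M"
    by simp
  then have MM: "M \<le> M * M"
    by simp
  have L1: "1 \<le> len L"
    using L(1) by (cases L) (auto simp: label_list_def)
  have L4: "\<forall>a\<in>set (items L). input_size a + 4 \<le> Z" and L2: "\<forall>a\<in>set (items L). input_size a + 2 \<le> Z"
    and L4': "\<forall>a\<in>set (items L). input_size a + 4 \<le> Z - 2"
    using L(2) by auto
  have LZ: "input_size a \<le> Z" if "a \<in> set (items L)" for a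
    using L(2) that by auto
  have Z3: "3 \<le> Z"
  proof -
    obtain a where "a \<in> set (items L)"
      using L1 by (cases L) auto
    then show ?thesis
      using L(2) by fastforce
  qed
  have le: "1 \<le> Z ^ 4" "Z \<le> Z ^ 4" "Z ^ 2 \<le> Z ^ 4" "Z ^ 3 \<le> Z ^ 4"
    using Z power_increasing[of 1 4 Z] power_increasing[of 2 4 Z] power_increasing[of 3 4 Z]
    by simp_all
  have LL: "len L * Z \<le> Z ^ 2"
    using L(3) by (simp add: power2_eq_square)
  have W1: "1 \<le> W"
    using M1 le(1) by (simp add: W_def)
  have bound: "a * k \<le> c * W" if "a \<le> M * M" "k \<le> c * Z ^ 4" for a k c
  proof -
    have "a * k \<le> (M * M) * (c * Z ^ 4)"
      using that by (rule mult_mono) auto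
    then show ?thesis
      by (simp add: W_def algebra_simps)
  qed
  have op: "1000 * (len L * Z) + 50 \<le> 1050 * Z ^ 4"
    using LL le by linarith
  have key: "small (len L) (Z - 2) (left k)" "small (len L) Z (left k)" "small (2 * len L) Z (left k)"
    "len (left k) \<le> len L" "len (right k) \<le> card (wverts \<phi>)"
    "input_size (right k) \<le> 2 * card (wverts \<phi>) + 1"
    if k: "wf_key L (card (wverts \<phi>)) k" for k and \<phi> :: "nat wexp"
  proof -
    have wf: "wf_state L (left k)"
      using k by (simp add: wf_key_def)
    show "small (len L) (Z - 2) (left k)"
      by (rule small_wf_state[OF wf L4' L(1)])
    then show "small (len L) Z (left k)" "small (2 * len L) Z (left k)" "len (left k) \<le> len L"
      by (auto intro: small_mono) (simp add: small_def)
    obtain c where "c \<le> card (wverts \<phi>)" "right k = enc_list (replicate c Leaf)"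
      using k by (auto simp: wf_key_def)
    then show "len (right k) \<le> card (wverts \<phi>)" "input_size (right k) \<le> 2 * card (wverts \<phi>) + 1"
      by (simp_all add: input_size_enc_replicate)
  qed
  have len: "len (table L Ts \<phi>) \<le> M"
    if "w_expression w \<phi>" "enc_nat ` wlabels \<phi> \<subseteq> set (items L)" "card (wverts \<phi>) \<le> n" for \<phi>
    unfolding M
    by (rule order_trans[OF len_table_le[OF L(1) that(1,2)] mult_left_mono]) (use that(3) in simp_all)
  \<comment> \<open>The factor \<open>c\<close> is 4 for a join, where each of the two forget steps
    doubles the table, and 1 otherwise.\<close>
  have clean: "computes prog f_clean [X, t, L] (clean X t L) (c * (5000 * W) + 5)"
    if "len X \<le> c * (M * M)"
      "\<forall>e\<in>set (items X). small (2 * len L) Z (left e) \<and> input_size (right e) \<le> 2 * Z + 1" for X t c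
  proof (rule computes_mono[OF computes_clean_le[OF L(1) L4 L(3) that(2) Z] refl])
    have "len X * (5000 * Z ^ 4) \<le> (c * (M * M)) * (5000 * Z ^ 4)"
      using that(1) by (rule mult_right_mono) simp
    then show "len X * (5000 * Z ^ 4) + 5 \<le> c * (5000 * W) + 5"
      by (simp add: W_def algebra_simps)
  qed
  show ?thesis
    unfolding W_def[symmetric] using assms(8-11)
  proof (induction \<phi>)
    case (Vertex i v)
    have "input_size (enc_nat i) \<le> Z"
      using LZ Vertex.prems(2) by simp
    then have "len L * (100 * input_size (enc_nat i) + 200) \<le> Z * (300 * Z)"
      using L(3) Z by (intro mult_mono) auto
    moreover have "len Ts * (100 * input_size (enc_nat v) + 100) \<le> Z * (200 * Z)"
      using Ts Vertex.prems(4) Z by (intro mult_mono) auto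
    moreover have "Z * (300 * Z) + Z * (200 * Z) = 500 * Z ^ 2"
      by (simp add: power2_eq_square)
    moreover have "Z ^ 4 \<le> W"
      using M1 by (simp add: W_def)
    ultimately have cost: "len L * (100 * input_size (enc_nat i) + 200) +
        len Ts * (100 * input_size (enc_nat v) + 100) + 100 \<le> 600 * W"
      using le by linarith
    show ?case
      unfolding enc_wexp.simps enc_list.simps
      by (rule computesI, simp, rule prog_nth, unfold table_body_def, rule takes_CondF,
          (rule takes_select takes_rules computes_mono[OF computes_leaf_table refl cost] | (simp; fail))+)
        (use W1 in simp_all)
  next
    case (DUnion \<phi> \<psi>)
    have pre: "w_expression w \<phi>" "enc_nat ` wlabels \<phi> \<subseteq> set (items L)"
      "w_expression w \<psi>" "enc_nat ` wlabels \<psi> \<subseteq> set (items L)"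
      using DUnion.prems(1,2) by (simp_all add: image_Un)
    have card: "card (wverts \<phi>) + card (wverts \<psi>) \<le> n"
      using DUnion.prems(1,3) by (simp add: card_Un_disjoint)
    then have card': "card (wverts \<phi>) \<le> n" "card (wverts \<psi>) \<le> n"
      by simp_all
    have v: "\<forall>v\<in>wverts \<phi>. input_size (enc_nat v) \<le> Z" "\<forall>v\<in>wverts \<psi>. input_size (enc_nat v) \<le> Z"
      using DUnion.prems(4) by simp_all
    note IH = DUnion.IH(1)[OF pre(1,2) card'(1) v(1)] DUnion.IH(2)[OF pre(3,4) card'(2) v(2)]
    let ?X = "table L Ts \<phi>" and ?Y = "table L Ts \<psi>"
    note X = key[OF wf_key_table(2)[OF L(1) pre(1,2)]] and Y = key[OF wf_key_table(2)[OF L(1) pre(3,4)]]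
    have app: "small (2 * len L) Z (app (left k) (tag (left e)))"
      if "k \<in> set (items ?X)" "e \<in> set (items ?Y)" for k e
    proof -
      have "small (len L) Z (tag (left e))"
        using Z3 by (intro small_mono[OF small_tag[OF Y(1)[OF that(2)]]]) simp_all
      then show ?thesis
        using small_app[OF X(2)[OF that(1)]] unfolding mult_2 by blast
    qed
    have "computes prog f_union_row [k, ?Y, L, Z'] (union_row k ?Y L Z')
        (len ?Y * (len L * (1000 * (2 * len L * Z) + 40) + 5 + 70 * len L + 20 * n + 100) + 5)"
      if k: "k \<in> set (items ?X)" for k Z'
      using X(4,5)[OF k] Y(4) card' L1 app[OF k] L2
      by (intro computes_union_row ballI conjI computes_fuse) (auto intro: le_trans)
    then have "computes prog f_union_table [?X, ?Y, L] (union_table ?X ?Y L) (len ?X *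
        (len ?Y * (len L * (1000 * (2 * len L * Z) + 40) + 5 + 70 * len L + 20 * n + 100) + 5 + 50) + 5)"
      by (intro computes_union_table) blast
    moreover have "len ?X *
        (len ?Y * (len L * (1000 * (2 * len L * Z) + 40) + 5 + 70 * len L + 20 * n + 100) + 5 + 50) + 5
        \<le> 2400 * W"
    proof -
      have "len L * (1000 * (2 * len L * Z) + 40) \<le> Z * (1000 * (2 * Z ^ 2) + 40)"
        using L(3) LL by (intro mult_mono) auto
      also have "\<dots> = 2000 * Z ^ 3 + 40 * Z"
        by (simp add: power_numeral_reduce algebra_simps)
      finally have "len L * (1000 * (2 * len L * Z) + 40) + 5 + 70 * len L + 20 * n + 100 \<le> 2300 * Z ^ 4"
        using le L(3) n by linarith
      then have "len ?Y * (len L * (1000 * (2 * len L * Z) + 40) + 5 + 70 * len L + 20 * n + 100) \<le>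
          M * (2300 * Z ^ 4)"
        using len[OF pre(3,4) card'(2)] by (intro mult_mono) auto
      moreover have "1 \<le> M * Z ^ 4"
        using M1 le(1) by simp
      ultimately have "len ?Y * (len L * (1000 * (2 * len L * Z) + 40) + 5 + 70 * len L + 20 * n + 100)
          + 5 + 50 \<le> 2360 * (M * Z ^ 4)"
        by linarith
      then have "len ?X * (len ?Y * (len L * (1000 * (2 * len L * Z) + 40) + 5 + 70 * len L + 20 * n + 100)
          + 5 + 50) \<le> M * (2360 * (M * Z ^ 4))"
        using len[OF pre(1,2) card'(1)] by (intro mult_mono) auto
      also have "\<dots> = 2360 * W"
        by (simp add: W_def)
      finally show ?thesis
        using W1 by linarith
    qed
    ultimately have union: "computes prog f_union_table [?X, ?Y, L] (union_table ?X ?Y L) (2400 * W)"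
      by (rule computes_mono[OF _ refl])
    have "len (union_table ?X ?Y L) \<le> 1 * (M * M)"
      using len[OF pre(1,2) card'(1)] len[OF pre(3,4) card'(2)]
      by (simp add: len_union_table mult_mono)
    moreover have "\<forall>e\<in>set (items (union_table ?X ?Y L)).
        small (2 * len L) Z (left e) \<and> input_size (right e) \<le> 2 * Z + 1"
    proof
      fix u
      assume "u \<in> set (items (union_table ?X ?Y L))"
      then obtain k e where u: "k \<in> set (items ?X)" "e \<in> set (items ?Y)"
        "u = Node (fuse L (app (left k) (tag (left e)))) (app (right k) (right e))"
        by (auto simp: items_union_table)
      obtain c d where "right k = enc_list (replicate c Leaf)" "right e = enc_list (replicate d Leaf)"
        "c \<le> card (wverts \<phi>)" "d \<le> card (wverts \<psi>)"
        using wf_key_table(2)[OF L(1) pre(1,2) u(1)] wf_key_table(2)[OF L(1) pre(3,4) u(2)]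
        by (auto simp: wf_key_def)
      then have "input_size (right u) \<le> 2 * Z + 1"
        using u(3) card n input_size_enc_replicate[of "c + d"] by (simp add: replicate_add)
      then show "small (2 * len L) Z (left u) \<and> input_size (right u) \<le> 2 * Z + 1"
        using small_fuse[OF app[OF u(1,2)] L2] u(3) by simp
    qed
    ultimately have "computes prog f_clean [union_table ?X ?Y L, Leaf, L] (clean (union_table ?X ?Y L) Leaf L)
        (1 * (5000 * W) + 5)"
      by (rule clean)
    note rules = IH union this
    show ?case
      unfolding enc_wexp.simps enc_list.simps
      by (rule computesI, simp, rule prog_nth, unfold table_body_def,
          rule takes_CondT, rule takes_select, simp, rule takes_CondF,
          rule takes_Snd, rule takes_select, simp add: enc_tags,
          (rule takes_select takes_rules rules)+)
        (use W1 in \<open>simp_all add: algebra_simps\<close>)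
  next
    case (Relabel i j \<phi>)
    have pre: "w_expression w \<phi>" "enc_nat ` wlabels \<phi> \<subseteq> set (items L)" "card (wverts \<phi>) \<le> n"
      using Relabel.prems(1-3) by simp_all
    have IH: "computes prog f_table [enc_wexp \<phi>, L, Ts] (table L Ts \<phi>) (nodes \<phi> * (30000 * W))"
      using Relabel.IH[OF pre] Relabel.prems(4) by simp
    let ?X = "table L Ts \<phi>" and ?a = "enc_nat i" and ?b = "enc_nat j"
    note X = key[OF wf_key_table(2)[OF L(1) pre(1,2)]]
    have ab: "input_size ?a \<le> Z" "input_size ?b \<le> Z"
      using LZ Relabel.prems(2) by simp_all
    have "computes prog f_relab_table [?X, ?a, ?b] (relab_table ?X ?a ?b) (len ?X * (1000 * (len L * Z) + 50) + 5)"
      by (intro computes_relab_table ballI computes_relab[OF X(2) L1 ab])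
    from computes_mono[OF this refl]
    have relab: "computes prog f_relab_table [?X, ?a, ?b] (relab_table ?X ?a ?b) (1050 * W + 5)"
      using bound[OF le_trans[OF len[OF pre] MM] op] by simp
    have "len (relab_table ?X ?a ?b) \<le> 1 * (M * M)"
      using le_trans[OF len[OF pre] MM] by (simp add: items_relab_table)
    moreover have "\<forall>e\<in>set (items (relab_table ?X ?a ?b)).
        small (2 * len L) Z (left e) \<and> input_size (right e) \<le> 2 * Z + 1"
      using X(3,6) pre(3) n ab by (fastforce simp: items_relab_table intro: small_relab)
    ultimately have "computes prog f_clean [relab_table ?X ?a ?b, Leaf, L] (clean (relab_table ?X ?a ?b) Leaf L)
        (1 * (5000 * W) + 5)"
      by (rule clean)
    note rules = IH relab this
    show ?case
      unfolding enc_wexp.simps enc_list.simps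
      by (rule computesI, simp, rule prog_nth, unfold table_body_def,
          rule takes_CondT, rule takes_select, simp, rule takes_CondT,
          rule takes_Snd, rule takes_select, simp add: enc_tags, rule takes_CondF,
          rule takes_Fst, rule takes_select, simp add: enc_tags,
          (rule takes_select takes_rules rules)+)
        (use W1 in \<open>simp_all add: algebra_simps\<close>)
  next
    case (Join i j \<phi>)
    have pre: "w_expression w \<phi>" "enc_nat ` wlabels \<phi> \<subseteq> set (items L)" "card (wverts \<phi>) \<le> n"
      using Join.prems(1-3) by simp_all
    have IH: "computes prog f_table [enc_wexp \<phi>, L, Ts] (table L Ts \<phi>) (nodes \<phi> * (30000 * W))"
      using Join.IH[OF pre] Join.prems(4) by simp
    let ?X = "table L Ts \<phi>" and ?a = "enc_nat i" and ?b = "enc_nat j"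
    let ?J = "join_table ?X ?a ?b"
    let ?F = "forget_table ?J ?a"
    note X = key[OF wf_key_table(2)[OF L(1) pre(1,2)]]
    have ab: "input_size ?a \<le> Z" "input_size ?b \<le> Z"
      using LZ Join.prems(2) by simp_all
    have J: "small (len L) Z (left e) \<and> input_size (right e) \<le> 2 * Z + 1" if "e \<in> set (items ?J)" for e
      using that X(2,6) pre(3) n by (fastforce simp: items_join_table intro: small_join[OF _ Z])
    have F: "small (len L) Z (left e) \<and> input_size (right e) \<le> 2 * Z + 1" if "e \<in> set (items ?F)" for e
      using forget_table_small[of ?J, OF _ ab(1) Z3] J that by blast
    have "computes prog f_join_table [?X, ?a, ?b] ?J (len ?X * (1000 * (len L * Z) + 50) + 5)"
      by (intro computes_join_table ballI computes_join[OF X(2) L1 ab])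
    from computes_mono[OF this refl]
    have join: "computes prog f_join_table [?X, ?a, ?b] ?J (1050 * W + 5)"
      using bound[OF le_trans[OF len[OF pre] MM] op] by simp
    have lenJ: "len ?J \<le> M * M"
      using le_trans[OF len[OF pre] MM] by (simp add: items_join_table)
    have "computes prog f_forget_table [?J, ?a] ?F (len ?J * (1000 * (len L * Z) + 50) + 5)"
      using J by (intro computes_forget_table ballI computes_forget[OF _ L1 ab(1)]) blast
    from computes_mono[OF this refl]
    have forget1: "computes prog f_forget_table [?J, ?a] ?F (1050 * W + 5)"
      using bound[OF lenJ op] by simp
    have "computes prog f_forget_table [?F, ?b] (forget_table ?F ?b) (len ?F * (1000 * (len L * Z) + 50) + 5)"
      using F by (intro computes_forget_table ballI computes_forget[OF _ L1 ab(2)]) blast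
    note mono = computes_mono[OF this refl]
    have forget2: "computes prog f_forget_table [?F, ?b] (forget_table ?F ?b) (2100 * W + 5)"
    proof -
      have "len ?F * (1000 * (len L * Z) + 50) = 2 * (len ?J * (1000 * (len L * Z) + 50))"
        by (simp add: len_forget_table)
      then have "len ?F * (1000 * (len L * Z) + 50) + 5 \<le> 2100 * W + 5"
        using bound[OF lenJ op] by linarith
      then show ?thesis
        by (rule mono)
    qed
    have "len (forget_table ?F ?b) \<le> 4 * (M * M)"
      using lenJ by (simp add: len_forget_table)
    moreover have "\<forall>e\<in>set (items (forget_table ?F ?b)).
        small (2 * len L) Z (left e) \<and> input_size (right e) \<le> 2 * Z + 1"
    proof
      fix e
      assume "e \<in> set (items (forget_table ?F ?b))"
      then have "small (len L) Z (left e) \<and> input_size (right e) \<le> 2 * Z + 1"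
        using forget_table_small[of ?F, OF _ ab(2) Z3] F by blast
      then show "small (2 * len L) Z (left e) \<and> input_size (right e) \<le> 2 * Z + 1"
        using small_mono by auto
    qed
    ultimately have "computes prog f_clean [forget_table ?F ?b, Leaf, L] (clean (forget_table ?F ?b) Leaf L)
        (4 * (5000 * W) + 5)"
      by (rule clean)
    note rules = IH join forget1 forget2 this
    show ?case
      unfolding enc_wexp.simps enc_list.simps
      by (rule computesI, simp, rule prog_nth, unfold table_body_def,
          rule takes_CondT, rule takes_select, simp, rule takes_CondT,
          rule takes_Snd, rule takes_select, simp add: enc_tags, rule takes_CondT,
          rule takes_Fst, rule takes_select, simp add: enc_tags,
          (rule takes_select takes_rules rules)+)
        (use W1 in \<open>simp_all add: algebra_simps\<close>)
  qed
qed

lemma len_le_input_size: "len x \<le> input_size x"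
  by (induction x) auto

lemma input_size_enc_wexp:
  "i \<in> wlabels \<phi> \<Longrightarrow> input_size (enc_nat i) \<le> input_size (enc_wexp \<phi>)"
  "v \<in> wverts \<phi> \<Longrightarrow> input_size (enc_nat v) \<le> input_size (enc_wexp \<phi>)"
  "nodes \<phi> \<le> input_size (enc_wexp \<phi>)"
  "len (labels \<phi> K) \<le> len K + input_size (enc_wexp \<phi>)"
proof -
  show "i \<in> wlabels \<phi> \<Longrightarrow> input_size (enc_nat i) \<le> input_size (enc_wexp \<phi>)"
    "v \<in> wverts \<phi> \<Longrightarrow> input_size (enc_nat v) \<le> input_size (enc_wexp \<phi>)"
    "nodes \<phi> \<le> input_size (enc_wexp \<phi>)"
    by (induction \<phi>) auto
  have add: "len (add x K) \<le> len K + 1" for x K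
    by (simp add: add_def)
  show "len (labels \<phi> K) \<le> len K + input_size (enc_wexp \<phi>)"
  proof (induction \<phi> arbitrary: K)
    case (Vertex i v)
    show ?case
      using add[of "enc_nat i" K] by simp
  next
    case (DUnion \<phi> \<psi>)
    show ?case
      using DUnion.IH(1)[of "labels \<psi> K"] DUnion.IH(2)[of K] by simp
  next
    case (Relabel i j \<phi>)
    show ?case
      using Relabel.IH[of K] add[of "enc_nat j" "labels \<phi> K"]
        add[of "enc_nat i" "add (enc_nat j) (labels \<phi> K)"] by simp
  next
    case (Join i j \<phi>)
    show ?case
      using Join.IH[of K] add[of "enc_nat j" "labels \<phi> K"]
        add[of "enc_nat i" "add (enc_nat j) (labels \<phi> K)"] by simp
  qed
qed

lemma card_wverts_le: "card (wverts \<phi>) \<le> nodes \<phi>"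
proof (induction \<phi>)
  case (DUnion \<phi> \<psi>)
  then show ?case
    using card_Un_le[of "wverts \<phi>" "wverts \<psi>"] by simp
qed auto

text \<open>A negative \<open>k\<close> is rejected on reading its sign; otherwise the stored
  magnitude is \<open>nat k\<close> and can be passed on as it is.\<close>

lemma computes_main:
  fixes k :: int
  assumes "computes prog f_labels [enc_wexp \<phi>, Leaf] L b1" "computes prog f_table [enc_wexp \<phi>, L, Ts] X b2"
    "computes prog f_accept [X, enc_nat (nat k)] (enc_bool r) b3"
  shows "computes prog 0 [enc_list [vs, es, Ts, enc_int k, enc_wexp \<phi>]] (enc_bool (0 \<le> k \<and> r))
    (b1 + b2 + b3 + 50)"
proof (cases "k < 0")
  case True
  show ?thesis
    unfolding enc_list.simps
    by (rule computesI, simp, rule prog_nth, unfold main_body_def, rule takes_CondT,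
        rule takes_Fst, rule takes_select, simp add: enc_int_def True, rule takes_rules)
      (use True in simp_all)
next
  case False
  then have k: "enc_int k = Node Leaf (enc_nat (nat k))"
    by (simp add: enc_int_def)
  have snd: "takes prog (Node x0 (Node x1 (Node x2 (Node (Node z y) xs))) # env)
      (Snd (Fst (Snd (Snd (Snd (Var 0)))))) y 6" for x0 x1 x2 z y xs env
    by (rule takes_mono, rule takes_Snd, rule takes_select, simp_all)
  show ?thesis
    unfolding enc_list.simps k
    by (rule computesI, simp, rule prog_nth, unfold main_body_def, rule takes_CondF,
        rule takes_Fst, rule takes_select, simp,
        (rule snd takes_select takes_rules assms)+)
      (use False in simp_all)
qed

theorem runs_in_time:
  fixes T :: "nat set"
  assumes w: "w_expression w \<phi>" and T: "T \<subseteq> wverts \<phi>" and enc: "encodes x (wgraph \<phi>) T k \<phi>"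
  shows "\<exists>t. runs prog x (enc_bool (node_multiway_cut (wgraph \<phi>) T k)) t \<and>
    t \<le> 200000 * (w + 3) ^ (2 * w) * input_size x ^ 7"
proof -
  obtain vs es ts where x: "set ts = T"
    "x = enc_list [enc_nats vs, enc_arcs es, enc_nats ts, enc_int k, enc_wexp \<phi>]"
    using enc by (auto simp: encodes_def)
  let ?L = "labels \<phi> Leaf" and ?Ts = "enc_nats ts"
  define Z where "Z = input_size x"
  define n where "n = card (wverts \<phi>)"
  define m where "m = len ?L"
  define M where "M = (m + 3) ^ m * (n + 1)"
  note L = label_list_labels[OF w]
  have set: "set (items ?L) = enc_nat ` wlabels \<phi>"
    by (simp add: set_labels)
  \<comment> \<open>The 10 consists of the list's five nodes and final leaf, plus at least 1 for
    each of the other four components. It covers the slack of 6 required for the labels.\<close>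
  have Z: "input_size (enc_wexp \<phi>) + 10 \<le> Z" "input_size ?Ts \<le> Z" "input_size (enc_int k) \<le> Z"
    using input_size_pos[of "enc_nats vs"] input_size_pos[of "enc_arcs es"]
      input_size_pos[of ?Ts] input_size_pos[of "enc_int k"]
    unfolding Z_def x(2) enc_list.simps input_size.simps by linarith+
  have Z1: "1 \<le> Z"
    using Z(1) by simp
  have LA: "\<forall>a\<in>set (items ?L). input_size a + 6 \<le> Z"
    unfolding set using input_size_enc_wexp(1)[of _ \<phi>] Z(1) by fastforce
  have mZ: "m \<le> Z"
    using input_size_enc_wexp(4)[of \<phi> Leaf] Z(1) by (simp add: m_def)
  have nodes: "nodes \<phi> \<le> Z"
    using input_size_enc_wexp(3)[of \<phi>] Z(1) by simp
  have nZ: "n \<le> Z"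
    using card_wverts_le[of \<phi>] nodes by (simp add: n_def)
  have TsZ: "len ?Ts \<le> Z"
    using len_le_input_size[of ?Ts] Z(2) by simp
  have kZ: "len (enc_nat (nat k)) \<le> Z" if "0 \<le> k"
    using len_le_input_size[of "enc_nat (nat k)"] Z(3) that by (simp add: enc_int_def)
  have Ts: "v \<in> T \<longleftrightarrow> enc_nat v \<in> set (items ?Ts)" for v
    using x(1) by (auto simp: enc_nats_def)
  have M1: "1 \<le> M"
  proof -
    have "M \<noteq> 0"
      unfolding M_def mult_eq_0_iff by simp
    then show ?thesis by simp
  qed
  let ?X = "table ?L ?Ts \<phi>"
  have b1: "computes prog f_labels [enc_wexp \<phi>, Leaf] ?L (nodes \<phi> * (200 * Z * Z))"
    using mZ input_size_enc_wexp(1)[of _ \<phi>] Z(1) Z1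
    by (intro computes_labels ballI) (fastforce simp: m_def)+
  have b2: "computes prog f_table [enc_wexp \<phi>, ?L, ?Ts] ?X (nodes \<phi> * (30000 * (M * M * Z ^ 4)))"
    using w mZ TsZ nZ Z1 input_size_enc_wexp(2)[of _ \<phi>] Z(1) LA L(1)
    by (intro computes_table[where n = n]) (fastforce simp: set m_def n_def M_def)+
  have lab: "enc_nat ` wlabels \<phi> \<subseteq> set (items ?L)"
    by (simp add: set)
  have "\<forall>e\<in>set (items ?X). len (right e) \<le> n"
    using wf_key_table(2)[OF L(1) w lab] by (fastforce simp: wf_key_def n_def)
  then have b3: "computes prog f_accept [?X, enc_nat (nat k)] (enc_bool (accept ?X (enc_nat (nat k))))
      (len ?X * (len (enc_nat (nat k)) * (20 * n + 30) + 40) + 5)"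
    by (rule computes_accept)
  have kZ': "len (enc_nat (nat k)) \<le> Z"
    using kZ by (cases "0 \<le> k") auto
  have lenX: "len ?X \<le> M"
    using len_table_le[OF L(1) w lab] by (simp add: M_def m_def n_def)
  \<comment> \<open>One power of \<open>Z\<close> more than in the cost per node, as
    \<open>Z\<close> also bounds the number of nodes of the expression.\<close>
  define W where "W = M * M * Z ^ 5"
  have W: "nodes \<phi> * (200 * Z * Z) \<le> 200 * W" "nodes \<phi> * (30000 * (M * M * Z ^ 4)) \<le> 30000 * W"
    "len ?X * (len (enc_nat (nat k)) * (20 * n + 30) + 40) \<le> 90 * W" "1 \<le> W"
  proof -
    have MM: "1 \<le> M * M" "M \<le> M * M"
      using M1 by auto
    have Zp: "1 \<le> Z ^ 5" "Z ^ 2 \<le> Z ^ 5" "Z ^ 3 \<le> Z ^ 5"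
      using Z1 power_increasing[of 2 5 Z] power_increasing[of 3 5 Z] by simp_all
    have "nodes \<phi> * (200 * Z * Z) \<le> Z * (200 * Z * Z)"
      using nodes by (rule mult_right_mono) simp
    also have "\<dots> = 1 * (200 * Z ^ 3)"
      by (simp add: power_numeral_reduce)
    also have "\<dots> \<le> (M * M) * (200 * Z ^ 5)"
      using MM Zp by (intro mult_mono) auto
    finally show "nodes \<phi> * (200 * Z * Z) \<le> 200 * W"
      by (simp add: W_def)
    have "nodes \<phi> * (30000 * (M * M * Z ^ 4)) \<le> Z * (30000 * (M * M * Z ^ 4))"
      using nodes by (rule mult_right_mono) simp
    also have "\<dots> = 30000 * W"
      by (simp add: W_def power_numeral_reduce)
    finally show "nodes \<phi> * (30000 * (M * M * Z ^ 4)) \<le> 30000 * W" .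
    have "len (enc_nat (nat k)) * (20 * n + 30) \<le> Z * (50 * Z)"
      using kZ' nZ Z1 by (intro mult_mono) auto
    also have "\<dots> = 50 * Z ^ 2"
      by (simp add: power2_eq_square)
    finally have "len (enc_nat (nat k)) * (20 * n + 30) + 40 \<le> 90 * Z ^ 5"
      using Zp by linarith
    then have "len ?X * (len (enc_nat (nat k)) * (20 * n + 30) + 40) \<le> (M * M) * (90 * Z ^ 5)"
      using le_trans[OF lenX MM(2)] by (intro mult_mono) auto
    then show "len ?X * (len (enc_nat (nat k)) * (20 * n + 30) + 40) \<le> 90 * W"
      by (simp add: W_def)
    show "1 \<le> W"
      unfolding W_def using mult_mono[OF MM(1) Zp(1)] by simp
  qed
  have "computes prog 0 [x] (enc_bool (node_multiway_cut (wgraph \<phi>) T k)) (40000 * W)"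
    unfolding x(2) table_correct[OF w Ts T]
    by (rule computes_mono[OF computes_main[OF b1 b2 b3] refl]) (use W in linarith)
  then have "takes prog [x] (Call 0 [Var 0]) (enc_bool (node_multiway_cut (wgraph \<phi>) T k))
      (1 + 0 + 40000 * W + 1)"
    by (rule takes_Call[OF takes_list_Cons[OF takes_Var(1) takes_list_Nil]])
  then obtain t where t: "runs prog x (enc_bool (node_multiway_cut (wgraph \<phi>) T k)) t"
    "t \<le> 1 + 0 + 40000 * W + 1"
    unfolding takes_def runs_def by blast
  \<comment> \<open>The passage from the occurring labels to \<open>w\<close>, with
    \<open>n + 1 \<le> 2 * Z\<close>. Squaring adds two powers of \<open>Z\<close> to the five in
    \<open>W\<close>, which gives the exponent 7.\<close>
  have "M \<le> (w + 3) ^ w * (2 * Z)"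
  proof -
    have "(m + 3) ^ m \<le> (w + 3) ^ m"
      using L(2) by (intro power_mono) (simp_all add: m_def)
    also have "\<dots> \<le> (w + 3) ^ w"
      using L(2) by (intro power_increasing) (simp_all add: m_def)
    finally show ?thesis
      unfolding M_def using nZ Z1 by (intro mult_mono) auto
  qed
  then have "M * M \<le> ((w + 3) ^ w * (2 * Z)) * ((w + 3) ^ w * (2 * Z))"
    by (intro mult_mono) auto
  then have "W \<le> ((w + 3) ^ w * (2 * Z)) * ((w + 3) ^ w * (2 * Z)) * Z ^ 5"
    unfolding W_def by (rule mult_right_mono) simp
  also have "\<dots> = 4 * ((w + 3) ^ (2 * w) * Z ^ 7)"
  proof -
    have "(w + 3) ^ (2 * w) = (w + 3) ^ w * (w + 3) ^ w" "Z ^ 7 = Z * Z * Z ^ 5"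
      by (simp_all add: mult_2 power_add power_numeral_reduce)
    then show ?thesis
      by simp
  qed
  finally have "W \<le> 4 * ((w + 3) ^ (2 * w) * Z ^ 7)" .
  then have "t \<le> 200000 * ((w + 3) ^ (2 * w) * Z ^ 7)"
    using t(2) W(4) by linarith
  then show ?thesis
    using t(1) by (auto simp: Z_def mult.assoc)
qed

theorem theorem7:
  shows "\<exists>P :: program. \<exists>(c :: nat) (C :: nat \<Rightarrow> nat).
    \<forall>(G :: nat pair_pre_digraph) (T :: nat set) (k :: int) (w :: nat) (\<phi> :: nat wexp) (x :: data).
      pair_graph G \<and> T \<subseteq> pverts G \<and> w_expression w \<phi> \<and> wgraph \<phi> = G \<and> encodes x G T k \<phi> \<longrightarrow>
      (let n = card (pverts G) in
       \<exists>t. runs P x (enc_bool (node_multiway_cut G T k)) t \<and>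
           t \<le> c * (w + 3) ^ (2 * w) * input_size x ^ c \<and>
           (\<forall>d. input_size x \<le> d * n ^ d \<longrightarrow> t \<le> C d * (w + 3) ^ (2 * w) * n ^ C d))"
proof -
  obtain c :: nat where c: "\<And>w \<phi> T x k. w_expression w \<phi> \<Longrightarrow> T \<subseteq> wverts \<phi> \<Longrightarrow>
    encodes x (wgraph \<phi>) T k \<phi> \<Longrightarrow>
    \<exists>t. runs prog x (enc_bool (node_multiway_cut (wgraph \<phi>) T k)) t \<and>
      t \<le> c * (w + 3) ^ (2 * w) * input_size x ^ c"
  proof (rule that[of 200000])
    fix w \<phi> x k and T :: "nat set"
    assume "w_expression w \<phi>" "T \<subseteq> wverts \<phi>" "encodes x (wgraph \<phi>) T k \<phi>"
    then obtain t where t: "runs prog x (enc_bool (node_multiway_cut (wgraph \<phi>) T k)) t"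
      "t \<le> 200000 * (w + 3) ^ (2 * w) * input_size x ^ 7"
      using runs_in_time by blast
    \<comment> \<open>The same constant serves as factor and as exponent, so the exponent is raised
      to the size of the factor.\<close>
    have "input_size x ^ 7 \<le> input_size x ^ 200000"
      by (rule power_increasing[OF _ input_size_pos]) simp
    then have "t \<le> 200000 * (w + 3) ^ (2 * w) * input_size x ^ 200000"
      using t(2) by (meson le_trans mult_left_mono zero_le)
    with t(1) show "\<exists>t. runs prog x (enc_bool (node_multiway_cut (wgraph \<phi>) T k)) t \<and>
        t \<le> 200000 * (w + 3) ^ (2 * w) * input_size x ^ 200000"
      by blast
  qed
  \<comment> \<open>With the input size at most \<open>d * n ^ d\<close>, the factor becomes
    \<open>c * d ^ c\<close> and the exponent of \<open>n\<close> becomes \<open>d * c\<close>.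
    Their sum can play both roles.\<close>
  define C where "C d = c * d ^ c + d * c" for d
  show ?thesis
  proof (intro exI[of _ prog] exI[of _ c] exI[of _ C] allI impI)
    fix G :: "nat pair_pre_digraph" and T :: "nat set" and k w \<phi> x
    assume A: "pair_graph G \<and> T \<subseteq> pverts G \<and> w_expression w \<phi> \<and> wgraph \<phi> = G \<and> encodes x G T k \<phi>"
    then have G: "G = wgraph \<phi>" and V: "pverts G = wverts \<phi>"
      by (auto simp: wgraph_def)
    obtain t where t: "runs prog x (enc_bool (node_multiway_cut G T k)) t"
      "t \<le> c * (w + 3) ^ (2 * w) * input_size x ^ c"
      using c[of w \<phi> T x k] A V unfolding G by auto
    define n where "n = card (pverts G)"
    \<comment> \<open>Every expression creates a vertex, so enlarging the exponent of
      \<open>n\<close> does not lower the bound.\<close>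
    have n: "1 \<le> n"
      unfolding n_def V by (induction \<phi>) (auto simp: Suc_le_eq card_gt_0_iff)
    have "t \<le> C d * (w + 3) ^ (2 * w) * n ^ C d" if d: "input_size x \<le> d * n ^ d" for d
    proof -
      have "input_size x ^ c \<le> (d * n ^ d) ^ c"
        using d by (rule power_mono) simp
      also have "\<dots> = d ^ c * n ^ (d * c)"
        by (simp add: power_mult_distrib power_mult)
      finally have "t \<le> c * (w + 3) ^ (2 * w) * (d ^ c * n ^ (d * c))"
        using t(2) by (meson le_trans mult_left_mono zero_le)
      also have "\<dots> = c * d ^ c * (w + 3) ^ (2 * w) * n ^ (d * c)"
        by simp
      also have "\<dots> \<le> C d * (w + 3) ^ (2 * w) * n ^ C d"
        using n by (intro mult_mono power_increasing) (simp_all add: C_def)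
      finally show ?thesis .
    qed
    then show "let n = card (pverts G) in
       \<exists>t. runs prog x (enc_bool (node_multiway_cut G T k)) t \<and>
           t \<le> c * (w + 3) ^ (2 * w) * input_size x ^ c \<and>
           (\<forall>d. input_size x \<le> d * n ^ d \<longrightarrow> t \<le> C d * (w + 3) ^ (2 * w) * n ^ C d)"
      unfolding Let_def n_def using t by blast
  qed
qed

end
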